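(* Let $k$ be a field of characteristic $\ne 2$ with algebraic closure $\bar k$, and let $d, d' \in k\setminus\{0,1\}$. Fix $d^{1/4}\in\bar k$ with $(d^{1/4})^4 = d$ and $\sqrt{-1}\in\bar k$. Then $E_d$ and $E_{d'}$ are isomorphic over $\bar k$ if and only if $$d' \in \left\{d,\ \frac1d,\ \left(\frac{1\pm d^{1/4}}{1\mp d^{1/4}}\right)^4,\ \left(\frac{1\pm\sqrt{-1}\,d^{1/4}}{1\mp\sqrt{-1}\,d^{1/4}}\right)^4\right\}.$$
   Context: For $c\in k\setminus\{0,1\}$, $E_c$ denotes the Edwards elliptic curve, the desingularization of the projective closure of $x^2+y^2 = 1+cx^2y^2$. *)

theory Defs
  imports
    "HOL-Algebra.Algebraic_Closure_Type"
    "HOL-Analysis.Abstract_Topology"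
begin

section \<open>Spaces with functions\<close>

text \<open>
  A variety over an algebraically closed field \<open>'a\<close> is represented, in the classical way, by its
  Zariski topology together with the \<open>'a\<close>-valued regular functions on each open set. Functions on
  \<open>U\<close> are normalised to be \<open>undefined\<close> outside \<open>U\<close>.
\<close>

record ('p, 'a) function_space =
  zariski :: "'p topology"
  regular :: "'p set \<Rightarrow> ('p \<Rightarrow> 'a) set"

definition morphism ::
    "('p, 'a) function_space \<Rightarrow> ('q, 'a) function_space \<Rightarrow> ('p \<Rightarrow> 'q) \<Rightarrow> bool"
  where "morphism M N \<phi> \<longleftrightarrow>
    continuous_map (zariski M) (zariski N) \<phi> \<and>
    (\<forall>U f. openin (zariski N) U \<longrightarrow> f \<in> regular N U \<longrightarrow>
      (let V = {p \<in> topspace (zariski M). \<phi> p \<in> U} in restrict (f \<circ> \<phi>) V \<in> regular M V))"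

definition isomorphic :: "('p, 'a) function_space \<Rightarrow> ('q, 'a) function_space \<Rightarrow> bool"
  where "isomorphic M N \<longleftrightarrow>
    (\<exists>\<phi> \<psi>. morphism M N \<phi> \<and> morphism N M \<psi> \<and>
      (\<forall>p \<in> topspace (zariski M). \<psi> (\<phi> p) = p) \<and>
      (\<forall>q \<in> topspace (zariski N). \<phi> (\<psi> q) = q))"


section \<open>Plane projective curves and their function fields\<close>

text \<open>
  Homogeneous forms of degree \<open>n\<close> in three variables, as functions; over an infinite field these
  are the same as homogeneous polynomials.
\<close>

definition forms :: "nat \<Rightarrow> ('a::field \<times> 'a \<times> 'a \<Rightarrow> 'a) set"
  where "forms n = {f. \<exists>a. f = (\<lambda>(x, y, z). \<Sum>i\<le>n. \<Sum>j\<le>n - i. a i j * x ^ i * y ^ j * z ^ (n - i - j))}"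

text \<open>
  A subset of the projective plane is represented by the set of all (nonzero) homogeneous
  coordinate vectors of its points. The affine plane sits inside as \<open>z = 1\<close>, and the projective
  closure is the Zariski closure of the image.
\<close>

definition projective_closure :: "('a::field \<times> 'a) set \<Rightarrow> ('a \<times> 'a \<times> 'a) set"
  where "projective_closure Z =
    {p. p \<noteq> (0, 0, 0) \<and> (\<forall>n. \<forall>f \<in> forms n. (\<forall>(x, y) \<in> Z. f (x, y, 1) = 0) \<longrightarrow> f p = 0)}"

text \<open>
  For an irreducible curve \<open>C\<close> the function field consists of the quotients \<open>f / g\<close> of forms of the
  same degree, \<open>g\<close> not vanishing identically on \<open>C\<close>, two such quotients being identified
  if they agree on \<open>C\<close>.
\<close>

definition fractions ::
    "('a::field \<times> 'a \<times> 'a) set \<Rightarrow> (('a \<times> 'a \<times> 'a \<Rightarrow> 'a) \<times> ('a \<times> 'a \<times> 'a \<Rightarrow> 'a)) set"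
  where "fractions C = {(f, g). \<exists>n. f \<in> forms n \<and> g \<in> forms n \<and> (\<exists>p \<in> C. g p \<noteq> 0)}"

definition fraction_rel ::
    "('a::field \<times> 'a \<times> 'a) set \<Rightarrow> (('a \<times> 'a \<times> 'a \<Rightarrow> 'a) \<times> ('a \<times> 'a \<times> 'a \<Rightarrow> 'a)) rel"
  where "fraction_rel C =
    {((f, g), (f', g')). (f, g) \<in> fractions C \<and> (f', g') \<in> fractions C \<and>
       (\<forall>p \<in> C. f p * g' p = f' p * g p)}"

type_synonym 'a rational_function = "(('a \<times> 'a \<times> 'a \<Rightarrow> 'a) \<times> ('a \<times> 'a \<times> 'a \<Rightarrow> 'a)) set"

definition ratio ::
    "('a::field \<times> 'a \<times> 'a) set \<Rightarrow> ('a \<times> 'a \<times> 'a \<Rightarrow> 'a) \<Rightarrow> ('a \<times> 'a \<times> 'a \<Rightarrow> 'a) \<Rightarrow> 'a rational_function"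
  where "ratio C f g = fraction_rel C `` {(f, g)}"

definition const_ratio :: "('a::field \<times> 'a \<times> 'a) set \<Rightarrow> 'a \<Rightarrow> 'a rational_function"
  where "const_ratio C a = ratio C (\<lambda>_. a) (\<lambda>_. 1)"

definition function_field :: "('a::field \<times> 'a \<times> 'a) set \<Rightarrow> 'a rational_function ring"
  where "function_field C =
    \<lparr>carrier = fractions C // fraction_rel C,
     monoid.mult = (\<lambda>A B. \<Union>(f, g) \<in> A. \<Union>(f', g') \<in> B. ratio C (\<lambda>p. f p * f' p) (\<lambda>p. g p * g' p)),
     one = const_ratio C 1,
     ring.zero = const_ratio C 0,
     add = (\<lambda>A B. \<Union>(f, g) \<in> A. \<Union>(f', g') \<in> B.
       ratio C (\<lambda>p. f p * g' p + f' p * g p) (\<lambda>p. g p * g' p))\<rparr>"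


section \<open>The nonsingular complete curve with a given function field\<close>

text \<open>
  Let \<open>L\<close> be a function field in one variable over the algebraically closed field \<open>'a\<close>, which is
  embedded in \<open>L\<close> by \<open>\<kappa>\<close>. The nonsingular complete curve with function field \<open>L\<close> has as its points
  the discrete valuation rings of \<open>L\<close> over \<open>'a\<close>; its proper closed subsets are the finite sets of
  points, and the regular functions on a nonempty open set \<open>U\<close> are the elements of the intersection
  of the rings in \<open>U\<close>, whose value at a point is the residue class (see Hartshorne, Algebraic
  Geometry, Section I.6).
\<close>

definition discrete_valuation :: "'b ring \<Rightarrow> ('a::field \<Rightarrow> 'b) \<Rightarrow> ('b \<Rightarrow> int) \<Rightarrow> bool"
  where "discrete_valuation L \<kappa> v \<longleftrightarrow>
    v ` (carrier L - {\<zero>\<^bsub>L\<^esub>}) = UNIV \<and>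
    (\<forall>f \<in> carrier L - {\<zero>\<^bsub>L\<^esub>}. \<forall>g \<in> carrier L - {\<zero>\<^bsub>L\<^esub>}.
      v (f \<otimes>\<^bsub>L\<^esub> g) = v f + v g \<and>
      (f \<oplus>\<^bsub>L\<^esub> g \<noteq> \<zero>\<^bsub>L\<^esub> \<longrightarrow> min (v f) (v g) \<le> v (f \<oplus>\<^bsub>L\<^esub> g))) \<and>
    (\<forall>a. a \<noteq> 0 \<longrightarrow> v (\<kappa> a) = 0)"

definition dvrs :: "'b ring \<Rightarrow> ('a::field \<Rightarrow> 'b) \<Rightarrow> 'b set set"
  where "dvrs L \<kappa> = {{f \<in> carrier L. f = \<zero>\<^bsub>L\<^esub> \<or> 0 \<le> v f} | v. discrete_valuation L \<kappa> v}"

definition residue_value :: "'b ring \<Rightarrow> ('a::field \<Rightarrow> 'b) \<Rightarrow> 'b \<Rightarrow> 'b set \<Rightarrow> 'a"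
  where "residue_value L \<kappa> f R =
    (THE a. \<exists>m \<in> R - Units (L\<lparr>carrier := R\<rparr>). f = \<kappa> a \<oplus>\<^bsub>L\<^esub> m)"

definition cofinite_topology :: "'p set \<Rightarrow> 'p topology"
  where "cofinite_topology P = topology (\<lambda>U. U \<subseteq> P \<and> (U = {} \<or> finite (P - U)))"

lemma openin_cofinite_topology:
  "openin (cofinite_topology P) U \<longleftrightarrow> U \<subseteq> P \<and> (U = {} \<or> finite (P - U))"
proof -
  have "istopology (\<lambda>U. U \<subseteq> P \<and> (U = {} \<or> finite (P - U)))"
    unfolding istopology_def
  proof (intro conjI allI impI)
    fix S T assume "S \<subseteq> P \<and> (S = {} \<or> finite (P - S))" "T \<subseteq> P \<and> (T = {} \<or> finite (P - T))"
    then show "S \<inter> T \<subseteq> P" "S \<inter> T = {} \<or> finite (P - S \<inter> T)"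
      by (auto simp: Diff_Int)
  next
    fix \<K> assume *: "\<forall>K\<in>\<K>. K \<subseteq> P \<and> (K = {} \<or> finite (P - K))"
    then show "\<Union>\<K> \<subseteq> P" by auto
    show "\<Union>\<K> = {} \<or> finite (P - \<Union>\<K>)"
    proof (cases "\<Union>\<K> = {}")
      case False
      then obtain K where "K \<in> \<K>" "K \<noteq> {}" by auto
      then have "finite (P - K)" "P - \<Union>\<K> \<subseteq> P - K" using * by auto
      then show ?thesis using finite_subset by blast
    qed simp
  qed
  then show ?thesis
    unfolding cofinite_topology_def by (simp only: topology_inverse')
qed

lemma topspace_cofinite_topology [simp]: "topspace (cofinite_topology P) = P"
proof
  show "topspace (cofinite_topology P) \<subseteq> P"
    using openin_topspace[of "cofinite_topology P"] unfolding openin_cofinite_topology by blast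
  show "P \<subseteq> topspace (cofinite_topology P)"
    by (rule openin_subset) (simp add: openin_cofinite_topology)
qed

definition nonsingular_curve ::
    "'b ring \<Rightarrow> ('a::field \<Rightarrow> 'b) \<Rightarrow> ('b set, 'a) function_space"
  where "nonsingular_curve L \<kappa> =
    \<lparr>zariski = cofinite_topology (dvrs L \<kappa>),
     regular = (\<lambda>U. {restrict (residue_value L \<kappa> f) U | f. f \<in> carrier L \<and> (\<forall>R \<in> U. f \<in> R)})\<rparr>"

text \<open>
  The desingularization of an irreducible projective curve \<open>C\<close> is the nonsingular complete curve
  birational to it. It lies over \<open>C\<close> by the map sending a discrete valuation ring to the
  unique point of \<open>C\<close> whose local ring it dominates.
\<close>

definition desingularization ::
    "('a::alg_closed_field \<times> 'a \<times> 'a) set \<Rightarrow> ('a rational_function set, 'a) function_space"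
  where "desingularization C = nonsingular_curve (function_field C) (const_ratio C)"


section \<open>Edwards curves\<close>

definition affine_edwards :: "'a::field \<Rightarrow> ('a \<times> 'a) set"
  where "affine_edwards c = {(x, y). x\<^sup>2 + y\<^sup>2 = 1 + c * x\<^sup>2 * y\<^sup>2}"

definition edwards_curve :: "'a::alg_closed_field \<Rightarrow> ('a rational_function set, 'a) function_space"
  where "edwards_curve c = desingularization (projective_closure (affine_edwards c))"

end

theory Submission
  imports Defs
begin

text \<open>
  The function field of \<open>E\<^sub>c\<close> is \<open>k(x, y)\<close> for any generic point \<open>(x, y)\<close> of the curve with
  coordinates in a field of Laurent series. An isomorphism of the curves pulls the coordinate
  functions back, so \<open>E\<^sub>c\<close> and \<open>E\<^sub>c\<^sub>'\<close> are isomorphic if and only if some generic points \<open>(x, y)\<close> of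
  \<open>E\<^sub>c\<close> and \<open>(u, w)\<close> of \<open>E\<^sub>c\<^sub>'\<close> generate the same field. Both \<open>y\<close> and \<open>w\<close> have degree 2, so (after
  exchanging \<open>u\<close> and \<open>w\<close> if \<open>w\<close> is rational in \<open>y\<close>) they satisfy an irreducible relation of bidegree
  \<open>(2, 2)\<close>, whose discriminants are multiples of the branch quartics \<open>(1 - y\<^sup>2)(1 - c y\<^sup>2)\<close> and
  \<open>(1 - w\<^sup>2)(1 - c' w\<^sup>2)\<close>. The two discriminants of a biquadratic form have equal invariants, and
  this leaves only the listed values of \<open>c'\<close>. Conversely, Moebius transformations matching the
  branch points \<open>{\<plusminus>1, \<plusminus>1/\<surd>c}\<close> give generators for each of these values.
\<close>

section \<open>Isomorphisms of function fields and of nonsingular curves\<close>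

text \<open>Elements of the function field are classes of pairs of forms. As a subfield of Laurent
  series the same field has plain arithmetic, and the order of a series is a ready-made discrete
  valuation, hence a point of the curve. An isomorphism is a map of spaces with functions, so it
  yields a map of fields only through values of functions. Hence the middle of the proof shows that
  the valuation rings have residue field k, that a function vanishing at all but finitely many of
  them is 0, and that x and y have only finitely many poles: the coordinates are then regular on a
  nonempty open set and determined by their values there. The parameters are compared without a
  Weierstrass model or j-invariant. Equality of the invariants of the two discriminants is a
  polynomial identity in the nine coefficients of the relation. For even quartics it splits into
  three linear cases, one for each way to divide the four branch points into two pairs. Each case
  gives a value and its inverse, which explains the six values; r and i r enter because their
  squares are the two square roots of c.\<close>

lemma morphism_comp:
  assumes "morphism M N \<phi>" "morphism N P \<chi>"
  shows "morphism M P (\<chi> \<circ> \<phi>)"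
  unfolding morphism_def
proof (intro conjI allI impI)
  show "continuous_map (zariski M) (zariski P) (\<chi> \<circ> \<phi>)"
    using assms by (meson continuous_map_compose morphism_def)
next
  fix U f assume U: "openin (zariski P) U" and f: "f \<in> regular P U"
  define V where "V = {p \<in> topspace (zariski N). \<chi> p \<in> U}"
  define W where "W = {p \<in> topspace (zariski M). \<phi> p \<in> V}"
  have V: "openin (zariski N) V"
    using assms(2) U openin_continuous_map_preimage unfolding morphism_def V_def by blast
  have "restrict (f \<circ> \<chi>) V \<in> regular N V"
    using assms(2) U f unfolding morphism_def V_def by (auto simp: Let_def)
  then have "restrict (restrict (f \<circ> \<chi>) V \<circ> \<phi>) W \<in> regular M W"
    using assms(1) V unfolding morphism_def W_def by (auto simp: Let_def)
  moreover have "restrict (restrict (f \<circ> \<chi>) V \<circ> \<phi>) W = restrict (f \<circ> (\<chi> \<circ> \<phi>)) W"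
    by (auto simp: restrict_def W_def fun_eq_iff)
  moreover have "W = {p \<in> topspace (zariski M). (\<chi> \<circ> \<phi>) p \<in> U}"
    using assms(1) unfolding W_def V_def morphism_def continuous_map_def by auto
  ultimately show "let V = {p \<in> topspace (zariski M). (\<chi> \<circ> \<phi>) p \<in> U}
    in restrict (f \<circ> (\<chi> \<circ> \<phi>)) V \<in> regular M V" by simp
qed

lemma isomorphic_sym: "isomorphic M N \<Longrightarrow> isomorphic N M"
  unfolding isomorphic_def by blast

lemma isomorphic_trans:
  assumes "isomorphic M N" "isomorphic N P"
  shows "isomorphic M P"
proof -
  obtain \<phi> \<psi> \<phi>' \<psi>' where *: "morphism M N \<phi>" "morphism N M \<psi>"
      "\<And>p. p \<in> topspace (zariski M) \<Longrightarrow> \<psi> (\<phi> p) = p" "\<And>p. p \<in> topspace (zariski N) \<Longrightarrow> \<phi> (\<psi> p) = p"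
      "morphism N P \<phi>'" "morphism P N \<psi>'"
      "\<And>p. p \<in> topspace (zariski N) \<Longrightarrow> \<psi>' (\<phi>' p) = p" "\<And>p. p \<in> topspace (zariski P) \<Longrightarrow> \<phi>' (\<psi>' p) = p"
    using assms unfolding isomorphic_def by metis
  have "\<phi> p \<in> topspace (zariski N)" if "p \<in> topspace (zariski M)" for p
    using *(1) that unfolding morphism_def continuous_map_def by auto
  moreover have "\<psi>' p \<in> topspace (zariski N)" if "p \<in> topspace (zariski P)" for p
    using *(6) that unfolding morphism_def continuous_map_def by auto
  ultimately show ?thesis
    unfolding isomorphic_def
    using * morphism_comp[OF *(1) *(5)] morphism_comp[OF *(6) *(2)]
    by (intro exI[of _ "\<phi>' \<circ> \<phi>"] exI[of _ "\<psi> \<circ> \<psi>'"]) auto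
qed

definition algebra_closed :: "'b ring \<Rightarrow> ('a \<Rightarrow> 'b) \<Rightarrow> bool"
  where "algebra_closed L \<kappa> \<longleftrightarrow> \<zero>\<^bsub>L\<^esub> \<in> carrier L \<and> \<one>\<^bsub>L\<^esub> \<in> carrier L \<and> (\<forall>a. \<kappa> a \<in> carrier L) \<and>
    (\<forall>f\<in>carrier L. \<forall>g\<in>carrier L. f \<otimes>\<^bsub>L\<^esub> g \<in> carrier L \<and> f \<oplus>\<^bsub>L\<^esub> g \<in> carrier L)"

text \<open>The definitions of valuation rings and residue values mention only the operations of the
  record, so an isomorphism of bare structures already transports them.\<close>

definition algebra_iso ::
    "'b ring \<Rightarrow> ('a \<Rightarrow> 'b) \<Rightarrow> 'c ring \<Rightarrow> ('a \<Rightarrow> 'c) \<Rightarrow> ('b \<Rightarrow> 'c) \<Rightarrow> bool"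
  where "algebra_iso L \<kappa> L' \<kappa>' h \<longleftrightarrow> algebra_closed L \<kappa> \<and> bij_betw h (carrier L) (carrier L') \<and>
    (\<forall>f\<in>carrier L. \<forall>g\<in>carrier L. h (f \<otimes>\<^bsub>L\<^esub> g) = h f \<otimes>\<^bsub>L'\<^esub> h g \<and> h (f \<oplus>\<^bsub>L\<^esub> g) = h f \<oplus>\<^bsub>L'\<^esub> h g) \<and>
    h \<zero>\<^bsub>L\<^esub> = \<zero>\<^bsub>L'\<^esub> \<and> h \<one>\<^bsub>L\<^esub> = \<one>\<^bsub>L'\<^esub> \<and> (\<forall>a. h (\<kappa> a) = \<kappa>' a)"

lemma algebra_iso_closed:
  assumes "algebra_iso L \<kappa> L' \<kappa>' h"
  shows "algebra_closed L' \<kappa>'"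
proof -
  have im: "carrier L' = h ` carrier L"
    using assms by (auto simp: algebra_iso_def bij_betw_def)
  have "f \<otimes>\<^bsub>L'\<^esub> g \<in> carrier L' \<and> f \<oplus>\<^bsub>L'\<^esub> g \<in> carrier L'"
    if fg: "f \<in> carrier L'" "g \<in> carrier L'" for f g
  proof -
    obtain f' g' where "f' \<in> carrier L" "g' \<in> carrier L" "f = h f'" "g = h g'"
      using fg im by auto
    then show ?thesis
      using assms unfolding algebra_iso_def algebra_closed_def im by (metis imageI)
  qed
  moreover have "\<zero>\<^bsub>L'\<^esub> \<in> carrier L'" "\<one>\<^bsub>L'\<^esub> \<in> carrier L'" "\<And>a. \<kappa>' a \<in> carrier L'"
    using assms unfolding algebra_iso_def algebra_closed_def im by (metis imageI)+
  ultimately show ?thesis by (auto simp: algebra_closed_def)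
qed

lemma algebra_iso_inv:
  assumes iso: "algebra_iso L \<kappa> L' \<kappa>' h"
  shows "algebra_iso L' \<kappa>' L \<kappa> (inv_into (carrier L) h)"
proof -
  let ?g = "inv_into (carrier L) h"
  have cl: "algebra_closed L \<kappa>" and bij: "bij_betw h (carrier L) (carrier L')"
    using iso by (auto simp: algebra_iso_def)
  have inv: "?g (h f) = f" if "f \<in> carrier L" for f
    using bij that by (simp add: bij_betw_def)
  have vni: "h (?g f) = f" "?g f \<in> carrier L" if "f \<in> carrier L'" for f
    using bij that by (auto simp: bij_betw_def f_inv_into_f inv_into_into)
  have "?g (f \<otimes>\<^bsub>L'\<^esub> f') = ?g f \<otimes>\<^bsub>L\<^esub> ?g f'" "?g (f \<oplus>\<^bsub>L'\<^esub> f') = ?g f \<oplus>\<^bsub>L\<^esub> ?g f'"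
    if f: "f \<in> carrier L'" "f' \<in> carrier L'" for f f'
  proof -
    have "f \<otimes>\<^bsub>L'\<^esub> f' = h (?g f \<otimes>\<^bsub>L\<^esub> ?g f')" "f \<oplus>\<^bsub>L'\<^esub> f' = h (?g f \<oplus>\<^bsub>L\<^esub> ?g f')"
      using iso vni[OF f(1)] vni[OF f(2)] by (auto simp: algebra_iso_def)
    then show "?g (f \<otimes>\<^bsub>L'\<^esub> f') = ?g f \<otimes>\<^bsub>L\<^esub> ?g f'" "?g (f \<oplus>\<^bsub>L'\<^esub> f') = ?g f \<oplus>\<^bsub>L\<^esub> ?g f'"
      using inv cl vni[OF f(1)] vni[OF f(2)] by (auto simp: algebra_closed_def)
  qed
  moreover have "?g \<zero>\<^bsub>L'\<^esub> = \<zero>\<^bsub>L\<^esub>" "?g \<one>\<^bsub>L'\<^esub> = \<one>\<^bsub>L\<^esub>" "\<And>a. ?g (\<kappa>' a) = \<kappa> a"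
    using iso inv cl unfolding algebra_iso_def algebra_closed_def by metis+
  moreover have "bij_betw ?g (carrier L') (carrier L)"
    using bij by (rule bij_betw_inv_into)
  ultimately show ?thesis
    using algebra_iso_closed[OF iso] by (auto simp: algebra_iso_def)
qed

lemma algebra_iso_comp:
  assumes "algebra_iso L \<kappa> L' \<kappa>' h" "algebra_iso L' \<kappa>' L'' \<kappa>'' h'"
  shows "algebra_iso L \<kappa> L'' \<kappa>'' (h' \<circ> h)"
proof -
  have "h f \<in> carrier L'" if "f \<in> carrier L" for f
    using assms(1) that by (auto simp: algebra_iso_def bij_betw_def)
  then show ?thesis
    using assms by (auto simp: algebra_iso_def intro: bij_betw_trans)
qed

lemma dvrs_subset_carrier: "R \<in> dvrs L \<kappa> \<Longrightarrow> R \<subseteq> carrier L"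
  by (auto simp: dvrs_def)

lemma inv_into_image_image:
  "bij_betw h A B \<Longrightarrow> R \<subseteq> A \<Longrightarrow> inv_into A h ` h ` R = R"
  "bij_betw h A B \<Longrightarrow> S \<subseteq> B \<Longrightarrow> h ` inv_into A h ` S = S"
  by (auto simp: bij_betw_def inv_into_image_cancel image_inv_into_cancel)

lemma algebra_iso_dvrs:
  assumes iso: "algebra_iso L \<kappa> L' \<kappa>' h" and R: "R \<in> dvrs L \<kappa>"
  shows "h ` R \<in> dvrs L' \<kappa>'"
proof -
  let ?g = "inv_into (carrier L) h"
  note iso' = algebra_iso_inv[OF iso]
  have cl': "algebra_closed L' \<kappa>'" using algebra_iso_closed[OF iso] .
  have bij: "bij_betw h (carrier L) (carrier L')" using iso by (auto simp: algebra_iso_def)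
  obtain v where v: "discrete_valuation L \<kappa> v" and Rv: "R = {f \<in> carrier L. f = \<zero>\<^bsub>L\<^esub> \<or> 0 \<le> v f}"
    using R by (auto simp: dvrs_def)
  have bij': "bij_betw ?g (carrier L') (carrier L)" using bij by (rule bij_betw_inv_into)
  have g0: "?g \<zero>\<^bsub>L'\<^esub> = \<zero>\<^bsub>L\<^esub>" using iso' by (simp add: algebra_iso_def)
  have vni: "h (?g f) = f" if "f \<in> carrier L'" for f
    using bij that by (auto simp: bij_betw_def f_inv_into_f)
  have inv: "?g (h f) = f" if "f \<in> carrier L" for f
    using bij that by (simp add: bij_betw_def)
  have gz: "?g f = \<zero>\<^bsub>L\<^esub> \<longleftrightarrow> f = \<zero>\<^bsub>L'\<^esub>" if "f \<in> carrier L'" for f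
    using vni[OF that] g0 iso by (auto simp: algebra_iso_def)
  have im: "?g ` (carrier L' - {\<zero>\<^bsub>L'\<^esub>}) = carrier L - {\<zero>\<^bsub>L\<^esub>}"
    using bij' gz by (force simp: bij_betw_def)
  have "discrete_valuation L' \<kappa>' (v \<circ> ?g)"
    unfolding discrete_valuation_def
  proof (intro conjI ballI allI impI)
    show "(v \<circ> ?g) ` (carrier L' - {\<zero>\<^bsub>L'\<^esub>}) = UNIV"
      using v unfolding image_comp[symmetric] im by (simp add: discrete_valuation_def)
  next
    fix f f' assume f: "f \<in> carrier L' - {\<zero>\<^bsub>L'\<^esub>}" "f' \<in> carrier L' - {\<zero>\<^bsub>L'\<^esub>}"
    then have gf: "?g f \<in> carrier L - {\<zero>\<^bsub>L\<^esub>}" "?g f' \<in> carrier L - {\<zero>\<^bsub>L\<^esub>}"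
      using im by blast+
    have hom: "?g (f \<otimes>\<^bsub>L'\<^esub> f') = ?g f \<otimes>\<^bsub>L\<^esub> ?g f'" "?g (f \<oplus>\<^bsub>L'\<^esub> f') = ?g f \<oplus>\<^bsub>L\<^esub> ?g f'"
      using iso' f by (auto simp: algebra_iso_def)
    show "(v \<circ> ?g) (f \<otimes>\<^bsub>L'\<^esub> f') = (v \<circ> ?g) f + (v \<circ> ?g) f'"
      using v gf hom by (simp add: discrete_valuation_def)
    assume "f \<oplus>\<^bsub>L'\<^esub> f' \<noteq> \<zero>\<^bsub>L'\<^esub>"
    then have "?g f \<oplus>\<^bsub>L\<^esub> ?g f' \<noteq> \<zero>\<^bsub>L\<^esub>"
      using hom gz cl' f by (metis DiffD1 algebra_closed_def)
    then show "min ((v \<circ> ?g) f) ((v \<circ> ?g) f') \<le> (v \<circ> ?g) (f \<oplus>\<^bsub>L'\<^esub> f')"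
      using v gf hom by (simp add: discrete_valuation_def)
  next
    fix a :: 'b assume "a \<noteq> 0"
    then show "(v \<circ> ?g) (\<kappa>' a) = 0"
      using v iso' by (simp add: discrete_valuation_def algebra_iso_def)
  qed
  moreover have "h ` R = {f \<in> carrier L'. f = \<zero>\<^bsub>L'\<^esub> \<or> 0 \<le> (v \<circ> ?g) f}"
  proof (intro Set.set_eqI iffI)
    fix f assume "f \<in> h ` R"
    then obtain f0 where "f0 \<in> R" "f = h f0" by auto
    then show "f \<in> {f \<in> carrier L'. f = \<zero>\<^bsub>L'\<^esub> \<or> 0 \<le> (v \<circ> ?g) f}"
      using inv iso unfolding Rv algebra_iso_def bij_betw_def by auto
  next
    fix f assume f: "f \<in> {f \<in> carrier L'. f = \<zero>\<^bsub>L'\<^esub> \<or> 0 \<le> (v \<circ> ?g) f}"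
    then have "?g f \<in> R" using gz bij' unfolding Rv bij_betw_def by auto
    then show "f \<in> h ` R" using f vni by (metis (mono_tags, lifting) image_eqI mem_Collect_eq)
  qed
  ultimately show ?thesis unfolding dvrs_def by blast
qed

text \<open>The map \<open>h\<close> carries the property that defines the residue value on one side
  to the same property on the other, so the two definite descriptions agree even where no value
  exists.\<close>

lemma algebra_iso_residue_value:
  assumes iso: "algebra_iso L \<kappa> L' \<kappa>' h" and R: "R \<subseteq> carrier L" and f: "f \<in> R"
  shows "residue_value L' \<kappa>' (h f) (h ` R) = residue_value L \<kappa> f R"
proof -
  have cl: "algebra_closed L \<kappa>" and inj: "inj_on h (carrier L)"
    using iso by (auto simp: algebra_iso_def bij_betw_def)
  have heq: "h f = h g \<longleftrightarrow> f = g" if "f \<in> carrier L" "g \<in> carrier L" for f g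
    using inj that by (auto simp: inj_on_def)
  have hom: "h (f \<otimes>\<^bsub>L\<^esub> g) = h f \<otimes>\<^bsub>L'\<^esub> h g" "h (f \<oplus>\<^bsub>L\<^esub> g) = h f \<oplus>\<^bsub>L'\<^esub> h g"
    if "f \<in> carrier L" "g \<in> carrier L" for f g
    using iso that by (auto simp: algebra_iso_def)
  have U: "h u \<in> Units (L'\<lparr>carrier := h ` R\<rparr>) \<longleftrightarrow> u \<in> Units (L\<lparr>carrier := R\<rparr>)" if u: "u \<in> R" for u
  proof -
    have one: "h \<one>\<^bsub>L\<^esub> = \<one>\<^bsub>L'\<^esub>" using iso by (simp add: algebra_iso_def)
    have *: "h w \<otimes>\<^bsub>L'\<^esub> h u = \<one>\<^bsub>L'\<^esub> \<longleftrightarrow> w \<otimes>\<^bsub>L\<^esub> u = \<one>\<^bsub>L\<^esub>"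
       "h u \<otimes>\<^bsub>L'\<^esub> h w = \<one>\<^bsub>L'\<^esub> \<longleftrightarrow> u \<otimes>\<^bsub>L\<^esub> w = \<one>\<^bsub>L\<^esub>" if w: "w \<in> R" for w
    proof -
      have uw: "u \<in> carrier L" "w \<in> carrier L" using R u w by auto
      have c: "w \<otimes>\<^bsub>L\<^esub> u \<in> carrier L" "u \<otimes>\<^bsub>L\<^esub> w \<in> carrier L" "\<one>\<^bsub>L\<^esub> \<in> carrier L"
        using cl uw by (simp_all add: algebra_closed_def)
      show "h w \<otimes>\<^bsub>L'\<^esub> h u = \<one>\<^bsub>L'\<^esub> \<longleftrightarrow> w \<otimes>\<^bsub>L\<^esub> u = \<one>\<^bsub>L\<^esub>"
        unfolding hom(1)[OF uw(2) uw(1), symmetric] one[symmetric] using c by (intro heq)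
      show "h u \<otimes>\<^bsub>L'\<^esub> h w = \<one>\<^bsub>L'\<^esub> \<longleftrightarrow> u \<otimes>\<^bsub>L\<^esub> w = \<one>\<^bsub>L\<^esub>"
        unfolding hom(1)[OF uw(1) uw(2), symmetric] one[symmetric] using c by (intro heq)
    qed
    have "h u \<in> Units (L'\<lparr>carrier := h ` R\<rparr>) \<longleftrightarrow>
        (\<exists>w\<in>R. h w \<otimes>\<^bsub>L'\<^esub> h u = \<one>\<^bsub>L'\<^esub> \<and> h u \<otimes>\<^bsub>L'\<^esub> h w = \<one>\<^bsub>L'\<^esub>)"
      using u by (simp add: Units_def)
    moreover have "u \<in> Units (L\<lparr>carrier := R\<rparr>) \<longleftrightarrow>
        (\<exists>w\<in>R. w \<otimes>\<^bsub>L\<^esub> u = \<one>\<^bsub>L\<^esub> \<and> u \<otimes>\<^bsub>L\<^esub> w = \<one>\<^bsub>L\<^esub>)"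
      using u by (simp add: Units_def)
    ultimately show ?thesis using * by simp
  qed
  have "(\<exists>m\<in>h ` R - Units (L'\<lparr>carrier := h ` R\<rparr>). h f = \<kappa>' a \<oplus>\<^bsub>L'\<^esub> m) \<longleftrightarrow>
        (\<exists>m\<in>R - Units (L\<lparr>carrier := R\<rparr>). f = \<kappa> a \<oplus>\<^bsub>L\<^esub> m)" for a
  proof -
    have "h f = \<kappa>' a \<oplus>\<^bsub>L'\<^esub> h m \<longleftrightarrow> f = \<kappa> a \<oplus>\<^bsub>L\<^esub> m" if "m \<in> R" for m
    proof -
      have m: "m \<in> carrier L" and fc: "f \<in> carrier L" and k: "\<kappa> a \<in> carrier L"
        using that R f cl by (auto simp: algebra_closed_def)
      have "\<kappa>' a \<oplus>\<^bsub>L'\<^esub> h m = h (\<kappa> a \<oplus>\<^bsub>L\<^esub> m)"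
        using hom(2)[OF k m] iso by (simp add: algebra_iso_def)
      moreover have "\<kappa> a \<oplus>\<^bsub>L\<^esub> m \<in> carrier L" using cl m by (auto simp: algebra_closed_def)
      ultimately show ?thesis using heq[OF fc] by simp
    qed
    moreover have "(\<exists>m\<in>h ` R - Units (L'\<lparr>carrier := h ` R\<rparr>). h f = \<kappa>' a \<oplus>\<^bsub>L'\<^esub> m) \<longleftrightarrow>
        (\<exists>m\<in>R. h m \<notin> Units (L'\<lparr>carrier := h ` R\<rparr>) \<and> h f = \<kappa>' a \<oplus>\<^bsub>L'\<^esub> h m)"
      by (simp only: bex_simps(7) Bex_def Diff_iff image_iff) blast
    ultimately show ?thesis using U by (simp add: Bex_def conj_assoc cong: conj_cong)
  qed
  then show ?thesis by (simp only: residue_value_def)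
qed

text \<open>A regular function given by f pulls back to the one given by the preimage of f under
  \<open>h\<close>. Continuity for the cofinite topologies comes from injectivity on points:
  preimages of finite sets are finite.\<close>

lemma algebra_iso_morphism:
  assumes iso: "algebra_iso L \<kappa> L' \<kappa>' h"
  shows "morphism (nonsingular_curve L \<kappa>) (nonsingular_curve L' \<kappa>') ((`) h)"
proof -
  let ?g = "inv_into (carrier L) h"
  let ?P = "dvrs L \<kappa>" and ?P' = "dvrs L' \<kappa>'"
  have bij: "bij_betw h (carrier L) (carrier L')" using iso by (auto simp: algebra_iso_def)
  have sub: "R \<in> ?P \<Longrightarrow> R \<subseteq> carrier L" for R by (rule dvrs_subset_carrier)
  have into: "R \<in> ?P \<Longrightarrow> h ` R \<in> ?P'" for R by (rule algebra_iso_dvrs[OF iso])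
  have inj: "inj_on ((`) h) ?P"
    using sub inv_into_image_image(1)[OF bij] by (intro inj_on_inverseI[of _ "(`) ?g"]) auto
  have opn: "openin (cofinite_topology ?P) {R \<in> ?P. h ` R \<in> U}"
    if U: "openin (cofinite_topology ?P') U" for U
  proof (cases "U = {}")
    case False
    then have "finite (?P' - U)" using U by (simp add: openin_cofinite_topology)
    then have "finite {R \<in> ?P. h ` R \<in> ?P' - U}"
      using inj by (rule finite_inverse_image_gen)
    moreover have "?P - {R \<in> ?P. h ` R \<in> U} = {R \<in> ?P. h ` R \<in> ?P' - U}"
      using into by auto
    ultimately show ?thesis by (simp add: openin_cofinite_topology)
  qed (simp add: openin_cofinite_topology)
  have cont: "continuous_map (cofinite_topology ?P) (cofinite_topology ?P') ((`) h)"
    using opn into by (auto simp: continuous_map_def)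
  have "restrict (restrict (residue_value L' \<kappa>' f) U \<circ> (`) h) {R \<in> ?P. h ` R \<in> U}
     = restrict (residue_value L \<kappa> (?g f)) {R \<in> ?P. h ` R \<in> U} \<and> ?g f \<in> carrier L
     \<and> (\<forall>R \<in> {R \<in> ?P. h ` R \<in> U}. ?g f \<in> R)"
    if f: "f \<in> carrier L'" "\<forall>R\<in>U. f \<in> R" for f U
  proof -
    have hg: "h (?g f) = f" "?g f \<in> carrier L"
      using bij f by (auto simp: bij_betw_def f_inv_into_f inv_into_into)
    have mem: "?g f \<in> R" if "R \<in> ?P" "h ` R \<in> U" for R
    proof -
      have "f \<in> h ` R" using that f by blast
      then show ?thesis using inv_into_image_image(1)[OF bij sub[OF that(1)]] by blast
    qed
    have "residue_value L' \<kappa>' f (h ` R) = residue_value L \<kappa> (?g f) R" if "R \<in> ?P" "h ` R \<in> U" for R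
      using algebra_iso_residue_value[OF iso sub[OF that(1)] mem[OF that]] hg by simp
    then have eq: "(restrict (residue_value L' \<kappa>' f) U \<circ> (`) h) R = residue_value L \<kappa> (?g f) R"
      if "R \<in> {R \<in> ?P. h ` R \<in> U}" for R
      using that by simp
    show ?thesis
    proof (intro conjI ballI)
      show "restrict (restrict (residue_value L' \<kappa>' f) U \<circ> (`) h) {R \<in> ?P. h ` R \<in> U}
        = restrict (residue_value L \<kappa> (?g f)) {R \<in> ?P. h ` R \<in> U}"
        by (rule restrict_ext) (rule eq)
    qed (use mem hg in auto)
  qed
  note key = this
  show ?thesis
    unfolding morphism_def
  proof (intro conjI allI impI)
    show "continuous_map (zariski (nonsingular_curve L \<kappa>)) (zariski (nonsingular_curve L' \<kappa>')) ((`) h)"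
      using cont by (simp add: nonsingular_curve_def)
  next
    fix U F assume "F \<in> regular (nonsingular_curve L' \<kappa>') U"
    then obtain f where F: "F = restrict (residue_value L' \<kappa>' f) U" "f \<in> carrier L'" "\<forall>R\<in>U. f \<in> R"
      by (auto simp: nonsingular_curve_def)
    have "restrict (F \<circ> (`) h) {R \<in> ?P. h ` R \<in> U} \<in> regular (nonsingular_curve L \<kappa>) {R \<in> ?P. h ` R \<in> U}"
      using key[OF F(2,3)] F(1) unfolding nonsingular_curve_def function_space.simps by blast
    then show "let V = {p \<in> topspace (zariski (nonsingular_curve L \<kappa>)). h ` p \<in> U}
        in restrict (F \<circ> (`) h) V \<in> regular (nonsingular_curve L \<kappa>) V"
      by (simp add: nonsingular_curve_def)
  qed
qed

lemma algebra_iso_isomorphic: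
  assumes iso: "algebra_iso L \<kappa> L' \<kappa>' h"
  shows "isomorphic (nonsingular_curve L \<kappa>) (nonsingular_curve L' \<kappa>')"
proof -
  have bij: "bij_betw h (carrier L) (carrier L')" using iso by (auto simp: algebra_iso_def)
  have "inv_into (carrier L) h ` h ` R = R" if "R \<in> topspace (zariski (nonsingular_curve L \<kappa>))" for R
    using that inv_into_image_image(1)[OF bij dvrs_subset_carrier] by (simp add: nonsingular_curve_def)
  moreover have "h ` inv_into (carrier L) h ` R = R" if "R \<in> topspace (zariski (nonsingular_curve L' \<kappa>'))" for R
    using that inv_into_image_image(2)[OF bij dvrs_subset_carrier] by (simp add: nonsingular_curve_def)
  ultimately show ?thesis
    unfolding isomorphic_def
    using algebra_iso_morphism[OF iso] algebra_iso_morphism[OF algebra_iso_inv[OF iso]]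
    by blast
qed


section \<open>Generic points of Edwards curves\<close>

lemma map_poly_hom_add:
  fixes h :: "'a::comm_ring_1 \<Rightarrow> 'b::comm_ring_1"
  assumes "h 0 = 0" "\<And>a b. h (a + b) = h a + h b"
  shows "map_poly h (p + q) = map_poly h p + map_poly h q"
  by (rule poly_eqI) (simp add: coeff_map_poly assms)

lemma map_poly_hom_mult:
  fixes h :: "'a::comm_ring_1 \<Rightarrow> 'b::comm_ring_1"
  assumes h: "h 0 = 0" "\<And>a b. h (a + b) = h a + h b" "\<And>a b. h (a * b) = h a * h b"
  shows "map_poly h (p * q) = map_poly h p * map_poly h q"
proof -
  have "h (\<Sum>i\<in>A. g i) = (\<Sum>i\<in>A. h (g i))" for A :: "nat set" and g
    by (induction A rule: infinite_finite_induct) (simp_all add: h)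
  then show ?thesis
    by (intro poly_eqI) (simp add: coeff_map_poly coeff_mult h)
qed

text \<open>Otherwise \<open>p + 1\<close> would be a nonconstant polynomial with constant value 1,
  hence without a root.\<close>

lemma poly_vanishing_imp_0:
  fixes p :: "'a::alg_closed_field poly"
  assumes "\<And>a. poly p a = 0"
  shows "p = 0"
proof (rule ccontr)
  assume "p \<noteq> 0"
  have "degree p \<noteq> 0"
  proof
    assume "degree p = 0"
    then obtain a where "p = [:a:]" using degree_eq_zeroE by blast
    then show False using assms[of 0] \<open>p \<noteq> 0\<close> by simp
  qed
  then have "degree (p + 1) > 0"
    by (metis degree_1 degree_add_eq_left gr0I)
  then obtain a where "poly (p + 1) a = 0"
    using alg_closed_imp_poly_has_root by blast
  then show False using assms[of a] by simp
qed

text \<open>Used through its parity: a square factor does not change whether an order is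
  odd.\<close>

lemma order_square_mult:
  fixes p :: "'a::idom poly"
  assumes "p \<noteq> 0" "q \<noteq> 0"
  shows "Polynomial.order a (p\<^sup>2 * q) = 2 * Polynomial.order a p + Polynomial.order a q"
  using assms by (simp add: order_mult power2_eq_square)

text \<open>At a root a, the cofactor of \<open>[:-a, 1:]\<close> takes the value -2 e a, which is
  nonzero outside characteristic 2. So all branch points are simple roots.\<close>

lemma order_one_minus:
  fixes a e :: "'a::field"
  assumes "(2::'a) \<noteq> 0"
  shows "Polynomial.order a [:1, 0, -e:] = (if e * a\<^sup>2 = 1 then 1 else 0)"
proof (cases "e * a\<^sup>2 = 1")
  case True
  then have ea: "e \<noteq> 0" "a \<noteq> 0" by auto
  have "[:1, 0, -e:] = [:-a, 1:] * [:-e * a, -e:]" using True by (simp add: power2_eq_square algebra_simps)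
  moreover have "poly [:-e * a, -e:] a = - (2 * (e * a))" by (simp add: algebra_simps)
  then have "Polynomial.order a [:-e * a, -e:] = 0"
    using assms ea by (intro order_0I) (simp only: neg_equal_0_iff_equal mult_eq_0_iff, simp)
  moreover have "Polynomial.order a [:-a, 1:] = 1"
    using order_power_n_n[of a 1] by simp
  moreover have "[:1, 0, -e:] \<noteq> 0" by simp
  ultimately show ?thesis using True by (metis One_nat_def add.right_neutral order_mult)
next
  case False
  then show ?thesis by (simp add: order_0I power2_eq_square algebra_simps)
qed

section \<open>Values of polynomials at Laurent series, and the fields they generate\<close>

lemma fls_const_add: "fls_const (a + b) = fls_const a + fls_const b"
  by (rule fls_plus_const[symmetric])

lemma fls_const_diff: "fls_const (a - b) = fls_const a - fls_const b"
  by (rule fls_minus_const[symmetric])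

lemma fls_const_mult: "fls_const (a * b) = fls_const a * (fls_const b :: 'a::comm_ring_1 fls)"
  by simp

definition pev :: "'a::alg_closed_field poly \<Rightarrow> 'a fls \<Rightarrow> 'a fls"
  where "pev p y = poly (map_poly fls_const p) y"

lemma pev_0 [simp]: "pev 0 y = 0"
  by (simp add: pev_def)

lemma pev_pCons [simp]: "pev (pCons a p) y = fls_const a + y * pev p y"
  by (simp add: pev_def map_poly_pCons)

lemma pev_1 [simp]: "pev 1 y = 1"
  by (simp add: one_pCons)

lemma pev_add [simp]: "pev (p + q) y = pev p y + pev q y"
  by (simp add: pev_def map_poly_hom_add fls_const_add)

lemma pev_mult [simp]: "pev (p * q) y = pev p y * pev q y"
  by (simp add: pev_def map_poly_hom_mult fls_const_add)

lemma pev_smult [simp]: "pev (smult a p) y = fls_const a * pev p y"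
  using pev_mult[of "[:a:]" p y] by (simp del: pev_mult)

lemma pev_minus [simp]: "pev (- p) y = - pev p y"
  using pev_smult[of "-1" p y] by (simp del: pev_smult)

lemma pev_diff [simp]: "pev (p - q) y = pev p y - pev q y"
  using pev_add[of p "-q" y] by (simp del: pev_add)

lemma pev_power [simp]: "pev (p ^ n) y = pev p y ^ n"
  by (induction n) simp_all

text \<open>A polynomial over an algebraically closed field splits into linear factors, and the
  Laurent series have no zero divisors. Thus a nonconstant series is transcendental over the
  constants.\<close>

lemma pev_eq_0_imp_const:
  assumes "pev p y = 0" "p \<noteq> 0"
  shows "\<exists>a. poly p a = 0 \<and> y = fls_const a"
  using assms
proof (induction "degree p" arbitrary: p rule: less_induct)
  case less
  show ?case
  proof (cases "degree p = 0")
    case True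
    then obtain a where "p = [:a:]" using degree_eq_zeroE by blast
    then show ?thesis using less.prems by simp
  next
    case False
    then obtain a where a: "poly p a = 0" using alg_closed_imp_poly_has_root by blast
    then obtain q where p: "p = [:-a, 1:] * q" by (metis dvd_def poly_eq_0_iff_dvd)
    then have q: "q \<noteq> 0" using less.prems by auto
    have "degree p = degree q + 1"
      unfolding p using q by (subst degree_mult_eq) auto
    moreover have "(y - fls_const a) * pev q y = 0"
      using less.prems(1) unfolding p by (simp del: mult_pCons_left)
    then have "y = fls_const a \<or> pev q y = 0" by simp
    ultimately show ?thesis
      using less.hyps[of q] a q unfolding p by auto
  qed
qed

text \<open>\<open>poly_pair x y f e\<close> means that some polynomial in two variables with coefficients in \<open>'a\<close>
  induces the function \<open>f\<close> on the plane and takes the value \<open>e\<close> at \<open>(x, y)\<close>.\<close>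

inductive poly_pair :: "'a::alg_closed_field fls \<Rightarrow> 'a fls \<Rightarrow> ('a \<times> 'a \<Rightarrow> 'a) \<Rightarrow> 'a fls \<Rightarrow> bool"
  for x y :: "'a fls" where
  const: "poly_pair x y (\<lambda>_. a) (fls_const a)"
| fst: "poly_pair x y fst x"
| snd: "poly_pair x y snd y"
| add: "poly_pair x y f e \<Longrightarrow> poly_pair x y f' e' \<Longrightarrow> poly_pair x y (\<lambda>p. f p + f' p) (e + e')"
| mult: "poly_pair x y f e \<Longrightarrow> poly_pair x y f' e' \<Longrightarrow> poly_pair x y (\<lambda>p. f p * f' p) (e * e')"

lemma poly_pair_minus: "poly_pair x y f e \<Longrightarrow> poly_pair x y (\<lambda>p. - f p) (- e)"
  using poly_pair.mult[OF poly_pair.const[of x y "-1"], of f e] by simp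

lemma poly_pair_diff:
  "poly_pair x y f e \<Longrightarrow> poly_pair x y f' e' \<Longrightarrow> poly_pair x y (\<lambda>p. f p - f' p) (e - e')"
  using poly_pair.add[OF _ poly_pair_minus, of x y f e f' e'] by simp

lemma poly_pair_power: "poly_pair x y f e \<Longrightarrow> poly_pair x y (\<lambda>p. f p ^ n) (e ^ n)"
proof (induction n)
  case 0
  then show ?case using poly_pair.const[of x y 1] by simp
next
  case (Suc n)
  then show ?case using poly_pair.mult[of x y f e "\<lambda>p. f p ^ n" "e ^ n"] by simp
qed

lemma poly_pair_sum:
  assumes "finite I" "\<And>i. i \<in> I \<Longrightarrow> poly_pair x y (f i) (e i)"
  shows "poly_pair x y (\<lambda>p. \<Sum>i\<in>I. f i p) (\<Sum>i\<in>I. e i)"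
  using assms
proof (induction I)
  case empty
  then show ?case using poly_pair.const[of x y 0] by simp
next
  case (insert i I)
  then show ?case using poly_pair.add[of x y "f i" "e i"] by simp
qed

definition generated_field :: "'a::alg_closed_field fls \<Rightarrow> 'a fls \<Rightarrow> 'a fls set"
  where "generated_field x y = {e / e' | e e' f f'. poly_pair x y f e \<and> poly_pair x y f' e' \<and> e' \<noteq> 0}"

lemma generated_fieldI: "poly_pair x y f e \<Longrightarrow> e \<in> generated_field x y"
  unfolding generated_field_def
  using poly_pair.const[of x y 1]
  by (intro CollectI exI[of _ e] exI[of _ 1] exI[of _ f] exI[of _ "\<lambda>_. 1"]) simp

lemma generated_field_const [simp, intro]: "fls_const a \<in> generated_field x y"
  and generated_field_fst [simp, intro]: "x \<in> generated_field x y"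
  and generated_field_snd [simp, intro]: "y \<in> generated_field x y"
  by (auto intro: generated_fieldI poly_pair.intros)

lemma generated_field_0 [simp, intro]: "0 \<in> generated_field x y"
  and generated_field_1 [simp, intro]: "1 \<in> generated_field x y"
  using generated_field_const[of 0 x y] generated_field_const[of 1 x y] by simp_all

lemma generated_field_numeral [simp, intro]: "numeral n \<in> generated_field x y"
  using generated_field_const[of "numeral n" x y] by simp

lemma generated_field_add [intro]:
  assumes "a \<in> generated_field x y" "b \<in> generated_field x y"
  shows "a + b \<in> generated_field x y"
proof -
  obtain e e' f f' d d' g g' where *: "poly_pair x y f e" "poly_pair x y f' e'" "e' \<noteq> 0" "a = e / e'"
    "poly_pair x y g d" "poly_pair x y g' d'" "d' \<noteq> 0" "b = d / d'"
    using assms unfolding generated_field_def by blast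
  have "a + b = (e * d' + d * e') / (e' * d')" using * by (simp add: field_simps)
  moreover have "poly_pair x y (\<lambda>p. f p * g' p + g p * f' p) (e * d' + d * e')"
    "poly_pair x y (\<lambda>p. f' p * g' p) (e' * d')"
    using * by (auto intro: poly_pair.intros)
  moreover have "e' * d' \<noteq> 0" using * by simp
  ultimately show ?thesis unfolding generated_field_def by blast
qed

lemma generated_field_mult [intro]:
  assumes "a \<in> generated_field x y" "b \<in> generated_field x y"
  shows "a * b \<in> generated_field x y"
proof -
  obtain e e' f f' d d' g g' where *: "poly_pair x y f e" "poly_pair x y f' e'" "e' \<noteq> 0" "a = e / e'"
    "poly_pair x y g d" "poly_pair x y g' d'" "d' \<noteq> 0" "b = d / d'"
    using assms unfolding generated_field_def by blast
  have "a * b = (e * d) / (e' * d')" using * by simp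
  moreover have "poly_pair x y (\<lambda>p. f p * g p) (e * d)"
    "poly_pair x y (\<lambda>p. f' p * g' p) (e' * d')"
    using * by (auto intro: poly_pair.intros)
  moreover have "e' * d' \<noteq> 0" using * by simp
  ultimately show ?thesis unfolding generated_field_def by blast
qed

lemma generated_field_inverse [intro]:
  assumes "a \<in> generated_field x y"
  shows "inverse a \<in> generated_field x y"
proof (cases "a = 0")
  case False
  obtain e e' f f' where *: "poly_pair x y f e" "poly_pair x y f' e'" "e' \<noteq> 0" "a = e / e'"
    using assms unfolding generated_field_def by blast
  then have "inverse a = e' / e" "e \<noteq> 0" using False by auto
  then show ?thesis using * unfolding generated_field_def by blast
qed simp

lemma generated_field_minus [intro]: "a \<in> generated_field x y \<Longrightarrow> - a \<in> generated_field x y"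
  using generated_field_mult[OF generated_field_const[of "-1"]] by simp

lemma generated_field_diff [intro]:
  "a \<in> generated_field x y \<Longrightarrow> b \<in> generated_field x y \<Longrightarrow> a - b \<in> generated_field x y"
  using generated_field_add[of a x y "-b"] by auto

lemma generated_field_divide [intro]:
  "a \<in> generated_field x y \<Longrightarrow> b \<in> generated_field x y \<Longrightarrow> a / b \<in> generated_field x y"
  using generated_field_mult[of a x y "inverse b"] by (auto simp: divide_inverse)

lemma generated_field_power [intro]: "a \<in> generated_field x y \<Longrightarrow> a ^ n \<in> generated_field x y"
  by (induction n) auto

lemma generated_field_pev [intro]: "a \<in> generated_field x y \<Longrightarrow> pev p a \<in> generated_field x y"
  by (induction p) auto

lemma generated_field_subset:
  assumes "x' \<in> S" "y' \<in> S" "\<And>a. fls_const a \<in> S" "\<And>a b. a \<in> S \<Longrightarrow> b \<in> S \<Longrightarrow> a + b \<in> S"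
    "\<And>a b. a \<in> S \<Longrightarrow> b \<in> S \<Longrightarrow> a * b \<in> S" "\<And>a b. a \<in> S \<Longrightarrow> b \<in> S \<Longrightarrow> b \<noteq> 0 \<Longrightarrow> a / b \<in> S"
  shows "generated_field x' y' \<subseteq> S"
proof -
  have "e \<in> S" if "poly_pair x' y' f e" for f e
    using that by induction (use assms in auto)
  then show ?thesis unfolding generated_field_def using assms(6) by blast
qed

lemma generated_field_mono:
  "x' \<in> generated_field x y \<Longrightarrow> y' \<in> generated_field x y \<Longrightarrow> generated_field x' y' \<subseteq> generated_field x y"
  by (rule generated_field_subset) auto

text \<open>Nonconstant means transcendental here, because the constants are algebraically closed.
  So (x, y) satisfies exactly the polynomial equations that hold on the whole curve
  (\<open>poly_pair_eq_0_iff\<close>), and the field it generates is the function field.\<close>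

locale generic_point =
  fixes c :: "'a::alg_closed_field" and x y :: "'a fls"
  assumes two: "(2::'a) \<noteq> 0" and c0: "c \<noteq> 0" and c1: "c \<noteq> 1"
    and equation: "x\<^sup>2 + y\<^sup>2 = 1 + fls_const c * x\<^sup>2 * y\<^sup>2"
    and y_nonconst: "y \<notin> range fls_const"
begin

lemma pev_y_eq_0_iff [simp]: "pev p y = 0 \<longleftrightarrow> p = 0"
  using pev_eq_0_imp_const y_nonconst by fastforce

lemma pev_y_eq_iff: "pev p y = pev q y \<longleftrightarrow> p = q"
  using pev_y_eq_0_iff[of "p - q"] by (simp del: pev_y_eq_0_iff)

lemma den_nonzero: "1 - fls_const c * y\<^sup>2 \<noteq> 0"
  using pev_y_eq_0_iff[of "[:1, 0, -c:]"] by (simp add: power2_eq_square mult_ac del: pev_y_eq_0_iff)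

lemma num_nonzero: "1 - y\<^sup>2 \<noteq> 0"
  using pev_y_eq_0_iff[of "[:1, 0, -1:]"] by (simp add: power2_eq_square mult_ac del: pev_y_eq_0_iff)

lemma equation': "x\<^sup>2 * (1 - fls_const c * y\<^sup>2) = 1 - y\<^sup>2"
  using equation by (simp add: algebra_simps)

lemma x_nonzero: "x \<noteq> 0"
  using equation' num_nonzero by auto

lemma y_nonzero: "y \<noteq> 0"
  using y_nonconst by (metis fls_const_0 rangeI)

lemma order_1_num: "Polynomial.order (1::'a) [:1, 0, -1:] = 1"
  using order_one_minus[OF two, of 1 1] by simp

lemma order_1_den: "Polynomial.order (1::'a) [:1, 0, -c:] = 0"
  using order_one_minus[OF two, of 1 c] c1 by simp

text \<open>A relation, with x moved to one side and squared, gives p^2 (1 - c y^2) = q^2 (1 - y^2).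
  At y = 1 the left side has even order and the right side odd order, since c \<noteq> 1 keeps 1
  from being a root of 1 - c y^2. So x is not rational in y.\<close>

lemma independent:
  assumes "pev p y + pev q y * x = 0"
  shows "p = 0" "q = 0"
proof -
  have "pev p y = - pev q y * x" using assms by (simp add: add_eq_0_iff2)
  then have "pev p y ^ 2 * (1 - fls_const c * y\<^sup>2) = pev q y ^ 2 * (1 - y\<^sup>2)"
    using equation' by (simp add: power_mult_distrib mult.assoc)
  then have "pev (p\<^sup>2 * [:1, 0, -c:]) y = pev (q\<^sup>2 * [:1, 0, -1:]) y"
    by (simp add: power2_eq_square algebra_simps)
  then have eq: "p\<^sup>2 * [:1, 0, -c:] = q\<^sup>2 * [:1, 0, -1:]"
    by (simp only: pev_y_eq_iff)
  show "q = 0"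
  proof (rule ccontr)
    assume q: "q \<noteq> 0"
    then have "q\<^sup>2 * [:1, 0, -1:] \<noteq> 0" by (simp del: mult_pCons_right)
    then have p: "p \<noteq> 0" using eq by (metis mult_zero_left zero_power2)
    have "Polynomial.order 1 (p\<^sup>2 * [:1, 0, -c:]) = 2 * Polynomial.order 1 p"
      using order_square_mult[OF p, of "[:1, 0, -c:]" 1] order_1_den by simp
    moreover have "Polynomial.order 1 (q\<^sup>2 * [:1, 0, -1:]) = 2 * Polynomial.order 1 q + 1"
      using order_square_mult[OF q, of "[:1, 0, -1:]" 1] order_1_num by simp
    ultimately have "2 * Polynomial.order 1 p = 2 * Polynomial.order 1 q + 1" using eq by simp
    then show False by presburger
  qed
  then have "p\<^sup>2 * [:1, 0, -c:] = 0" using eq by simp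
  then show "p = 0" by (metis mult_eq_0_iff one_neq_zero pCons_eq_0_iff power_eq_0_iff)
qed

lemma x_nonconst: "x \<notin> range fls_const"
proof
  assume "x \<in> range fls_const"
  then obtain a where "x = fls_const a" by auto
  then have "pev [:a:] y + pev [:-1:] y * x = 0" by simp
  from independent(2)[OF this] show False by simp
qed

lemma swap: "generic_point c y x"
  using two c0 c1 equation x_nonconst by unfold_locales (simp_all add: ac_simps)

text \<open>This automorphism of the curve exchanges zeros and poles of y. It reduces questions at
  the poles of y to questions at its zeros.\<close>

lemma reciprocal:
  assumes "s\<^sup>2 = c"
  shows "generic_point c (1 / (fls_const s * x)) (1 / (fls_const s * y))"
proof unfold_locales
  have s: "fls_const c = fls_const s ^ 2" "s \<noteq> 0" using assms c0 by (auto simp: fls_const_power)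
  then have s0: "fls_const s \<noteq> 0" by simp
  show "(1 / (fls_const s * x))\<^sup>2 + (1 / (fls_const s * y))\<^sup>2 =
    1 + fls_const c * (1 / (fls_const s * x))\<^sup>2 * (1 / (fls_const s * y))\<^sup>2"
    (is "?X + ?Y = 1 + _ * ?X * ?Y")
  proof -
    let ?D = "(fls_const s)\<^sup>2 * x\<^sup>2 * y\<^sup>2"
    have "?X * ?D = y\<^sup>2" "?Y * ?D = x\<^sup>2" "fls_const s ^ 2 * ?X * ?Y * ?D = 1"
      using x_nonzero y_nonzero s0 by (simp_all add: power_divide power_mult_distrib)
    then have "(?X + ?Y) * ?D = (1 + fls_const s ^ 2 * ?X * ?Y) * ?D"
      using equation unfolding s(1) by (simp only: distrib_right mult_1_left add.commute)
    moreover have "?D \<noteq> 0" using x_nonzero y_nonzero s0 by simp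
    ultimately show ?thesis unfolding s(1) by (simp only: mult_cancel_right) simp
  qed
  show "1 / (fls_const s * y) \<notin> range fls_const"
  proof
    assume "1 / (fls_const s * y) \<in> range fls_const"
    then obtain a where "1 / (fls_const s * y) = fls_const a" by auto
    then have "y * fls_const (s * a) = 1" using s0 y_nonzero by (simp add: field_simps)
    then have "pev [:-1, s * a:] y = 0" by (simp add: mult.commute)
    then show False by (simp del: pev_pCons)
  qed
qed (use two c0 c1 in auto)

lemma generated_field_reciprocal:
  assumes "s\<^sup>2 = c"
  shows "generated_field (1 / (fls_const s * x)) (1 / (fls_const s * y)) = generated_field x y"
proof -
  have s0: "fls_const s \<noteq> 0" using assms c0 by auto
  have "x = 1 / (fls_const s * (1 / (fls_const s * x)))" "y = 1 / (fls_const s * (1 / (fls_const s * y)))"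
    using x_nonzero y_nonzero s0 by simp_all
  moreover have "1 / (fls_const s * u) \<in> generated_field u v" "1 / (fls_const s * v) \<in> generated_field u v"
    for u v by (intro generated_field_divide generated_field_mult generated_field_1
        generated_field_const generated_field_fst generated_field_snd)+
  ultimately show ?thesis by (intro equalityI generated_field_mono) metis+
qed

lemma affine_edwards_iff: "(a, b) \<in> affine_edwards c \<longleftrightarrow> a\<^sup>2 * (1 - c * b\<^sup>2) = 1 - b\<^sup>2"
  by (auto simp: affine_edwards_def algebra_simps)

lemma affine_edwards_den: "(a, b) \<in> affine_edwards c \<Longrightarrow> 1 - c * b\<^sup>2 \<noteq> 0"
  using c1 by (auto simp: affine_edwards_iff)

lemma affine_edwards_ex:
  assumes "1 - c * b\<^sup>2 \<noteq> 0"
  obtains a where "(a, b) \<in> affine_edwards c" "(- a, b) \<in> affine_edwards c"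
proof -
  obtain a where "a ^ 2 = (1 - b\<^sup>2) / (1 - c * b\<^sup>2)"
    using nth_root_exists[of 2] by auto
  then show ?thesis using that[of a] assms by (simp add: affine_edwards_iff)
qed

text \<open>The equation in the form \<open>x\<^sup>2 (1 - c y\<^sup>2) = 1 - y\<^sup>2\<close> eliminates \<open>x\<^sup>2\<close> at the cost of
  multiplying by \<open>1 - c y\<^sup>2\<close>.\<close>

lemma poly_pair_reduce:
  assumes "poly_pair x y f e"
  shows "\<exists>p q N. (\<forall>a b. (a, b) \<in> affine_edwards c \<longrightarrow>
        (1 - c * b\<^sup>2) ^ N * f (a, b) = poly p b + poly q b * a) \<and>
      (1 - fls_const c * y\<^sup>2) ^ N * e = pev p y + pev q y * x"
  using assms
proof induction
  case (const a)
  show ?case by (intro exI[of _ "[:a:]"] exI[of _ 0]) simp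
next
  case fst
  show ?case by (intro exI[of _ 0] exI[of _ 1]) (simp add: exI[of _ 0])
next
  case snd
  show ?case by (intro exI[of _ "[:0, 1:]"] exI[of _ 0]) simp
next
  case (add f e f' e')
  then obtain p q N p' q' N' where
    *: "\<And>a b. (a, b) \<in> affine_edwards c \<Longrightarrow> (1 - c * b\<^sup>2) ^ N * f (a, b) = poly p b + poly q b * a"
       "\<And>a b. (a, b) \<in> affine_edwards c \<Longrightarrow> (1 - c * b\<^sup>2) ^ N' * f' (a, b) = poly p' b + poly q' b * a"
    and **: "(1 - fls_const c * y\<^sup>2) ^ N * e = pev p y + pev q y * x"
       "(1 - fls_const c * y\<^sup>2) ^ N' * e' = pev p' y + pev q' y * x"
    by blast
  have A: "D ^ (N + N') * (u + u') = D ^ N' * (D ^ N * u) + D ^ N * (D ^ N' * u')"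
    for D u u' :: "'z::comm_ring_1" by (simp add: power_add algebra_simps)
  let ?D = "[:1, 0, -c:]"
  have D: "poly ?D b = 1 - c * b\<^sup>2" "pev ?D y = 1 - fls_const c * y\<^sup>2" for b
    by (simp_all add: power2_eq_square algebra_simps)
  show ?case
  proof (intro exI conjI allI impI)
    show "(1 - c * b\<^sup>2) ^ (N + N') * (f (a, b) + f' (a, b)) =
      poly (?D ^ N' * p + ?D ^ N * p') b + poly (?D ^ N' * q + ?D ^ N * q') b * a"
      if "(a, b) \<in> affine_edwards c" for a b
      unfolding A *[OF that] poly_mult poly_add poly_power D by (simp add: algebra_simps)
    show "(1 - fls_const c * y\<^sup>2) ^ (N + N') * (e + e') =
      pev (?D ^ N' * p + ?D ^ N * p') y + pev (?D ^ N' * q + ?D ^ N * q') y * x"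
      unfolding A ** pev_mult pev_add pev_power D by (simp add: algebra_simps)
  qed
next
  case (mult f e f' e')
  then obtain p q N p' q' N' where
    *: "\<And>a b. (a, b) \<in> affine_edwards c \<Longrightarrow> (1 - c * b\<^sup>2) ^ N * f (a, b) = poly p b + poly q b * a"
       "\<And>a b. (a, b) \<in> affine_edwards c \<Longrightarrow> (1 - c * b\<^sup>2) ^ N' * f' (a, b) = poly p' b + poly q' b * a"
    and **: "(1 - fls_const c * y\<^sup>2) ^ N * e = pev p y + pev q y * x"
       "(1 - fls_const c * y\<^sup>2) ^ N' * e' = pev p' y + pev q' y * x"
    by blast
  \<comment> \<open>The extra factor D is spent on the product of the two terms with x, where D x^2
    becomes 1 - y^2.\<close>
  have A: "D ^ (N + N' + 1) * (u * u') = D * ((D ^ N * u) * (D ^ N' * u'))"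
    for D u u' :: "'z::comm_ring_1" by (simp add: power_add algebra_simps)
  have B: "D * ((p + q * u) * (p' + q' * u)) = (D * p * p' + q * q' * (u\<^sup>2 * D)) + D * (p * q' + p' * q) * u"
    for D u p p' q q' :: "'z::comm_ring_1" by (simp add: power2_eq_square algebra_simps)
  let ?D = "[:1, 0, -c:]" and ?E = "[:1, 0, -1:]"
  have D: "poly ?D b = 1 - c * b\<^sup>2" "pev ?D y = 1 - fls_const c * y\<^sup>2" 
    "poly ?E b = 1 - b\<^sup>2" "pev ?E y = 1 - y\<^sup>2" for b
    by (simp_all add: power2_eq_square algebra_simps)
  show ?case
  proof (intro exI conjI allI impI)
    show "(1 - c * b\<^sup>2) ^ (N + N' + 1) * (f (a, b) * f' (a, b)) =
      poly (?D * p * p' + q * q' * ?E) b + poly (?D * (p * q' + p' * q)) b * a"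
      if "(a, b) \<in> affine_edwards c" for a b
      unfolding A *[OF that] B poly_mult poly_add D
      by (simp only: that[unfolded affine_edwards_iff])
    show "(1 - fls_const c * y\<^sup>2) ^ (N + N' + 1) * (e * e') =
      pev (?D * p * p' + q * q' * ?E) y + pev (?D * (p * q' + p' * q)) y * x"
      unfolding A ** B pev_mult pev_add D equation' by (rule refl)
  qed
qed

text \<open>Both sides say that the polynomials p and q of the reduced form are 0. On the curve this
  is read off from the two points (a, b) and (- a, b) over b: their sum gives p(b) = 0, and then
  q(b) a = 0. The values b with 1 - c b^2 = 0, over which there is no affine point, are covered by
  multiplying with that factor.\<close>

lemma poly_pair_eq_0_iff:
  assumes "poly_pair x y f e"
  shows "e = 0 \<longleftrightarrow> (\<forall>a b. (a, b) \<in> affine_edwards c \<longrightarrow> f (a, b) = 0)"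
proof -
  obtain p q N where
    *: "\<And>a b. (a, b) \<in> affine_edwards c \<Longrightarrow> (1 - c * b\<^sup>2) ^ N * f (a, b) = poly p b + poly q b * a"
    and **: "(1 - fls_const c * y\<^sup>2) ^ N * e = pev p y + pev q y * x"
    using poly_pair_reduce[OF assms] by blast
  show ?thesis
  proof
    assume "e = 0"
    then have "p = 0" "q = 0" using independent[of p q] ** by auto
    then have "(1 - c * b\<^sup>2) ^ N * f (a, b) = 0" if "(a, b) \<in> affine_edwards c" for a b
      using * that by simp
    then show "\<forall>a b. (a, b) \<in> affine_edwards c \<longrightarrow> f (a, b) = 0"
      using affine_edwards_den by simp
  next
    assume "\<forall>a b. (a, b) \<in> affine_edwards c \<longrightarrow> f (a, b) = 0"
    then have z: "poly p b + poly q b * a = 0" if "(a, b) \<in> affine_edwards c" for a b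
      using * that by (metis mult_zero_right)
    have "poly p b = 0 \<and> poly q b * (1 - b\<^sup>2) = 0" if b: "1 - c * b\<^sup>2 \<noteq> 0" for b
    proof -
      obtain a where a: "(a, b) \<in> affine_edwards c" "(- a, b) \<in> affine_edwards c"
        using affine_edwards_ex[OF b] .
      have "2 * poly p b = (poly p b + poly q b * a) + (poly p b + poly q b * - a)" by simp
      then have "2 * poly p b = 0" by (simp only: z[OF a(1)] z[OF a(2)] add_0)
      then have p0: "poly p b = 0" using two by simp
      then have "poly q b = 0 \<or> a = 0" using z[OF a(1)] by (metis add_0 mult_eq_0_iff)
      then show ?thesis using p0 a(1) by (auto simp: affine_edwards_iff)
    qed
    moreover have "poly [:1, 0, -c:] b = 1 - c * b\<^sup>2" "poly [:1, 0, -1:] b = 1 - b\<^sup>2" for b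
      by (simp_all add: power2_eq_square algebra_simps)
    ultimately have "poly (p * [:1, 0, -c:]) b = 0 \<and> poly (q * [:1, 0, -1:] * [:1, 0, -c:]) b = 0" for b
      unfolding poly_mult by (metis mult_zero_left mult_zero_right)
    then have "p * [:1, 0, -c:] = 0" "q * [:1, 0, -1:] * [:1, 0, -c:] = 0"
      by (blast intro: poly_vanishing_imp_0)+
    then have "p = 0" "q = 0"
      by (metis mult_eq_0_iff one_neq_zero pCons_eq_0_iff)+
    then have "(1 - fls_const c * y\<^sup>2) ^ N * e = 0" using ** by simp
    then show "e = 0" using den_nonzero by simp
  qed
qed

lemma poly_pair_unique:
  assumes "poly_pair x y f e" "poly_pair x y f e'"
  shows "e = e'"
  using poly_pair_eq_0_iff[OF poly_pair_diff[OF assms]] by simp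

end


section \<open>The function field at a generic point\<close>

lemma forms_sum:
  assumes "finite I" "\<And>t. t \<in> I \<Longrightarrow> f t \<in> forms n"
  shows "(\<lambda>p. \<Sum>t\<in>I. f t p) \<in> forms n"
proof -
  have "\<forall>t\<in>I. \<exists>a. f t = (\<lambda>(x, y, z). \<Sum>i\<le>n. \<Sum>j\<le>n - i. a i j * x ^ i * y ^ j * z ^ (n - i - j))"
    using assms(2) unfolding forms_def by blast
  from bchoice[OF this] obtain a where
    a: "\<And>t. t \<in> I \<Longrightarrow> f t = (\<lambda>(x, y, z). \<Sum>i\<le>n. \<Sum>j\<le>n - i. a t i j * x ^ i * y ^ j * z ^ (n - i - j))"
    by blast
  have "(\<Sum>t\<in>I. f t (x, y, z)) =
      (\<Sum>i\<le>n. \<Sum>j\<le>n - i. (\<Sum>t\<in>I. a t i j) * x ^ i * y ^ j * z ^ (n - i - j))" for x y z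
  proof -
    have "(\<Sum>t\<in>I. f t (x, y, z)) = (\<Sum>t\<in>I. \<Sum>i\<le>n. \<Sum>j\<le>n - i. a t i j * x ^ i * y ^ j * z ^ (n - i - j))"
      using a by simp
    also have "\<dots> = (\<Sum>i\<le>n. \<Sum>j\<le>n - i. \<Sum>t\<in>I. a t i j * x ^ i * y ^ j * z ^ (n - i - j))"
      by (subst sum.swap, intro sum.cong refl, subst sum.swap) (rule refl)
    finally show ?thesis by (simp add: sum_distrib_right)
  qed
  then show ?thesis
    unfolding forms_def by (intro CollectI exI[of _ "\<lambda>i j. \<Sum>t\<in>I. a t i j"]) (auto simp: fun_eq_iff)
qed

lemma forms_add: "f \<in> forms n \<Longrightarrow> g \<in> forms n \<Longrightarrow> (\<lambda>p. f p + g p) \<in> forms n"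
  using forms_sum[of "{False, True}" "\<lambda>t. if t then f else g" n] by (simp add: add.commute)

lemma forms_scale:
  assumes "f \<in> forms n"
  shows "(\<lambda>p. b * f p) \<in> forms n"
proof -
  obtain a where "f = (\<lambda>(x, y, z). \<Sum>i\<le>n. \<Sum>j\<le>n - i. a i j * x ^ i * y ^ j * z ^ (n - i - j))"
    using assms unfolding forms_def by auto
  then show ?thesis
    unfolding forms_def
    by (intro CollectI exI[of _ "\<lambda>i j. b * a i j"]) (auto simp: fun_eq_iff sum_distrib_left mult_ac)
qed

lemma forms_monomial:
  assumes "i + j + k = n"
  shows "(\<lambda>(x, y, z). x ^ i * y ^ j * z ^ k) \<in> forms n"
proof -
  have "(\<Sum>i'\<le>n. \<Sum>j'\<le>n - i'. (if i' = i then if j' = j then 1 else 0 else 0) * x ^ i' * y ^ j' * z ^ (n - i' - j'))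
      = x ^ i * y ^ j * z ^ k" for x y z :: 'a
  proof -
    have "(\<Sum>i'\<le>n. \<Sum>j'\<le>n - i'. (if i' = i then if j' = j then 1 else 0 else 0) * x ^ i' * y ^ j' * z ^ (n - i' - j'))
      = (\<Sum>i'\<le>n. if i' = i then (\<Sum>j'\<le>n - i'. if j' = j then x ^ i' * y ^ j' * z ^ (n - i' - j') else 0) else 0)"
    proof (intro sum.cong refl)
      fix i'
      show "(\<Sum>j'\<le>n - i'. (if i' = i then if j' = j then 1 else 0 else 0) * x ^ i' * y ^ j' * z ^ (n - i' - j'))
        = (if i' = i then (\<Sum>j'\<le>n - i'. if j' = j then x ^ i' * y ^ j' * z ^ (n - i' - j') else 0) else 0)"
      proof (cases "i' = i")
        case True
        show ?thesis unfolding True by (simp only: simp_thms if_True) (intro sum.cong refl, simp)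
      qed simp
    qed
    also have "\<dots> = x ^ i * y ^ j * z ^ (n - i - j)"
      using assms by simp
    finally show ?thesis using assms by (metis add.commute add_diff_cancel_left' diff_diff_left)
  qed
  then show ?thesis
    unfolding forms_def
    by (intro CollectI exI[of _ "\<lambda>i' j'. if i' = i then if j' = j then 1 else 0 else 0"])
      (auto simp: fun_eq_iff)
qed

lemma forms_mult:
  assumes "f \<in> forms m" "g \<in> forms n"
  shows "(\<lambda>p. f p * g p) \<in> forms (m + n)"
proof -
  obtain a where a: "f = (\<lambda>(x, y, z). \<Sum>i\<le>m. \<Sum>j\<le>m - i. a i j * x ^ i * y ^ j * z ^ (m - i - j))"
    using assms(1) unfolding forms_def by auto
  obtain b where b: "g = (\<lambda>(x, y, z). \<Sum>i\<le>n. \<Sum>j\<le>n - i. b i j * x ^ i * y ^ j * z ^ (n - i - j))"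
    using assms(2) unfolding forms_def by auto
  have mono: "(\<lambda>p. a i j * b i' j' * (\<lambda>(x, y, z). x ^ (i + i') * y ^ (j + j') * z ^ (m - i - j + (n - i' - j'))) p)
      \<in> forms (m + n)" if "i \<le> m" "j \<le> m - i" "i' \<le> n" "j' \<le> n - i'" for i j i' j'
    using that by (intro forms_scale forms_monomial) auto
  have "(\<lambda>p. \<Sum>i\<le>m. \<Sum>j\<le>m - i. \<Sum>i'\<le>n. \<Sum>j'\<le>n - i'.
      a i j * b i' j' * (\<lambda>(x, y, z). x ^ (i + i') * y ^ (j + j') * z ^ (m - i - j + (n - i' - j'))) p) \<in> forms (m + n)"
    by (intro forms_sum mono) auto
  also have "(\<lambda>p. \<Sum>i\<le>m. \<Sum>j\<le>m - i. \<Sum>i'\<le>n. \<Sum>j'\<le>n - i'.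
      a i j * b i' j' * (\<lambda>(x, y, z). x ^ (i + i') * y ^ (j + j') * z ^ (m - i - j + (n - i' - j'))) p)
    = (\<lambda>p. f p * g p)"
  proof
    fix p :: "'a \<times> 'a \<times> 'a"
    obtain x y z where p: "p = (x, y, z)" by (cases p)
    have "f p * g p = (\<Sum>i\<le>m. \<Sum>j\<le>m - i. a i j * x ^ i * y ^ j * z ^ (m - i - j) * g p)"
      unfolding a p prod.case sum_distrib_right ..
    also have "\<dots> = (\<Sum>i\<le>m. \<Sum>j\<le>m - i. \<Sum>i'\<le>n. \<Sum>j'\<le>n - i'.
        a i j * x ^ i * y ^ j * z ^ (m - i - j) * (b i' j' * x ^ i' * y ^ j' * z ^ (n - i' - j')))"
      unfolding b p prod.case sum_distrib_left ..
    finally show "(\<Sum>i\<le>m. \<Sum>j\<le>m - i. \<Sum>i'\<le>n. \<Sum>j'\<le>n - i'. a i j * b i' j' *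
        (\<lambda>(x, y, z). x ^ (i + i') * y ^ (j + j') * z ^ (m - i - j + (n - i' - j'))) p) = f p * g p"
      unfolding p by (simp only: prod.case power_add mult_ac)
  qed
  finally show ?thesis .
qed

lemma forms_const: "(\<lambda>_. a) \<in> forms 0"
  using forms_scale[OF forms_monomial[of 0 0 0 0], of a] by (simp add: case_prod_unfold)

definition dehomogenize :: "('a::field \<times> 'a \<times> 'a \<Rightarrow> 'a) \<Rightarrow> 'a \<times> 'a \<Rightarrow> 'a"
  where "dehomogenize f = (\<lambda>(x, y). f (x, y, 1))"

lemma forms_dehomogenize:
  assumes "f \<in> forms n"
  shows "\<exists>e. poly_pair x y (dehomogenize f) e"
proof -
  obtain a where a: "f = (\<lambda>(x, y, z). \<Sum>i\<le>n. \<Sum>j\<le>n - i. a i j * x ^ i * y ^ j * z ^ (n - i - j))"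
    using assms unfolding forms_def by auto
  have "dehomogenize f = (\<lambda>p. \<Sum>i\<le>n. \<Sum>j\<le>n - i. a i j * fst p ^ i * snd p ^ j)"
    by (simp add: dehomogenize_def a fun_eq_iff)
  moreover have "poly_pair x y (\<lambda>p. \<Sum>i\<le>n. \<Sum>j\<le>n - i. a i j * fst p ^ i * snd p ^ j)
      (\<Sum>i\<le>n. \<Sum>j\<le>n - i. fls_const (a i j) * x ^ i * y ^ j)"
    by (intro poly_pair_sum poly_pair.mult poly_pair.const poly_pair_power poly_pair.fst poly_pair.snd) auto
  ultimately show ?thesis by metis
qed

text \<open>All sufficiently large degrees are provided, so that the numerator and the denominator
  of a fraction can be given the same degree.\<close>

lemma poly_pair_homogenize:
  assumes "poly_pair x y f e"
  shows "\<exists>N. \<forall>n\<ge>N. \<exists>F\<in>forms n. dehomogenize F = f"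
  using assms
proof induction
  case (const a)
  have "(\<lambda>p. a * (\<lambda>(x, y, z). x ^ 0 * y ^ 0 * z ^ n) p) \<in> forms n" for n
    by (intro forms_scale forms_monomial) simp
  moreover have "dehomogenize (\<lambda>p. a * (\<lambda>(x, y, z). x ^ 0 * y ^ 0 * z ^ n) p) = (\<lambda>_. a)" for n
    by (simp add: dehomogenize_def fun_eq_iff)
  ultimately show ?case by blast
next
  case fst
  have "(\<lambda>(x, y, z). x ^ 1 * y ^ 0 * z ^ (n - 1)) \<in> forms n" if "n \<ge> 1" for n
    using that by (intro forms_monomial) simp
  moreover have "dehomogenize (\<lambda>(x, y, z). x ^ 1 * y ^ 0 * z ^ (n - 1)) = fst" for n
    by (simp add: dehomogenize_def fun_eq_iff)
  ultimately show ?case by blast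
next
  case snd
  have "(\<lambda>(x, y, z). x ^ 0 * y ^ 1 * z ^ (n - 1)) \<in> forms n" if "n \<ge> 1" for n
    using that by (intro forms_monomial) simp
  moreover have "dehomogenize (\<lambda>(x, y, z). x ^ 0 * y ^ 1 * z ^ (n - 1)) = snd" for n
    by (simp add: dehomogenize_def fun_eq_iff)
  ultimately show ?case by blast
next
  case (add f e f' e')
  then obtain N N' where N: "\<And>n. n \<ge> N \<Longrightarrow> \<exists>F\<in>forms n. dehomogenize F = f"
    "\<And>n. n \<ge> N' \<Longrightarrow> \<exists>F\<in>forms n. dehomogenize F = f'" by blast
  have "\<exists>F\<in>forms n. dehomogenize F = (\<lambda>p. f p + f' p)" if n: "n \<ge> max N N'" for n
  proof -
    obtain F F' where "F \<in> forms n" "dehomogenize F = f" "F' \<in> forms n" "dehomogenize F' = f'"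
      using N(1)[of n] N(2)[of n] n by auto
    then show ?thesis
      by (intro bexI[OF _ forms_add[of F n F']]) (auto simp: dehomogenize_def fun_eq_iff)
  qed
  then show ?case by blast
next
  case (mult f e f' e')
  then obtain N N' where N: "\<And>n. n \<ge> N \<Longrightarrow> \<exists>F\<in>forms n. dehomogenize F = f"
    "\<And>n. n \<ge> N' \<Longrightarrow> \<exists>F\<in>forms n. dehomogenize F = f'" by blast
  have "\<exists>F\<in>forms n. dehomogenize F = (\<lambda>p. f p * f' p)" if n: "n \<ge> N + N'" for n
  proof -
    obtain F F' where "F \<in> forms N" "dehomogenize F = f" "F' \<in> forms (n - N)" "dehomogenize F' = f'"
      using N n by (metis add_le_imp_le_diff add.commute order_refl)
    then show ?thesis
      using forms_mult[of F N F' "n - N"] n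
      by (intro bexI[of _ "\<lambda>p. F p * F' p"]) (auto simp: dehomogenize_def fun_eq_iff)
  qed
  then show ?case by blast
qed

text \<open>Sum and product in \<open>function_field\<close> are unions over all pairs of
  representatives. This evaluates such a union once every pair is known to contribute the same
  class.\<close>

lemma UN_UN_const:
  assumes "S \<noteq> {}" and "T \<noteq> {}"
    and const: "\<And>s s' t t'. (s, s') \<in> S \<Longrightarrow> (t, t') \<in> T \<Longrightarrow> h s s' t t' = Y"
  shows "(\<Union>(s, s')\<in>S. \<Union>(t, t')\<in>T. h s s' t t') = Y"
proof -
  have *: "(\<Union>(t, t')\<in>T. h s s' t t') = Y" if "(s, s') \<in> S" for s s'
  proof -
    have "(\<Union>(t, t')\<in>T. h s s' t t') = (\<Union>t\<in>T. Y)"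
      using const[OF that] by (intro SUP_cong refl) (simp add: split_beta)
    then show ?thesis using \<open>T \<noteq> {}\<close> by simp
  qed
  have "(\<Union>(s, s')\<in>S. \<Union>(t, t')\<in>T. h s s' t t') = (\<Union>s\<in>S. Y)"
  proof (intro SUP_cong refl)
    fix q assume q: "q \<in> S"
    obtain s s' where "q = (s, s')" by (cases q)
    then show "(case q of (s, s') \<Rightarrow> \<Union>(t, t')\<in>T. h s s' t t') = Y"
      using *[of s s'] q by (simp only: prod.case)
  qed
  then show ?thesis using \<open>S \<noteq> {}\<close> by simp
qed

definition subfield_ring :: "'a::field set \<Rightarrow> 'a ring"
  where "subfield_ring S = \<lparr>carrier = S, monoid.mult = (*), one = 1, ring.zero = 0, add = (+)\<rparr>"

lemma subfield_ring_simps [simp]: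
  "carrier (subfield_ring S) = S" "\<zero>\<^bsub>subfield_ring S\<^esub> = 0" "\<one>\<^bsub>subfield_ring S\<^esub> = 1"
  "a \<otimes>\<^bsub>subfield_ring S\<^esub> b = a * b" "a \<oplus>\<^bsub>subfield_ring S\<^esub> b = a + b"
  by (simp_all add: subfield_ring_def)

context generic_point
begin

definition closure_curve :: "('a \<times> 'a \<times> 'a) set"
  where "closure_curve = projective_closure (affine_edwards c)"

definition polynomial_value :: "('a \<times> 'a \<Rightarrow> 'a) \<Rightarrow> 'a fls"
  where "polynomial_value f = (THE e. poly_pair x y f e)"

lemma polynomial_value_eq: "poly_pair x y f e \<Longrightarrow> polynomial_value f = e"
  unfolding polynomial_value_def using poly_pair_unique by blast

definition generic_value :: "('a \<times> 'a \<times> 'a \<Rightarrow> 'a) \<Rightarrow> 'a fls"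
  where "generic_value f = polynomial_value (dehomogenize f)"

lemma generic_value_poly_pair: "f \<in> forms n \<Longrightarrow> poly_pair x y (dehomogenize f) (generic_value f)"
  using forms_dehomogenize polynomial_value_eq unfolding generic_value_def by metis

lemma generic_value_add:
  assumes "f \<in> forms n" "g \<in> forms n"
  shows "generic_value (\<lambda>p. f p + g p) = generic_value f + generic_value g"
proof -
  have "dehomogenize (\<lambda>p. f p + g p) = (\<lambda>p. dehomogenize f p + dehomogenize g p)"
    by (auto simp: dehomogenize_def)
  then show ?thesis
    using poly_pair.add[OF generic_value_poly_pair generic_value_poly_pair, OF assms]
      polynomial_value_eq unfolding generic_value_def by metis
qed

lemma generic_value_mult:
  assumes "f \<in> forms m" "g \<in> forms n"
  shows "generic_value (\<lambda>p. f p * g p) = generic_value f * generic_value g"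
proof -
  have "dehomogenize (\<lambda>p. f p * g p) = (\<lambda>p. dehomogenize f p * dehomogenize g p)"
    by (auto simp: dehomogenize_def)
  then show ?thesis
    using poly_pair.mult[OF generic_value_poly_pair generic_value_poly_pair, OF assms]
      polynomial_value_eq unfolding generic_value_def by metis
qed

lemma generic_value_const: "generic_value (\<lambda>_. a) = fls_const a"
  using polynomial_value_eq[OF poly_pair.const] by (simp add: generic_value_def dehomogenize_def case_prod_unfold)

lemma generic_value_eq_0_iff:
  assumes "f \<in> forms n"
  shows "generic_value f = 0 \<longleftrightarrow> (\<forall>p\<in>closure_curve. f p = 0)"
proof -
  have "(\<forall>p\<in>closure_curve. f p = 0) \<longleftrightarrow> (\<forall>(a, b)\<in>affine_edwards c. f (a, b, 1) = 0)"
  proof (intro iffI ballI)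
    fix q assume f: "\<forall>p\<in>closure_curve. f p = 0" and q: "q \<in> affine_edwards c"
    obtain a b where ab: "q = (a, b)" by (cases q)
    then have "(a, b, 1) \<in> closure_curve"
      using q unfolding closure_curve_def projective_closure_def by auto
    then show "case q of (a, b) \<Rightarrow> f (a, b, 1) = 0" using f ab by simp
  next
    fix p assume "\<forall>(a, b)\<in>affine_edwards c. f (a, b, 1) = 0" "p \<in> closure_curve"
    then show "f p = 0" using assms unfolding closure_curve_def projective_closure_def by blast
  qed
  also have "\<dots> \<longleftrightarrow> (\<forall>a b. (a, b) \<in> affine_edwards c \<longrightarrow> dehomogenize f (a, b) = 0)"
    by (auto simp: dehomogenize_def)
  finally show ?thesis
    using poly_pair_eq_0_iff[OF generic_value_poly_pair[OF assms]] by simp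
qed

definition fraction_value :: "('a \<times> 'a \<times> 'a \<Rightarrow> 'a) \<times> ('a \<times> 'a \<times> 'a \<Rightarrow> 'a) \<Rightarrow> 'a fls"
  where "fraction_value = (\<lambda>(f, g). generic_value f / generic_value g)"

lemma fractions_iff:
  "(f, g) \<in> fractions closure_curve \<longleftrightarrow> (\<exists>n. f \<in> forms n \<and> g \<in> forms n \<and> generic_value g \<noteq> 0)"
proof -
  have "(\<exists>p\<in>closure_curve. g p \<noteq> 0) \<longleftrightarrow> generic_value g \<noteq> 0" if "g \<in> forms n" for n
    using generic_value_eq_0_iff[OF that] by simp
  then show ?thesis unfolding fractions_def by auto
qed

text \<open>The difference f g' - f' g is again a form, and a form vanishes on the projective curve
  exactly when its value at the generic point is 0. So equivalence of fractions is equality of their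
  values.\<close>

lemma fraction_rel_iff:
  "(F, G) \<in> fraction_rel closure_curve \<longleftrightarrow>
    F \<in> fractions closure_curve \<and> G \<in> fractions closure_curve \<and> fraction_value F = fraction_value G"
proof -
  obtain f g f' g' where FG: "F = (f, g)" "G = (f', g')" by (metis prod.exhaust)
  have "(\<forall>p\<in>closure_curve. f p * g' p = f' p * g p) \<longleftrightarrow> fraction_value F = fraction_value G"
    if "F \<in> fractions closure_curve" "G \<in> fractions closure_curve"
  proof -
    obtain n n' where n: "f \<in> forms n" "g \<in> forms n" "generic_value g \<noteq> 0"
      "f' \<in> forms n'" "g' \<in> forms n'" "generic_value g' \<noteq> 0"
      using \<open>F \<in> _\<close> \<open>G \<in> _\<close> unfolding FG fractions_iff by blast
    have m: "(\<lambda>p. f p * g' p) \<in> forms (n + n')" "(\<lambda>p. f' p * g p) \<in> forms (n + n')"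
      using forms_mult[OF n(1,5)] forms_mult[OF n(4,2)] by (simp_all add: add.commute)
    have m': "(\<lambda>p. -1 * (f' p * g p)) \<in> forms (n + n')" using forms_scale[OF m(2)] .
    have "generic_value (\<lambda>p. -1 * (f' p * g p)) = - (generic_value f' * generic_value g)"
      using generic_value_mult[OF forms_const m(2), of "-1"] generic_value_mult[OF n(4,2)]
      by (simp add: generic_value_const)
    then have "generic_value (\<lambda>p. f p * g' p + -1 * (f' p * g p)) =
        generic_value f * generic_value g' - generic_value f' * generic_value g"
      using generic_value_add[OF m(1) m'] generic_value_mult[OF n(1,5)] by simp
    moreover have "(\<forall>p\<in>closure_curve. f p * g' p = f' p * g p) \<longleftrightarrow>
        generic_value (\<lambda>p. f p * g' p + -1 * (f' p * g p)) = 0"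
      using generic_value_eq_0_iff[OF forms_add[OF m(1) m']] by simp
    ultimately show ?thesis
      using n(3,6) unfolding FG fraction_value_def by (simp add: frac_eq_eq)
  qed
  then show ?thesis unfolding fraction_rel_def FG by blast
qed

text \<open>The inverse of evaluation at the generic point; by \<open>function_field_iso\<close> it
  is an isomorphism from the field of Laurent series onto the field of classes.\<close>

definition fiber :: "'a fls \<Rightarrow> 'a rational_function"
  where "fiber e = {F \<in> fractions closure_curve. fraction_value F = e}"

lemma ratio_eq_fiber:
  "(f, g) \<in> fractions closure_curve \<Longrightarrow> ratio closure_curve f g = fiber (fraction_value (f, g))"
  unfolding ratio_def fiber_def by (auto simp: fraction_rel_iff)

lemma fraction_value_mem: "F \<in> fractions closure_curve \<Longrightarrow> fraction_value F \<in> generated_field x y"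
proof -
  assume "F \<in> fractions closure_curve"
  then obtain f g n where *: "F = (f, g)" "f \<in> forms n" "g \<in> forms n"
    by (cases F) (auto simp: fractions_iff)
  show "fraction_value F \<in> generated_field x y"
    unfolding fraction_value_def *(1) prod.case
    using generated_fieldI[OF generic_value_poly_pair] *(2,3) by (intro generated_field_divide) blast+
qed

lemma fiber_nonempty:
  assumes "e \<in> generated_field x y"
  obtains f g where "(f, g) \<in> fractions closure_curve" "fraction_value (f, g) = e"
proof -
  obtain e1 e2 f1 f2 where e: "poly_pair x y f1 e1" "poly_pair x y f2 e2" "e2 \<noteq> 0" "e = e1 / e2"
    using assms unfolding generated_field_def by blast
  obtain N1 N2 where "\<And>n. n \<ge> N1 \<Longrightarrow> \<exists>F\<in>forms n. dehomogenize F = f1"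
    "\<And>n. n \<ge> N2 \<Longrightarrow> \<exists>F\<in>forms n. dehomogenize F = f2"
    using poly_pair_homogenize[OF e(1)] poly_pair_homogenize[OF e(2)] by blast
  then obtain F G where FG: "F \<in> forms (N1 + N2)" "dehomogenize F = f1"
      "G \<in> forms (N1 + N2)" "dehomogenize G = f2"
    by (metis le_add1 le_add2)
  then have "generic_value F = e1" "generic_value G = e2"
    using e polynomial_value_eq by (auto simp: generic_value_def)
  then show ?thesis
    using that[of F G] FG e unfolding fractions_iff fraction_value_def by auto
qed

lemma fiber_not_empty: "e \<in> generated_field x y \<Longrightarrow> fiber e \<noteq> {}"
  by (rule fiber_nonempty[of e]) (auto simp: fiber_def)

lemma fiber_mult:
  assumes "e \<in> generated_field x y" "e' \<in> generated_field x y"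
  shows "fiber e \<otimes>\<^bsub>function_field closure_curve\<^esub> fiber e' = fiber (e * e')"
proof -
  have "ratio closure_curve (\<lambda>p. f p * f' p) (\<lambda>p. g p * g' p) = fiber (e * e')"
    if FG: "(f, g) \<in> fiber e" "(f', g') \<in> fiber e'" for f g f' g'
  proof -
    obtain n n' where n: "f \<in> forms n" "g \<in> forms n" "generic_value g \<noteq> 0"
      "f' \<in> forms n'" "g' \<in> forms n'" "generic_value g' \<noteq> 0"
      using FG unfolding fiber_def mem_Collect_eq fractions_iff by blast
    have "(\<lambda>p. f p * f' p, \<lambda>p. g p * g' p) \<in> fractions closure_curve"
      using forms_mult[OF n(1,4)] forms_mult[OF n(2,5)] generic_value_mult[OF n(2,5)] n(3,6)
      unfolding fractions_iff by auto
    moreover have "fraction_value (\<lambda>p. f p * f' p, \<lambda>p. g p * g' p) = e * e'"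
      using FG generic_value_mult[OF n(1,4)] generic_value_mult[OF n(2,5)]
      by (auto simp: fraction_value_def fiber_def)
    ultimately show ?thesis by (simp add: ratio_eq_fiber)
  qed
  from UN_UN_const[OF fiber_not_empty[OF assms(1)] fiber_not_empty[OF assms(2)],
      of "\<lambda>f g f' g'. ratio closure_curve (\<lambda>p. f p * f' p) (\<lambda>p. g p * g' p)", OF this]
  show ?thesis by (simp add: function_field_def)
qed

lemma fiber_add:
  assumes "e \<in> generated_field x y" "e' \<in> generated_field x y"
  shows "fiber e \<oplus>\<^bsub>function_field closure_curve\<^esub> fiber e' = fiber (e + e')"
proof -
  have "ratio closure_curve (\<lambda>p. f p * g' p + f' p * g p) (\<lambda>p. g p * g' p) = fiber (e + e')"
    if FG: "(f, g) \<in> fiber e" "(f', g') \<in> fiber e'" for f g f' g'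
  proof -
    obtain n n' where n: "f \<in> forms n" "g \<in> forms n" "generic_value g \<noteq> 0"
      "f' \<in> forms n'" "g' \<in> forms n'" "generic_value g' \<noteq> 0"
      using FG unfolding fiber_def mem_Collect_eq fractions_iff by blast
    have m: "(\<lambda>p. f p * g' p) \<in> forms (n + n')" "(\<lambda>p. f' p * g p) \<in> forms (n + n')" "(\<lambda>p. g p * g' p) \<in> forms (n + n')"
      using forms_mult[OF n(1,5)] forms_mult[OF n(4,2)] forms_mult[OF n(2,5)] by (simp_all add: add.commute)
    have g: "generic_value (\<lambda>p. g p * g' p) = generic_value g * generic_value g'"
      using generic_value_mult[OF n(2,5)] .
    have "(\<lambda>p. f p * g' p + f' p * g p, \<lambda>p. g p * g' p) \<in> fractions closure_curve"
      using forms_add[OF m(1,2)] m(3) n(3,6) g unfolding fractions_iff by auto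
    moreover have "fraction_value (\<lambda>p. f p * g' p + f' p * g p, \<lambda>p. g p * g' p) = e + e'"
      using FG n(3,6) generic_value_add[OF m(1,2)] g generic_value_mult[OF n(1,5)] generic_value_mult[OF n(4,2)]
      by (auto simp: fraction_value_def fiber_def add_frac_eq)
    ultimately show ?thesis by (simp add: ratio_eq_fiber)
  qed
  from UN_UN_const[OF fiber_not_empty[OF assms(1)] fiber_not_empty[OF assms(2)],
      of "\<lambda>f g f' g'. ratio closure_curve (\<lambda>p. f p * g' p + f' p * g p) (\<lambda>p. g p * g' p)", OF this]
  show ?thesis by (simp add: function_field_def)
qed

lemma const_ratio_eq_fiber: "const_ratio closure_curve a = fiber (fls_const a)"
proof -
  have "(\<lambda>_. a, \<lambda>_. 1) \<in> fractions closure_curve"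
    unfolding fractions_iff using forms_const generic_value_const[of 1] by (metis fls_const_1 one_neq_zero)
  then show ?thesis
    by (simp add: const_ratio_def ratio_eq_fiber fraction_value_def generic_value_const)
qed

lemma function_field_iso:
  "algebra_iso (subfield_ring (generated_field x y)) fls_const
    (function_field closure_curve) (const_ratio closure_curve) fiber"
proof -
  have "carrier (function_field closure_curve) = fiber ` generated_field x y"
  proof (intro equalityI subsetI)
    fix A assume "A \<in> carrier (function_field closure_curve)"
    then obtain F where F: "F \<in> fractions closure_curve" "A = fraction_rel closure_curve `` {F}"
      unfolding function_field_def by (auto elim: quotientE)
    then have "A = fiber (fraction_value F)"
      using ratio_eq_fiber[of "fst F" "snd F"] by (simp add: ratio_def)
    then show "A \<in> fiber ` generated_field x y" using fraction_value_mem[OF F(1)] by blast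
  next
    fix A assume "A \<in> fiber ` generated_field x y"
    then obtain e where e: "e \<in> generated_field x y" "A = fiber e" by blast
    obtain f g where fg: "(f, g) \<in> fractions closure_curve" "fraction_value (f, g) = e"
      using fiber_nonempty[OF e(1)] .
    then have "A = fraction_rel closure_curve `` {(f, g)}"
      using ratio_eq_fiber[OF fg(1)] e by (simp add: ratio_def)
    then show "A \<in> carrier (function_field closure_curve)"
      using fg(1) by (simp add: function_field_def quotientI)
  qed
  moreover have "inj_on fiber (generated_field x y)"
  proof (rule inj_onI)
    fix e e' assume e: "e \<in> generated_field x y" "e' \<in> generated_field x y" "fiber e = fiber e'"
    obtain f g where "(f, g) \<in> fiber e" using fiber_nonempty[OF e(1)] unfolding fiber_def by blast
    then show "e = e'" using e(3) unfolding fiber_def by auto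
  qed
  ultimately show ?thesis
    unfolding algebra_iso_def algebra_closed_def bij_betw_def
  proof (intro conjI ballI allI)
    show "fiber \<zero>\<^bsub>subfield_ring (generated_field x y)\<^esub> = \<zero>\<^bsub>function_field closure_curve\<^esub>"
      "fiber \<one>\<^bsub>subfield_ring (generated_field x y)\<^esub> = \<one>\<^bsub>function_field closure_curve\<^esub>"
      using const_ratio_eq_fiber[of 0] const_ratio_eq_fiber[of 1] by (simp_all add: function_field_def)
  qed (auto simp: fiber_mult fiber_add const_ratio_eq_fiber)
qed

lemma edwards_curve_isomorphic:
  "isomorphic (nonsingular_curve (subfield_ring (generated_field x y)) fls_const) (edwards_curve c)"
  using algebra_iso_isomorphic[OF function_field_iso]
  by (simp add: edwards_curve_def desingularization_def closure_curve_def)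

end


section \<open>Discrete valuations and residues\<close>

definition nonunits :: "'a::field set \<Rightarrow> 'a set"
  where "nonunits R = {f \<in> R. f = 0 \<or> inverse f \<notin> R}"

lemma nonunits_subset: "f \<in> nonunits R \<Longrightarrow> f \<in> R"
  by (simp add: nonunits_def)

text \<open>Common roots a of the coefficients are cancelled one at a time, since y - a is never 0.
  Once no common root is left, the relation stays nontrivial when y is specialised to any
  constant.\<close>

lemma primitive_relation:
  fixes y z :: "'a::alg_closed_field fls"
  assumes "y \<notin> range fls_const"
    and "pev P y * z\<^sup>2 + pev Q y * z + pev S y = 0" and "P \<noteq> 0 \<or> Q \<noteq> 0 \<or> S \<noteq> 0"
  shows "\<exists>P Q S. pev P y * z\<^sup>2 + pev Q y * z + pev S y = 0 \<and>
    (\<forall>a. poly P a \<noteq> 0 \<or> poly Q a \<noteq> 0 \<or> poly S a \<noteq> 0)"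
  using assms(2,3)
proof (induction "degree P + degree Q + degree S" arbitrary: P Q S rule: less_induct)
  case less
  show ?case
  proof (cases "\<forall>a. poly P a \<noteq> 0 \<or> poly Q a \<noteq> 0 \<or> poly S a \<noteq> 0")
    case False
    then obtain a where "poly P a = 0" "poly Q a = 0" "poly S a = 0" by blast
    then obtain P' Q' S' where eq: "P = [:-a, 1:] * P'" "Q = [:-a, 1:] * Q'" "S = [:-a, 1:] * S'"
      unfolding poly_eq_0_iff_dvd by (metis dvdE)
    have deg: "degree ([:-a, 1:] * p) = (if p = 0 then 0 else degree p + 1)" for p
    proof (cases "p = 0")
      case False
      then have "degree ([:-a, 1:] * p) = degree [:-a, 1:] + degree p"
        by (intro degree_mult_eq) auto
      then show ?thesis using False by simp
    qed simp
    have "(y - fls_const a) * (pev P' y * z\<^sup>2 + pev Q' y * z + pev S' y) = 0"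
      using less.prems(1) unfolding eq pev_mult by (simp add: algebra_simps)
    moreover have "y - fls_const a \<noteq> 0" using assms(1) by auto
    ultimately have "pev P' y * z\<^sup>2 + pev Q' y * z + pev S' y = 0" by simp
    moreover have nz: "P' \<noteq> 0 \<or> Q' \<noteq> 0 \<or> S' \<noteq> 0" using less.prems(2) unfolding eq by auto
    moreover have "degree P' + degree Q' + degree S' < degree P + degree Q + degree S"
      using nz unfolding eq deg by auto
    ultimately show ?thesis using less.hyps by blast
  qed (use less.prems in blast)
qed

section \<open>The quadratic extension k(x, y) of k(y)\<close>

context generic_point
begin

text \<open>At y the polynomial is (1 - c y^2) (p + q x) (p - q x), the norm of p + q x over k(y)
  with its denominator cleared, and none of the factors vanishes.\<close>

lemma norm_nonzero:
  assumes "p \<noteq> 0 \<or> q \<noteq> 0"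
  shows "p\<^sup>2 * [:1, 0, -c:] - q\<^sup>2 * [:1, 0, -1:] \<noteq> 0"
proof
  assume "p\<^sup>2 * [:1, 0, -c:] - q\<^sup>2 * [:1, 0, -1:] = 0"
  then have "pev (p\<^sup>2 * [:1, 0, -c:]) y = pev (q\<^sup>2 * [:1, 0, -1:]) y"
    by (metis eq_iff_diff_eq_0)
  then have "pev p y ^ 2 * (1 - fls_const c * y\<^sup>2) = pev q y ^ 2 * (1 - y\<^sup>2)"
    unfolding pev_mult pev_power by (simp add: power2_eq_square algebra_simps)
  then have "(pev p y)\<^sup>2 = (pev q y * x)\<^sup>2"
    using den_nonzero unfolding equation'[symmetric] by (simp add: power_mult_distrib)
  then have "pev p y + pev (- q) y * x = 0 \<or> pev p y + pev q y * x = 0"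
    by (auto simp: power2_eq_iff)
  then show False
  proof
    assume "pev p y + pev (- q) y * x = 0"
    from independent[OF this] show False using assms by simp
  next
    assume "pev p y + pev q y * x = 0"
    from independent[OF this] show False using assms by simp
  qed
qed

text \<open>The denominator p2 + q2 x of a quotient is rationalised with its conjugate p2 - q2
  x.\<close>

lemma generated_field_form:
  assumes "g \<in> generated_field x y"
  obtains p q r where "r \<noteq> 0" "g * pev r y = pev p y + pev q y * x"
proof -
  obtain e1 e2 f1 f2 where e: "poly_pair x y f1 e1" "poly_pair x y f2 e2" "e2 \<noteq> 0" "g = e1 / e2"
    using assms unfolding generated_field_def by blast
  obtain p1 q1 N1 p2 q2 N2 where
    1: "(1 - fls_const c * y\<^sup>2) ^ N1 * e1 = pev p1 y + pev q1 y * x" and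
    2: "(1 - fls_const c * y\<^sup>2) ^ N2 * e2 = pev p2 y + pev q2 y * x"
    using poly_pair_reduce[OF e(1)] poly_pair_reduce[OF e(2)] by blast
  let ?D = "[:1, 0, -c:]" and ?E = "[:1, 0, -1:]"
  have D: "pev ?D y = 1 - fls_const c * y\<^sup>2" "pev ?E y = 1 - y\<^sup>2"
    by (simp_all add: power2_eq_square algebra_simps)
  define r where "r = ?D ^ N1 * (p2\<^sup>2 * ?D - q2\<^sup>2 * ?E)"
  have "p2 \<noteq> 0 \<or> q2 \<noteq> 0" using 2 e(3) den_nonzero by auto
  then have "r \<noteq> 0" using norm_nonzero[of p2 q2] by (simp add: r_def del: mult_pCons_right)
  have "g * e2 = e1" using e by simp
  have "pev r y = (1 - fls_const c * y\<^sup>2) ^ N1 * ((1 - fls_const c * y\<^sup>2) * (pev p2 y + pev q2 y * x) * (pev p2 y - pev q2 y * x))"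
    unfolding r_def pev_mult pev_diff pev_power D unfolding equation'[symmetric] by (simp add: power2_eq_square algebra_simps)
  also have "\<dots> = (1 - fls_const c * y\<^sup>2) ^ (N1 + N2 + 1) * (pev p2 y - pev q2 y * x) * e2"
    unfolding 2[symmetric] by (simp add: power_add algebra_simps)
  finally have "g * pev r y = (1 - fls_const c * y\<^sup>2) ^ (N1 + N2 + 1) * (pev p2 y - pev q2 y * x) * e1"
    unfolding \<open>g * e2 = e1\<close>[symmetric] by (simp add: mult_ac)
  also have "\<dots> = (1 - fls_const c * y\<^sup>2) ^ N2 * ((1 - fls_const c * y\<^sup>2) * ((pev p1 y + pev q1 y * x) * (pev p2 y - pev q2 y * x)))"
    unfolding 1[symmetric] by (simp add: power_add mult_ac)
  also have "(1 - fls_const c * y\<^sup>2) * ((pev p1 y + pev q1 y * x) * (pev p2 y - pev q2 y * x)) =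
    pev (?D * p1 * p2 - q1 * q2 * ?E) y + pev (?D * (q1 * p2 - p1 * q2)) y * x"
    unfolding pev_mult pev_diff D unfolding equation'[symmetric] by (simp add: power2_eq_square algebra_simps)
  finally have "g * pev r y = pev (?D ^ N2 * (?D * p1 * p2 - q1 * q2 * ?E)) y + pev (?D ^ N2 * (?D * (q1 * p2 - p1 * q2))) y * x"
    unfolding pev_mult pev_power D by (simp only: distrib_left mult.assoc)
  then show ?thesis using that \<open>r \<noteq> 0\<close> by blast
qed

text \<open>This is the characteristic equation of (p + q x) / r over k(y) with denominators
  cleared. Its constant term is the norm of p + q x, nonzero because g is.\<close>

lemma quadratic_relation:
  assumes "g \<in> generated_field x y" "g \<noteq> 0"
  obtains P Q S where "S \<noteq> 0" "pev P y * g\<^sup>2 + pev Q y * g + pev S y = 0"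
proof -
  obtain p q r where r: "r \<noteq> 0" "g * pev r y = pev p y + pev q y * x"
    using generated_field_form[OF assms(1)] .
  let ?D = "[:1, 0, -c:]" and ?E = "[:1, 0, -1:]"
  have D: "pev ?D y = 1 - fls_const c * y\<^sup>2" "pev ?E y = 1 - y\<^sup>2"
    by (simp_all add: power2_eq_square algebra_simps)
  have "g * pev r y \<noteq> 0" using r(1) assms(2) by simp
  then have "p \<noteq> 0 \<or> q \<noteq> 0" unfolding r(2) by auto
  then have S: "p\<^sup>2 * ?D - q\<^sup>2 * ?E \<noteq> 0" by (rule norm_nonzero)
  have "(g * pev r y - pev p y)\<^sup>2 * (1 - fls_const c * y\<^sup>2) = (pev q y)\<^sup>2 * (1 - y\<^sup>2)"
    unfolding r(2) equation'[symmetric] by (simp add: power_mult_distrib mult_ac)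
  then have "pev (?D * r\<^sup>2) y * g\<^sup>2 + pev (Polynomial.smult (- 2) (?D * r * p)) y * g + pev (p\<^sup>2 * ?D - q\<^sup>2 * ?E) y = 0"
    unfolding pev_mult pev_diff pev_power pev_smult D
    by (simp add: power2_eq_square algebra_simps)
  with S that show ?thesis by blast
qed

section \<open>Valuation rings of k(x, y) and their residues\<close>

abbreviation K :: "'a fls set" where "K \<equiv> generated_field x y"
abbreviation L :: "'a fls ring" where "L \<equiv> subfield_ring (generated_field x y)"

text \<open>A member of \<open>dvrs\<close> is only a ring; this names a valuation behind
  it.\<close>

definition valued :: "('a fls \<Rightarrow> int) \<Rightarrow> 'a fls set \<Rightarrow> bool"
  where "valued v R \<longleftrightarrow> discrete_valuation L fls_const v \<and> R = {f \<in> K. f = 0 \<or> 0 \<le> v f}"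

lemma dvr_valued: "R \<in> dvrs L fls_const \<longleftrightarrow> (\<exists>v. valued v R)"
  unfolding dvrs_def valued_def by auto

context
  fixes v R assumes v: "valued v R"
begin

lemma valued_mem: "f \<in> R \<longleftrightarrow> f \<in> K \<and> (f = 0 \<or> 0 \<le> v f)"
  using v by (auto simp: valued_def)

lemma valued_mult: "f \<in> K \<Longrightarrow> g \<in> K \<Longrightarrow> f \<noteq> 0 \<Longrightarrow> g \<noteq> 0 \<Longrightarrow> v (f * g) = v f + v g"
  using v by (simp add: valued_def discrete_valuation_def)

lemma valued_add:
  "f \<in> K \<Longrightarrow> g \<in> K \<Longrightarrow> f \<noteq> 0 \<Longrightarrow> g \<noteq> 0 \<Longrightarrow> f + g \<noteq> 0 \<Longrightarrow> min (v f) (v g) \<le> v (f + g)"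
  using v by (simp add: valued_def discrete_valuation_def)

lemma valued_const: "a \<noteq> 0 \<Longrightarrow> v (fls_const a) = 0"
  using v by (simp add: valued_def discrete_valuation_def)

lemma valued_surj: "\<exists>f\<in>K. f \<noteq> 0 \<and> v f = n"
proof -
  have "n \<in> v ` (K - {0})" using v by (simp add: valued_def discrete_valuation_def)
  then show ?thesis by blast
qed

lemma valued_inverse:
  assumes "f \<in> K" "f \<noteq> 0"
  shows "v (inverse f) = - v f"
proof -
  have "v (f * inverse f) = v f + v (inverse f)"
    using assms by (intro valued_mult) auto
  moreover have "v (f * inverse f) = 0" using assms valued_const[of 1] by simp
  ultimately show ?thesis by simp
qed

lemma valued_nonunits: "f \<in> nonunits R \<longleftrightarrow> f \<in> K \<and> (f = 0 \<or> 0 < v f)"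
  using valued_inverse[of f] generated_field_inverse[of f x y]
  by (auto simp: nonunits_def valued_mem)

end

context
  fixes R assumes R: "R \<in> dvrs L fls_const"
begin

lemma dvr_subset: "f \<in> R \<Longrightarrow> f \<in> K"
  using dvrs_subset_carrier[OF R] by auto

lemma dvr_const [simp, intro]: "fls_const a \<in> R"
proof -
  obtain v where v: "valued v R" using R dvr_valued by blast
  then show ?thesis using valued_const[OF v, of a] by (cases "a = 0") (auto simp: valued_mem)
qed

lemma dvr_add [intro]:
  assumes "f \<in> R" "g \<in> R" shows "f + g \<in> R"
proof -
  obtain v where v: "valued v R" using R dvr_valued by blast
  show ?thesis using assms valued_add[OF v, of f g] unfolding valued_mem[OF v]
    by (cases "f = 0 \<or> g = 0 \<or> f + g = 0") auto
qed

lemma dvr_mult [intro]: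
  assumes "f \<in> R" "g \<in> R" shows "f * g \<in> R"
proof -
  obtain v where v: "valued v R" using R dvr_valued by blast
  show ?thesis using assms valued_mult[OF v, of f g] unfolding valued_mem[OF v]
    by (cases "f = 0 \<or> g = 0") auto
qed

lemma dvr_minus [intro]: "f \<in> R \<Longrightarrow> - f \<in> R"
  using dvr_mult[OF dvr_const[of "-1"], of f] by simp

lemma dvr_diff [intro]: "f \<in> R \<Longrightarrow> g \<in> R \<Longrightarrow> f - g \<in> R"
  using dvr_add[of f "- g"] by auto

lemma dvr_power [intro]: "f \<in> R \<Longrightarrow> f ^ n \<in> R"
  using dvr_const[of 1] by (induction n) auto

lemma dvr_pev [intro]: "f \<in> R \<Longrightarrow> pev p f \<in> R"
  using dvr_const[of 0] by (induction p) auto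

lemma nonunits_add [intro]:
  assumes "f \<in> nonunits R" "g \<in> nonunits R" shows "f + g \<in> nonunits R"
proof -
  obtain v where v: "valued v R" using R dvr_valued by blast
  show ?thesis using assms valued_add[OF v, of f g] unfolding valued_nonunits[OF v]
    by (cases "f = 0 \<or> g = 0 \<or> f + g = 0") auto
qed

lemma nonunits_mult [intro]:
  assumes "f \<in> R" "g \<in> nonunits R" shows "f * g \<in> nonunits R"
proof -
  obtain v where v: "valued v R" using R dvr_valued by blast
  have "f \<in> K" "f = 0 \<or> 0 \<le> v f" using assms(1) valued_mem[OF v] by auto
  then show ?thesis using assms(2) valued_mult[OF v, of f g] unfolding valued_nonunits[OF v]
    by (cases "f = 0 \<or> g = 0") auto
qed

lemma nonunits_minus [intro]: "f \<in> nonunits R \<Longrightarrow> - f \<in> nonunits R"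
  using nonunits_mult[OF dvr_const[of "-1"], of f] by simp

lemma nonunits_diff [intro]: "f \<in> nonunits R \<Longrightarrow> g \<in> nonunits R \<Longrightarrow> f - g \<in> nonunits R"
  using nonunits_add[of f "- g"] by auto

lemma nonunits_const_iff [simp]: "fls_const a \<in> nonunits R \<longleftrightarrow> a = 0"
proof -
  obtain v where v: "valued v R" using R dvr_valued by blast
  then show ?thesis using valued_const[OF v, of a] by (cases "a = 0") (auto simp: valued_nonunits)
qed

lemma nonunits_prime:
  assumes "f * g \<in> nonunits R" "f \<in> R" "g \<in> R"
  shows "f \<in> nonunits R \<or> g \<in> nonunits R"
proof -
  obtain v where v: "valued v R" using R dvr_valued by blast
  have "f \<in> K" "f = 0 \<or> 0 \<le> v f" "g \<in> K" "g = 0 \<or> 0 \<le> v g" using assms(2,3) valued_mem[OF v] by auto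
  then show ?thesis using assms(1) valued_mult[OF v, of f g] unfolding valued_nonunits[OF v]
    by (cases "f = 0 \<or> g = 0") auto
qed

lemma inverse_nonunit:
  assumes "f \<in> K" "f \<notin> R"
  shows "inverse f \<in> nonunits R"
proof -
  obtain v where v: "valued v R" using R dvr_valued by blast
  show ?thesis using assms valued_inverse[OF v, of f] unfolding valued_mem[OF v] valued_nonunits[OF v] by auto
qed

text \<open>A valuation ring is integrally closed: otherwise the inverse of f would be a nonunit,
  and with it 1.\<close>

lemma dvr_root_of_power:
  assumes "f \<in> K" "f\<^sup>2 \<in> R"
  shows "f \<in> R"
proof (rule ccontr)
  assume "f \<notin> R"
  then have inv: "inverse f \<in> nonunits R" using assms(1) inverse_nonunit by blast
  then have "f\<^sup>2 * (inverse f * inverse f) \<in> nonunits R"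
    using assms(2) nonunits_subset[OF inv] by blast
  moreover have "f \<noteq> 0" using \<open>f \<notin> R\<close> dvr_const[of 0] by auto
  then have "f\<^sup>2 * (inverse f * inverse f) = fls_const 1"
    by (simp add: power2_eq_square field_simps)
  ultimately have "fls_const 1 \<in> nonunits R" by simp
  then show False by (simp del: fls_const_1)
qed

text \<open>The nonunits form a prime ideal and p splits into linear factors, one of which must
  therefore have its value in the ideal.\<close>

lemma pev_nonunit_imp_residue:
  assumes "f \<in> R" "pev p f \<in> nonunits R" "p \<noteq> 0"
  shows "\<exists>a. poly p a = 0 \<and> f - fls_const a \<in> nonunits R"
  using assms(2,3)
proof (induction "degree p" arbitrary: p rule: less_induct)
  case less
  show ?case
  proof (cases "degree p = 0")
    case True
    then obtain a where "p = [:a:]" using degree_eq_zeroE by blast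
    then show ?thesis using less.prems by simp
  next
    case False
    then obtain a where a: "poly p a = 0" using alg_closed_imp_poly_has_root by blast
    then obtain q where p: "p = [:-a, 1:] * q" by (metis dvd_def poly_eq_0_iff_dvd)
    then have q: "q \<noteq> 0" using less.prems by auto
    have deg: "degree p = degree q + 1"
      unfolding p using q by (subst degree_mult_eq) auto
    have "pev p f = (f - fls_const a) * pev q f"
      unfolding p pev_mult by simp
    then have "f - fls_const a \<in> nonunits R \<or> pev q f \<in> nonunits R"
      using less.prems(1) assms(1) by (intro nonunits_prime) auto
    then show ?thesis
      using less.hyps[of q] a q deg unfolding p by auto
  qed
qed

lemma pev_residue:
  assumes "f \<in> R" "f - fls_const a \<in> nonunits R"
  shows "pev p f - fls_const (poly p a) \<in> nonunits R"
proof (induction p)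
  case 0
  then show ?case using nonunits_const_iff[of 0] by simp
next
  case (pCons b p)
  have "pev (pCons b p) f - fls_const (poly (pCons b p) a) =
    f * (pev p f - fls_const (poly p a)) + fls_const (poly p a) * (f - fls_const a)"
    by (simp add: fls_const_add algebra_simps)
  then show ?case using assms pCons.IH by auto
qed

text \<open>Without a residue for y every nonzero polynomial in y would be a unit, so the valuation
  would be trivial on k(y). But an element of value -1 satisfies a quadratic equation over k(y),
  whose leading term then has value -2 and whose other nonzero terms have value at least -1. If the
  leading coefficient is 0, the clash is between the values -1 and 0.\<close>

lemma residue_y:
  assumes "y \<in> R"
  shows "\<exists>a. y - fls_const a \<in> nonunits R"
proof (rule ccontr)
  assume no: "\<nexists>a. y - fls_const a \<in> nonunits R"
  obtain v where v: "valued v R" using R dvr_valued by blast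
  have vp: "v (pev p y) = 0" if "p \<noteq> 0" for p
  proof -
    have "pev p y \<in> R" using assms by auto
    moreover have "pev p y \<notin> nonunits R" using pev_nonunit_imp_residue[OF assms _ that] no by blast
    ultimately show ?thesis using valued_mem[OF v] valued_nonunits[OF v] that by auto
  qed
  have vm: "v (- g) = v g" if "g \<in> K" "g \<noteq> 0" for g
  proof -
    have "v (pev [:-1:] y) = 0" by (rule vp) simp
    then show ?thesis using valued_mult[OF v, of "pev [:-1:] y" g] that by (auto simp del: pev_pCons) (simp add: generated_field_minus)
  qed
  obtain f where f: "f \<in> K" "f \<noteq> 0" "v f = -1" using valued_surj[OF v] by blast
  obtain P Q S where rel: "S \<noteq> 0" "pev P y * f\<^sup>2 + pev Q y * f + pev S y = 0"
    using quadratic_relation[OF f(1,2)] .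
  have mem: "pev p y \<in> K" for p by blast
  have vQf: "pev Q y * f = 0 \<or> v (pev Q y * f) = -1"
    using valued_mult[OF v mem f(1) _ f(2), of Q] vp[of Q] f(3) by (cases "Q = 0") auto
  have nz: "pev S y \<noteq> 0" using rel(1) by simp
  show False
  proof (cases "P = 0")
    case True
    then have e: "pev Q y * f = - pev S y" using rel(2) by (simp add: add_eq_0_iff2)
    then have "v (pev Q y * f) = 0" using vm[OF mem nz] vp[OF rel(1)] by simp
    then show False using vQf e nz by auto
  next
    case False
    have "pev P y * f\<^sup>2 = - (pev Q y * f + pev S y)"
      using rel(2) by (metis add.assoc eq_neg_iff_add_eq_0)
    moreover have nzP: "pev P y * f\<^sup>2 \<noteq> 0" using False f by simp
    ultimately have nz2: "pev Q y * f + pev S y \<noteq> 0" and eq: "v (pev P y * f\<^sup>2) = v (- (pev Q y * f + pev S y))"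
      by (metis neg_0_equal_iff_equal, simp)
    have "v (f\<^sup>2) = -2" using valued_mult[OF v f(1) f(1) f(2) f(2)] f(3) by (simp add: power2_eq_square)
    then have "v (pev P y * f\<^sup>2) = -2"
      using valued_mult[OF v mem, of "f\<^sup>2" P] False f vp[OF False] by auto
    moreover have "pev Q y * f + pev S y \<in> K" using mem f(1) by blast
    ultimately have "v (pev Q y * f + pev S y) = -2" using eq vm[OF _ nz2] by simp
    moreover have "v (pev Q y * f + pev S y) \<ge> -1"
    proof (cases "pev Q y * f = 0")
      case True
      then show ?thesis unfolding True add_0 using vp[OF rel(1)] by simp
    next
      case ne: False
      have "pev Q y * f \<in> K" using mem f(1) by blast
      then show ?thesis using valued_add[OF v _ mem ne nz nz2] vQf ne vp[OF rel(1)] by auto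
    qed
    ultimately show False by simp
  qed
qed

text \<open>Specialising a primitive quadratic equation of f at the residue a of y leaves a nonzero
  polynomial over k whose value at f is a nonunit. One of its roots is the residue of f.\<close>

lemma residue_exists_finite:
  assumes "y \<in> R" "f \<in> R"
  shows "\<exists>a. f - fls_const a \<in> nonunits R"
proof (cases "f = 0")
  case True
  then show ?thesis using nonunits_const_iff[of 0] by (intro exI[of _ 0]) simp
next
  case False
  obtain P Q S where "S \<noteq> 0" "pev P y * f\<^sup>2 + pev Q y * f + pev S y = 0"
    using quadratic_relation[OF dvr_subset[OF assms(2)] False] .
  then obtain P Q S where rel: "pev P y * f\<^sup>2 + pev Q y * f + pev S y = 0"
    and prim: "\<And>a. poly P a \<noteq> 0 \<or> poly Q a \<noteq> 0 \<or> poly S a \<noteq> 0"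
    using primitive_relation[OF y_nonconst, of P f Q S] by blast
  obtain a where a: "y - fls_const a \<in> nonunits R" using residue_y[OF assms(1)] by blast
  let ?p = "[:poly S a, poly Q a, poly P a:]"
  have "pev ?p f = - (f\<^sup>2 * (pev P y - fls_const (poly P a)) + f * (pev Q y - fls_const (poly Q a)) + (pev S y - fls_const (poly S a)))
      + (pev P y * f\<^sup>2 + pev Q y * f + pev S y)"
    by (simp add: power2_eq_square algebra_simps)
  also have "\<dots> = - (f\<^sup>2 * (pev P y - fls_const (poly P a)) + f * (pev Q y - fls_const (poly Q a)) + (pev S y - fls_const (poly S a)))"
    unfolding rel by simp
  also have "\<dots> \<in> nonunits R"
    using pev_residue[OF assms(1) a] assms(2)
    by (intro nonunits_minus nonunits_add nonunits_mult dvr_power) auto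
  finally have "pev ?p f \<in> nonunits R" .
  moreover have "?p \<noteq> 0" using prim[of a] by auto
  ultimately show ?thesis using pev_nonunit_imp_residue[OF assms(2)] by blast
qed

end

lemma residue_exists:
  assumes R: "R \<in> dvrs L fls_const" and f: "f \<in> R"
  shows "\<exists>a. f - fls_const a \<in> nonunits R"
proof (cases "y \<in> R")
  case True
  then show ?thesis using residue_exists_finite[OF R] f by blast
next
  case False
  \<comment> \<open>At a pole of y the reciprocal generic point has a finite second coordinate, and
    it generates the same field.\<close>
  obtain s where s: "s\<^sup>2 = c" using nth_root_exists[of 2 c] by auto
  interpret r: generic_point c "1 / (fls_const s * x)" "1 / (fls_const s * y)"
    using reciprocal[OF s] .
  have "inverse y \<in> nonunits R" using inverse_nonunit[OF R _ False] by blast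
  then have "fls_const (inverse s) * inverse y \<in> R"
    using dvr_mult[OF R dvr_const[OF R]] nonunits_subset by blast
  moreover have "s \<noteq> 0" using s c0 by auto
  then have "fls_const s * fls_const (inverse s) = 1" using fls_const_mult[of s "inverse s"] by simp
  then have "fls_const (inverse s) = inverse (fls_const s)" by (metis inverse_unique)
  ultimately have "1 / (fls_const s * y) \<in> R" by (simp add: divide_inverse)
  then show ?thesis
    using r.residue_exists_finite[of R f] R f generated_field_reciprocal[OF s] by simp
qed

definition residue :: "'a fls \<Rightarrow> 'a fls set \<Rightarrow> 'a"
  where "residue f R = residue_value L fls_const f R"

context
  fixes R assumes R: "R \<in> dvrs L fls_const"
begin

lemma nonunits_eq: "R - Units (L\<lparr>carrier := R\<rparr>) = nonunits R"
proof -
  have "u \<in> Units (L\<lparr>carrier := R\<rparr>) \<longleftrightarrow> u \<noteq> 0 \<and> inverse u \<in> R" if "u \<in> R" for u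
  proof -
    have "u \<in> Units (L\<lparr>carrier := R\<rparr>) \<longleftrightarrow> (\<exists>w\<in>R. w * u = 1)"
      using that by (simp add: Units_def mult.commute)
    also have "\<dots> \<longleftrightarrow> u \<noteq> 0 \<and> inverse u \<in> R"
      by (metis inverse_unique left_inverse mult.commute mult_zero_right zero_neq_one)
    finally show ?thesis .
  qed
  then show ?thesis unfolding nonunits_def by auto
qed

lemma residue_unique:
  assumes "f - fls_const a \<in> nonunits R" "f - fls_const b \<in> nonunits R"
  shows "a = b"
proof -
  have "fls_const (b - a) = (f - fls_const a) - (f - fls_const b)" by (simp add: fls_const_diff)
  then have "fls_const (b - a) \<in> nonunits R" using nonunits_diff[OF R assms] by simp
  then show ?thesis using nonunits_const_iff[OF R] by simp
qed

lemma residue_eqI: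
  assumes "f - fls_const a \<in> nonunits R"
  shows "residue f R = a"
proof -
  have "(\<exists>m\<in>R - Units (L\<lparr>carrier := R\<rparr>). f = fls_const b \<oplus>\<^bsub>L\<^esub> m) \<longleftrightarrow> f - fls_const b \<in> nonunits R" for b
    unfolding nonunits_eq by (auto simp: algebra_simps intro: bexI[of _ "f - fls_const b"])
  then show ?thesis
    unfolding residue_def residue_value_def using assms residue_unique by (simp add: the_equality)
qed

lemma residue_nonunit:
  assumes "f \<in> R"
  shows "f - fls_const (residue f R) \<in> nonunits R"
proof -
  obtain a where a: "f - fls_const a \<in> nonunits R" using residue_exists[OF R assms] by blast
  then show ?thesis using residue_eqI[OF a] by simp
qed

lemma residue_const: "residue (fls_const a) R = a"
  using nonunits_const_iff[OF R, of 0] by (intro residue_eqI) simp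

lemma residue_add:
  assumes "f \<in> R" "g \<in> R"
  shows "residue (f + g) R = residue f R + residue g R"
proof (rule residue_eqI)
  have "f + g - fls_const (residue f R + residue g R) =
    (f - fls_const (residue f R)) + (g - fls_const (residue g R))"
    by (simp add: fls_const_add)
  also have "\<dots> \<in> nonunits R" by (intro nonunits_add[OF R] residue_nonunit assms)
  finally show "f + g - fls_const (residue f R + residue g R) \<in> nonunits R" .
qed

lemma residue_mult:
  assumes "f \<in> R" "g \<in> R"
  shows "residue (f * g) R = residue f R * residue g R"
proof (rule residue_eqI)
  have "f * g - fls_const (residue f R * residue g R) =
    f * (g - fls_const (residue g R)) + fls_const (residue g R) * (f - fls_const (residue f R))"
    by (simp add: algebra_simps)
  also have "\<dots> \<in> nonunits R"
    by (intro nonunits_add[OF R] nonunits_mult[OF R] residue_nonunit assms dvr_const[OF R])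
  finally show "f * g - fls_const (residue f R * residue g R) \<in> nonunits R" .
qed

lemma residue_eq_0_iff: "f \<in> R \<Longrightarrow> residue f R = 0 \<longleftrightarrow> f \<in> nonunits R"
proof
  assume "f \<in> R" "residue f R = 0"
  then show "f \<in> nonunits R" using residue_nonunit[of f] by simp
next
  assume "f \<in> nonunits R"
  then show "residue f R = 0" by (intro residue_eqI) simp
qed

text \<open>Taking residues is a homomorphism to k that fixes the constants. This links the two
  halves of \<open>poly_pair\<close>: the series e takes at a point of the curve the value of the
  function f at the coordinates of that point.\<close>

lemma residue_poly_pair:
  assumes "poly_pair u w f e" "u \<in> R" "w \<in> R"
  shows "e \<in> R \<and> residue e R = f (residue u R, residue w R)"
  using assms(1)
proof induction
  case (const a)
  show ?case using residue_const dvr_const[OF R] by simp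
next
  case (add f e f' e')
  then show ?case using residue_add[of e e'] dvr_add[OF R, of e e'] by simp
next
  case (mult f e f' e')
  then show ?case using residue_mult[of e e'] dvr_mult[OF R, of e e'] by simp
qed (use assms in simp_all)

end

end


section \<open>Points of the nonsingular curve\<close>

context
  fixes b :: "'a::field" and F :: "nat \<Rightarrow> 'a"
begin

text \<open>The recursion solves G^2 = F in degree n + 1: the two end terms of the convolution
  together are 2 b times the new coefficient, and the sum in between involves earlier coefficients
  only.\<close>

fun sqrt_coeff :: "nat \<Rightarrow> 'a"
  where "sqrt_coeff 0 = b"
  | "sqrt_coeff (Suc n) = (F (Suc n) - (\<Sum>i\<in>{1..n}. sqrt_coeff i * sqrt_coeff (Suc n - i))) / (2 * b)"

end

lemma fps_square_root:
  fixes F :: "'a::field fps"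
  assumes "(2::'a) \<noteq> 0" "b \<noteq> 0" "fps_nth F 0 = b\<^sup>2"
  shows "\<exists>G. G\<^sup>2 = F \<and> fps_nth G 0 = b"
proof -
  define s where "s = sqrt_coeff b (fps_nth F)"
  have "(\<Sum>i=0..n. s i * s (n - i)) = fps_nth F n" for n
  proof (cases n)
    case 0
    then show ?thesis using assms(3) by (simp add: s_def power2_eq_square)
  next
    case (Suc m)
    have "(\<Sum>i=0..Suc m. s i * s (Suc m - i)) = s 0 * s (Suc m) + (\<Sum>i=1..m. s i * s (Suc m - i)) + s (Suc m) * s 0"
      by (simp add: sum.atLeast_Suc_atMost)
    also have "\<dots> = 2 * b * s (Suc m) + (\<Sum>i=1..m. s i * s (Suc m - i))"
      by (simp add: s_def algebra_simps)
    also have "2 * b * s (Suc m) = fps_nth F (Suc m) - (\<Sum>i=1..m. s i * s (Suc m - i))"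
      using assms(1,2) by (simp add: s_def del: One_nat_def)
    finally show ?thesis using Suc by simp
  qed
  then have "(Abs_fps s)\<^sup>2 = F"
    by (intro fps_ext) (simp add: power2_eq_square fps_mult_nth)
  then show ?thesis by (intro exI[of _ "Abs_fps s"]) (simp add: s_def)
qed

text \<open>Otherwise the product of all the factors X - a would vanish everywhere without being
  0.\<close>

lemma infinite_UNIV_alg_closed: "infinite (UNIV :: 'a::alg_closed_field set)"
proof
  assume fin: "finite (UNIV :: 'a set)"
  let ?p = "\<Prod>a\<in>UNIV. [:- a, 1 :: 'a:]"
  have "poly ?p b = 0" for b
    using fin by (simp add: poly_prod prod_zero_iff)
  then have "?p = 0" by (rule poly_vanishing_imp_0)
  then show False using fin by simp
qed

text \<open>For y = a + X the quotient (1 - y^2) / (1 - c y^2) is a power series whose constant term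
  is a nonzero square, so it has a square root. This is the expansion of the curve at a point with
  second coordinate a, in the local parameter y - a.\<close>

lemma series_point:
  fixes a c :: "'a::alg_closed_field"
  assumes two: "(2::'a) \<noteq> 0" and c0: "c \<noteq> 0" and c1: "c \<noteq> 1"
    and nz: "1 - a\<^sup>2 \<noteq> 0" "1 - c * a\<^sup>2 \<noteq> 0"
  shows "\<exists>u. generic_point c u (fls_const a + fls_X)"
proof -
  let ?Y = "fps_const a + fps_X"
  let ?N = "1 - ?Y\<^sup>2" and ?D = "1 - fps_const c * ?Y\<^sup>2"
  obtain b where b: "b\<^sup>2 = (1 - a\<^sup>2) / (1 - c * a\<^sup>2)"
    using nth_root_exists[of 2 "(1 - a\<^sup>2) / (1 - c * a\<^sup>2)"] by auto
  have 0: "fps_nth ?N 0 = 1 - a\<^sup>2" "fps_nth ?D 0 = 1 - c * a\<^sup>2"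
    by (simp_all add: fps_mult_nth power2_eq_square)
  have "b \<noteq> 0" using b nz by auto
  moreover have "fps_nth (?N * inverse ?D) 0 = b\<^sup>2"
    using 0 by (simp add: b divide_inverse)
  ultimately obtain G where G: "G\<^sup>2 = ?N * inverse ?D" using fps_square_root[OF two] by blast
  have "inverse ?D * ?D = 1" using 0 nz by (intro inverse_mult_eq_1) simp
  then have "G\<^sup>2 * ?D = ?N" unfolding G mult.assoc by simp
  then have "fps_to_fls (G\<^sup>2 * ?D) = fps_to_fls ?N" by simp
  then have "(fps_to_fls G)\<^sup>2 * (1 - fls_const c * (fls_const a + fls_X)\<^sup>2) = 1 - (fls_const a + fls_X)\<^sup>2"
    by (simp add: fls_times_fps_to_fls fps_to_fls_power)
  then have "(fps_to_fls G)\<^sup>2 + (fls_const a + fls_X)\<^sup>2 =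
      1 + fls_const c * (fps_to_fls G)\<^sup>2 * (fls_const a + fls_X)\<^sup>2"
    by (simp add: algebra_simps)
  moreover have "fls_const a + fls_X \<notin> range fls_const"
  proof
    assume "fls_const a + fls_X \<in> range fls_const"
    then obtain a' where "fls_const a + fls_X = fls_const a'" by auto
    then have "fls_nth (fls_const a + fls_X) 1 = fls_nth (fls_const a') 1" by simp
    then show False by simp
  qed
  ultimately have "generic_point c (fps_to_fls G) (fls_const a + fls_X)"
    using two c0 c1 by unfold_locales
  then show ?thesis by blast
qed

context generic_point
begin

lemma fiber_eq:
  assumes "F \<in> fractions closure_curve"
  shows "fiber (fraction_value F) = fraction_rel closure_curve `` {F}"
  using assms by (auto simp: fiber_def fraction_rel_iff)

text \<open>Both fields are copies of the function field of the same curve, and y and w are the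
  values of the same fraction Y / Z.\<close>

lemma generic_point_iso:
  assumes "generic_point c u w"
  shows "\<exists>h. algebra_iso L fls_const (subfield_ring (generated_field u w)) fls_const h \<and> h y = w"
proof -
  interpret G: generic_point c u w using assms .
  let ?h = "inv_into (carrier G.L) G.fiber \<circ> fiber"
  have iso: "algebra_iso L fls_const G.L fls_const ?h"
    by (rule algebra_iso_comp[OF function_field_iso algebra_iso_inv[OF G.function_field_iso]])
  let ?f = "\<lambda>(x, y, z). x ^ 0 * y ^ 1 * z ^ 0 :: 'a" and ?g = "\<lambda>(x, y, z). x ^ 0 * y ^ 0 * z ^ 1 :: 'a"
  have forms: "?f \<in> forms 1" "?g \<in> forms 1" by (intro forms_monomial, simp)+
  have dh: "dehomogenize ?f = snd" "dehomogenize ?g = (\<lambda>_. 1)"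
    by (simp_all add: dehomogenize_def fun_eq_iff)
  have val: "generic_value ?f = y" "generic_value ?g = 1"
    using polynomial_value_eq[OF poly_pair.snd] polynomial_value_eq[OF poly_pair.const[of x y 1]]
    unfolding generic_value_def dh by simp_all
  have valG: "G.generic_value ?f = w" "G.generic_value ?g = 1"
    using G.polynomial_value_eq[OF poly_pair.snd] G.polynomial_value_eq[OF poly_pair.const[of u w 1]]
    unfolding G.generic_value_def dh by simp_all
  have "(?f, ?g) \<in> fractions closure_curve" unfolding fractions_iff using forms val by force
  from fiber_eq[OF this] G.fiber_eq[OF this]
  have "fiber y = G.fiber w"
    unfolding fraction_value_def G.fraction_value_def prod.case val valG by simp
  then have "?h y = inv_into (carrier G.L) G.fiber (G.fiber w)" by simp
  also have "\<dots> = w"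
    using G.function_field_iso by (intro inv_into_f_f) (auto simp: algebra_iso_def bij_betw_def)
  finally show ?thesis using iso by blast
qed

text \<open>The valuation is the order of a Laurent series, transported from the generic point with
  second coordinate a + X. It takes all integer values because X = (a + X) - a lies in the
  field.\<close>

lemma dvr_exists:
  assumes "1 - a\<^sup>2 \<noteq> 0" "1 - c * a\<^sup>2 \<noteq> 0"
  shows "\<exists>R\<in>dvrs L fls_const. y - fls_const a \<in> nonunits R"
proof -
  obtain u where u: "generic_point c u (fls_const a + fls_X)" using series_point[OF two c0 c1 assms] by blast
  let ?w = "fls_const a + fls_X"
  let ?K' = "generated_field u ?w"
  obtain h where h: "algebra_iso L fls_const (subfield_ring ?K') fls_const h" "h y = ?w"
    using generic_point_iso[OF u] by blast
  have hom: "h (f * g) = h f * h g" "h (f + g) = h f + h g" if "f \<in> K" "g \<in> K" for f g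
    using h(1) that by (auto simp: algebra_iso_def)
  have h0: "h 0 = 0" and hc: "h (fls_const e) = fls_const e" for e
    using h(1) by (auto simp: algebra_iso_def)
  have bij: "bij_betw h K ?K'" using h(1) by (simp add: algebra_iso_def)
  have hnz: "h f \<noteq> 0" if "f \<in> K" "f \<noteq> 0" for f
    using bij that h0 by (metis bij_betw_def generated_field_0 inj_onD)
  let ?v = "\<lambda>f. fls_subdegree (h f)"
  have "discrete_valuation L fls_const ?v"
    unfolding discrete_valuation_def
  proof (intro conjI ballI allI impI)
    have "n \<in> ?v ` (carrier L - {\<zero>\<^bsub>L\<^esub>})" for n
    proof -
      have "?w - fls_const a \<in> ?K'" by blast
      then have X: "fls_X \<in> ?K'" by simp
      obtain e where e: "e \<in> ?K'" "e \<noteq> 0" "fls_subdegree e = n"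
      proof (cases "n \<ge> 0")
        case True
        have "(fls_X :: 'a fls) ^ nat n \<in> ?K'" using X by blast
        moreover have "fls_subdegree ((fls_X :: 'a fls) ^ nat n) = n"
          using True by (simp add: fls_subdegree_pow)
        ultimately show ?thesis using that[of "fls_X ^ nat n"] by simp
      next
        case False
        have "inverse ((fls_X :: 'a fls) ^ nat (- n)) \<in> ?K'" using X by blast
        moreover have "fls_subdegree (inverse ((fls_X :: 'a fls) ^ nat (- n))) = n"
          using False by (simp add: fls_subdegree_pow fls_inverse_subdegree)
        ultimately show ?thesis using that[of "inverse (fls_X ^ nat (- n))"] by simp
      qed
      then obtain f where "f \<in> K" "e = h f" using bij by (auto simp: bij_betw_def)
      then show ?thesis using e h0 by force
    qed
    then show "?v ` (carrier L - {\<zero>\<^bsub>L\<^esub>}) = UNIV" by blast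
  next
    fix f g assume fg: "f \<in> carrier L - {\<zero>\<^bsub>L\<^esub>}" "g \<in> carrier L - {\<zero>\<^bsub>L\<^esub>}"
    then show "?v (f \<otimes>\<^bsub>L\<^esub> g) = ?v f + ?v g"
      using hom(1)[of f g] hnz[of f] hnz[of g] by simp
    assume "f \<oplus>\<^bsub>L\<^esub> g \<noteq> \<zero>\<^bsub>L\<^esub>"
    then have "h f + h g \<noteq> 0" using fg hom(2)[of f g] hnz[of "f + g"] by auto
    then show "min (?v f) (?v g) \<le> ?v (f \<oplus>\<^bsub>L\<^esub> g)"
      using fg hom(2)[of f g] fls_plus_subdegree[of "h f" "h g"] by simp
  next
    fix e :: 'a assume "e \<noteq> 0"
    then show "?v (fls_const e) = 0" by (simp add: hc)
  qed
  then have v: "valued ?v {f \<in> K. f = 0 \<or> 0 \<le> ?v f}" by (simp add: valued_def)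
  have "h (y - fls_const a) = fls_X"
    using hom(2)[OF generated_field_snd generated_field_minus[OF generated_field_const], of a] h(2) hc[of "- a"]
    by simp
  then have "y - fls_const a \<in> nonunits {f \<in> K. f = 0 \<or> 0 \<le> ?v f}"
    unfolding valued_nonunits[OF v] by auto
  then show ?thesis using v dvr_valued by blast
qed

text \<open>If P g^2 + Q g + S = 0, then a point at which g vanishes and y has the value a forces
  S(a) = 0. For S \<noteq> 0 only finitely many a allow this, while all but finitely many a are
  values of y at some point.\<close>

lemma nonunits_cofinite_imp_0:
  assumes fin: "finite (dvrs L fls_const - A)"
    and g: "g \<in> K" "\<And>R. R \<in> A \<Longrightarrow> R \<in> dvrs L fls_const \<Longrightarrow> g \<in> nonunits R"
  shows "g = 0"
proof (rule ccontr)
  assume "g \<noteq> 0"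
  obtain P Q S where rel: "S \<noteq> 0" "pev P y * g\<^sup>2 + pev Q y * g + pev S y = 0"
    using quadratic_relation[OF g(1) \<open>g \<noteq> 0\<close>] .
  \<comment> \<open>Besides the roots of S this excludes the values of y at which
    \<open>dvr_exists\<close> does not apply.\<close>
  let ?T = "S * [:1, 0, -1:] * [:1, 0, -c:]"
  let ?B = "{a. poly ?T a \<noteq> 0}"
  have T: "?T \<noteq> 0" using rel(1) by (metis mult_eq_0_iff one_neq_zero pCons_eq_0_iff)
  have "finite {a. poly ?T a = 0}" using poly_roots_finite[OF T] .
  moreover have "?B = UNIV - {a. poly ?T a = 0}" by auto
  ultimately have inf: "infinite ?B" using infinite_UNIV_alg_closed by (metis Diff_infinite_finite)
  have "\<exists>R\<in>dvrs L fls_const. y - fls_const a \<in> nonunits R" if "a \<in> ?B" for a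
  proof -
    have "poly ?T a = poly S a * (1 - a\<^sup>2) * (1 - c * a\<^sup>2)"
      by (simp add: power2_eq_square algebra_simps)
    then show ?thesis using that by (intro dvr_exists) auto
  qed
  then obtain R where R: "\<And>a. a \<in> ?B \<Longrightarrow> R a \<in> dvrs L fls_const" "\<And>a. a \<in> ?B \<Longrightarrow> y - fls_const a \<in> nonunits (R a)"
    by metis
  have "inj_on R ?B"
  proof (rule inj_onI)
    fix a b assume ab: "a \<in> ?B" "b \<in> ?B" "R a = R b"
    then show "a = b"
      using residue_unique[OF R(1)[OF ab(1)] R(2)[OF ab(1)]] R(2)[OF ab(2)] by simp
  qed
  then have "infinite (R ` ?B)" using inf finite_imageD by blast
  then have "\<not> R ` ?B \<subseteq> dvrs L fls_const - A" using fin finite_subset by blast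
  then obtain a where a: "a \<in> ?B" "R a \<in> A" using R(1) by blast
  note dvr = R(1)[OF a(1)] and ya = R(2)[OF a(1)]
  have y: "y \<in> R a"
    using dvr_add[OF dvr nonunits_subset[OF ya] dvr_const[OF dvr, of a]] by simp
  have gn: "g \<in> nonunits (R a)" using g(2) a(2) dvr by blast
  have "pev S y = - (pev P y * g\<^sup>2 + pev Q y * g)"
    using rel(2) by (metis add.commute eq_neg_iff_add_eq_0)
  also have "\<dots> \<in> nonunits (R a)"
    unfolding power2_eq_square
    by (intro nonunits_minus[OF dvr] nonunits_add[OF dvr] nonunits_mult[OF dvr] gn dvr_pev[OF dvr] y
        nonunits_subset[OF gn])
  finally have "pev S y - (pev S y - fls_const (poly S a)) \<in> nonunits (R a)"
    using pev_residue[OF dvr y ya] nonunits_diff[OF dvr] by blast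
  then have "poly S a = 0" using nonunits_const_iff[OF dvr] by simp
  then show False using a(1) by simp
qed

text \<open>The ring k[x, y, 1 / (x + b)], used for b = 1 and b = -1. It lies in the local ring of
  the point (b, 0), where x + b has the nonzero value 2 b, and inverting this one function is enough
  to expand in powers of y.\<close>

inductive_set localization :: "'a \<Rightarrow> 'a fls set" for b where
  const: "fls_const a \<in> localization b"
| x: "x \<in> localization b"
| y: "y \<in> localization b"
| inv: "1 / (x + fls_const b) \<in> localization b"
| add: "f \<in> localization b \<Longrightarrow> g \<in> localization b \<Longrightarrow> f + g \<in> localization b"
| mult: "f \<in> localization b \<Longrightarrow> g \<in> localization b \<Longrightarrow> f * g \<in> localization b"

text \<open>Near the points \<open>(1, 0)\<close> and \<open>(- 1, 0)\<close> the function \<open>y\<close> is a local parameter, because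
  \<open>x\<^sup>2 - 1 = y\<^sup>2 (c x\<^sup>2 - 1)\<close>.\<close>

lemma localization_expand:
  assumes b: "b\<^sup>2 = 1" and f: "f \<in> localization b"
  shows "\<exists>a. \<exists>g\<in>localization b. f = fls_const a + y * g"
  using f
proof induction
  case (const a)
  show ?case using localization.const[of 0 b] by (intro exI[of _ a] bexI[of _ 0]) simp_all
next
  case y
  show ?case using localization.const[of 1 b] by (intro exI[of _ 0] bexI[of _ 1]) simp_all
next
  case x
  let ?h = "1 / (x + fls_const b)"
  have xb: "x + fls_const b \<noteq> 0" using x_nonconst by (metis eq_neg_iff_add_eq_0 fls_const_uminus rangeI)
  let ?g = "y * (fls_const c * x * x + fls_const (-1)) * ?h"
  have "(x - fls_const b) * (x + fls_const b) = x\<^sup>2 - fls_const (b\<^sup>2)"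
    by (simp add: fls_const_power power2_eq_square algebra_simps)
  also have "\<dots> = y * y * (fls_const c * x * x + fls_const (-1))"
    using equation unfolding b by (simp add: power2_eq_square algebra_simps)
  finally have *: "(x - fls_const b) * (x + fls_const b) = y * y * (fls_const c * x * x + fls_const (-1))" .
  have "y * ?g = y * y * (fls_const c * x * x + fls_const (-1)) * ?h" by (simp only: mult_ac)
  also have "\<dots> = x - fls_const b" unfolding *[symmetric] using xb by simp
  finally have "x = fls_const b + y * ?g" by simp
  moreover have "?g \<in> localization b" by (intro localization.intros)
  ultimately show ?case by blast
next
  case inv
  let ?h = "1 / (x + fls_const b)"
  have xb: "x + fls_const b \<noteq> 0" using x_nonconst by (metis eq_neg_iff_add_eq_0 fls_const_uminus rangeI)
  have b0: "b \<noteq> 0" using b by auto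
  \<comment> \<open>The source is 1 / (x + b) = 1 / (2 b) - (x - b) / (2 b (x + b)), with a factor y
    taken out of x - b.\<close>
  let ?g = "fls_const (- 1 / (2 * b)) * (y * (fls_const c * x * x + fls_const (-1)) * ?h * ?h)"
  have "(x - fls_const b) * (x + fls_const b) = x\<^sup>2 - fls_const (b\<^sup>2)"
    by (simp add: fls_const_power power2_eq_square algebra_simps)
  also have "\<dots> = y * y * (fls_const c * x * x + fls_const (-1))"
    using equation unfolding b by (simp add: power2_eq_square algebra_simps)
  finally have **: "(x - fls_const b) * (x + fls_const b) = y * y * (fls_const c * x * x + fls_const (-1))" .
  have "y * (y * (fls_const c * x * x + fls_const (-1)) * ?h * ?h) =
      y * y * (fls_const c * x * x + fls_const (-1)) * ?h * ?h" by (simp only: mult_ac)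
  also have "\<dots> = (x - fls_const b) * ?h" unfolding **[symmetric] using xb by simp
  finally have *: "y * (y * (fls_const c * x * x + fls_const (-1)) * ?h * ?h) = (x - fls_const b) * ?h" .
  have "fls_const (2 * b) * h + - ((x + fls_const b) * h) = - ((x - fls_const b) * h)" for h
    by (simp only: mult_2 fls_const_add) (simp add: algebra_simps)
  from this[of ?h]
  have "fls_const (2 * b) * ?h + - ((x + fls_const b) * ?h) = - ((x - fls_const b) * ?h)" .
  moreover have "(x + fls_const b) * ?h = 1" using xb by simp
  ultimately have "fls_const (2 * b) * ?h = 1 - y * (y * (fls_const c * x * x + fls_const (-1)) * ?h * ?h)"
    unfolding * by (simp add: algebra_simps)
  then have "fls_const (1 / (2 * b)) * (fls_const (2 * b) * ?h) =
     fls_const (1 / (2 * b)) - fls_const (1 / (2 * b)) * (y * (y * (fls_const c * x * x + fls_const (-1)) * ?h * ?h))"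
    by (simp add: right_diff_distrib)
  also have "fls_const (1 / (2 * b)) * (fls_const (2 * b) * ?h) = fls_const (1 / (2 * b) * (2 * b)) * ?h"
    by (simp only: fls_const_mult mult.assoc)
  also have "1 / (2 * b) * (2 * b) = 1" using b0 two by simp
  finally have "?h = fls_const (1 / (2 * b)) + y * ?g"
    by (simp add: algebra_simps)
  moreover have "?g \<in> localization b" by (intro localization.intros)
  ultimately show ?case by blast
next
  case (add f g)
  then obtain a e a' e' where *: "f = fls_const a + y * e" "g = fls_const a' + y * e'"
    "e \<in> localization b" "e' \<in> localization b" by blast
  then have "f + g = fls_const (a + a') + y * (e + e')" by (simp add: fls_const_add algebra_simps)
  then show ?case using *(3,4) localization.add by blast
next
  case (mult f g)
  then obtain a e a' e' where *: "f = fls_const a + y * e" "g = fls_const a' + y * e'"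
    "e \<in> localization b" "e' \<in> localization b" by blast
  then have "f * g = fls_const (a * a') + y * (fls_const a * e' + e * fls_const a' + y * e * e')"
    by (simp add: algebra_simps)
  moreover have "fls_const a * e' + e * fls_const a' + y * e * e' \<in> localization b"
    using *(3,4) by (intro localization.intros)
  ultimately show ?case by blast
qed

lemma poly_pair_localization: "poly_pair x y f e \<Longrightarrow> e \<in> localization b"
  by (induction rule: poly_pair.induct) (auto intro: localization.intros)

text \<open>The points of the nonsingular curve above the point (b, 0) of the affine curve.\<close>

definition dvr_over :: "'a \<Rightarrow> 'a fls set \<Rightarrow> bool"
  where "dvr_over b R \<longleftrightarrow> R \<in> dvrs L fls_const \<and> y \<in> nonunits R \<and> x - fls_const b \<in> nonunits R"

lemma localization_subset:
  assumes b: "b\<^sup>2 = 1" and R: "dvr_over b R" and f: "f \<in> localization b"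
  shows "f \<in> R"
proof -
  have dvr: "R \<in> dvrs L fls_const" and yR: "y \<in> nonunits R" and xb: "x - fls_const b \<in> nonunits R"
    using R by (auto simp: dvr_over_def)
  from f show ?thesis
  proof induction
    case (const a)
    show ?case using dvr_const[OF dvr] .
  next
    case y
    show ?case using yR nonunits_subset by blast
  next
    case x
    show ?case using dvr_add[OF dvr nonunits_subset[OF xb] dvr_const[OF dvr, of b]] by simp
  next
    case inv
    show ?case
    proof (rule ccontr)
      assume "1 / (x + fls_const b) \<notin> R"
      then have "inverse (1 / (x + fls_const b)) \<in> nonunits R"
        by (intro inverse_nonunit[OF dvr] generated_field_divide generated_field_add
            generated_field_1 generated_field_const generated_field_fst)
      then have "x + fls_const b \<in> nonunits R" by simp
      then have "(x + fls_const b) - (x - fls_const b) \<in> nonunits R"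
        using xb nonunits_diff[OF dvr] by blast
      also have "(x + fls_const b) - (x - fls_const b) = fls_const (2 * b)"
        by (simp only: mult_2 fls_const_add) simp
      finally have "fls_const (2 * b) \<in> nonunits R" .
      then have "2 * b = 0" using nonunits_const_iff[OF dvr] by blast
      then show False using two b by auto
    qed
  next
    case (add f g)
    then show ?case using dvr_add[OF dvr] by blast
  next
    case (mult f g)
    then show ?case using dvr_mult[OF dvr] by blast
  qed
qed

text \<open>Splitting off y repeatedly must end, because each step lowers the value by v y > 0. The
  ring R serves to bound the number of steps; the factorisation itself does not refer to it.\<close>

lemma localization_factor:
  assumes b: "b\<^sup>2 = 1" and R: "dvr_over b R" and f: "f \<in> localization b" "f \<noteq> 0"
  shows "\<exists>n a. \<exists>g\<in>localization b. a \<noteq> 0 \<and> f = y ^ n * (fls_const a + y * g)"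
proof -
  obtain v where v: "valued v R" using R dvr_valued by (auto simp: dvr_over_def)
  have vy: "0 < v y" using R valued_nonunits[OF v] y_nonzero by (auto simp: dvr_over_def)
  show ?thesis
    using f
  proof (induction "nat (v f)" arbitrary: f rule: less_induct)
    case less
    obtain a g where g: "g \<in> localization b" "f = fls_const a + y * g"
      using localization_expand[OF b less.prems(1)] by blast
    show ?case
    proof (cases "a = 0")
      case True
      then have f: "f = y * g" using g by simp
      have g0: "g \<noteq> 0" using f less.prems(2) by auto
      have "g \<in> R" using localization_subset[OF b R g(1)] .
      then have "g \<in> K" "0 \<le> v g" using valued_mem[OF v] g0 by auto
      then have "v f = v y + v g" unfolding f using g0 y_nonzero by (intro valued_mult[OF v]) auto
      then have "nat (v g) < nat (v f)" using vy \<open>0 \<le> v g\<close> by simp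
      from less.hyps[OF this g(1) g0] obtain n a' g' where
        "g' \<in> localization b" "a' \<noteq> 0" "g = y ^ n * (fls_const a' + y * g')" by blast
      then show ?thesis unfolding f
        by (intro exI[of _ "Suc n"] exI[of _ a'] bexI[of _ g']) simp_all
    next
      case False
      then show ?thesis using g by (intro exI[of _ 0] exI[of _ a] bexI[of _ g]) simp_all
    qed
  qed
qed

text \<open>Such an element has residue a \<noteq> 0, hence value 0.\<close>

lemma dvr_over_unit:
  assumes b: "b\<^sup>2 = 1" and R: "dvr_over b R" and v: "valued v R" and g: "g \<in> localization b" "a \<noteq> 0"
  shows "fls_const a + y * g \<noteq> 0" "fls_const a + y * g \<in> K" "v (fls_const a + y * g) = 0"
proof -
  have dvr: "R \<in> dvrs L fls_const" using R by (simp add: dvr_over_def)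
  have yg: "y * g \<in> nonunits R"
    using R nonunits_mult[OF dvr localization_subset[OF b R g(1)], of y]
    by (simp add: dvr_over_def mult.commute)
  have no: "fls_const a + y * g \<notin> nonunits R"
  proof
    assume "fls_const a + y * g \<in> nonunits R"
    then have "fls_const a + y * g - y * g \<in> nonunits R" using yg nonunits_diff[OF dvr] by blast
    then show False using nonunits_const_iff[OF dvr] g(2) by simp
  qed
  then show "fls_const a + y * g \<noteq> 0" using nonunits_const_iff[OF dvr, of 0] by auto
  have mem: "fls_const a + y * g \<in> R"
    using dvr_add[OF dvr dvr_const[OF dvr] nonunits_subset[OF yg]] .
  then show "fls_const a + y * g \<in> K" using dvr_subset[OF dvr] by blast
  with mem no show "v (fls_const a + y * g) = 0"
    using valued_mem[OF v] valued_nonunits[OF v] by auto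
qed

text \<open>Write f = e / e' and factor e and e' into powers of y, with exponents n and n', and
  units. Every valuation over the point gives f the value (n - n') v y with v y > 0, so all of them
  agree on the sign.\<close>

lemma dvr_over_unique:
  assumes b: "b\<^sup>2 = 1" and R: "dvr_over b R" and R': "dvr_over b R'"
  shows "R \<subseteq> R'"
proof
  fix f assume f: "f \<in> R"
  have dvr: "R \<in> dvrs L fls_const" "R' \<in> dvrs L fls_const" using R R' by (simp_all add: dvr_over_def)
  show "f \<in> R'"
  proof (cases "f = 0")
    case True
    then show ?thesis using dvr_const[OF dvr(2), of 0] by simp
  next
    case False
    obtain e e' g g' where e: "poly_pair x y g e" "poly_pair x y g' e'" "e' \<noteq> 0" "f = e / e'"
      using dvr_subset[OF dvr(1) f] unfolding generated_field_def by blast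
    have "e \<noteq> 0" using False e by auto
    obtain n a u where u: "u \<in> localization b" "a \<noteq> 0" "e = y ^ n * (fls_const a + y * u)"
      using localization_factor[OF b R poly_pair_localization[OF e(1)] \<open>e \<noteq> 0\<close>] by blast
    obtain n' a' u' where u': "u' \<in> localization b" "a' \<noteq> 0" "e' = y ^ n' * (fls_const a' + y * u')"
      using localization_factor[OF b R poly_pair_localization[OF e(2)] e(3)] by blast
    have val: "v f = (int n - int n') * v y \<and> 0 < v y" if S: "dvr_over b S" and v: "valued v S" for v S
    proof -
      have vpow: "v (y ^ k) = int k * v y" for k
      proof (induction k)
        case 0
        show ?case using valued_const[OF v, of 1] by simp
      next
        case (Suc k)
        have "v (y * y ^ k) = v y + v (y ^ k)"
          using y_nonzero by (intro valued_mult[OF v]) auto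
        then show ?case using Suc by (simp add: algebra_simps)
      qed
      have "v e = int n * v y" unfolding u(3)
        using valued_mult[OF v, of "y ^ n" "fls_const a + y * u"] dvr_over_unit[OF b S v u(1,2)] vpow y_nonzero
        by (simp add: generated_field_power)
      moreover have "v e' = int n' * v y" unfolding u'(3)
        using valued_mult[OF v, of "y ^ n'" "fls_const a' + y * u'"] dvr_over_unit[OF b S v u'(1,2)] vpow y_nonzero
        by (simp add: generated_field_power)
      moreover have "e = f * e'" using e by simp
      then have "v e = v f + v e'"
        using valued_mult[OF v, of f e'] False e(3) dvr_subset[OF dvr(1) f] generated_fieldI[OF e(2)] by simp
      ultimately have "v f = (int n - int n') * v y" by (simp add: algebra_simps)
      moreover have "0 < v y" using S valued_nonunits[OF v] y_nonzero by (auto simp: dvr_over_def)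
      ultimately show ?thesis by simp
    qed
    obtain v v' where v: "valued v R" "valued v' R'" using dvr dvr_valued by blast
    have "0 \<le> v f" using f False valued_mem[OF v(1)] by blast
    then have "int n \<ge> int n'"
      using val[OF R v(1)] by (simp add: zero_le_mult_iff)
    then have "0 \<le> v' f" using val[OF R' v(2)] by simp
    then show ?thesis using valued_mem[OF v(2)] dvr_subset[OF dvr(1) f] by blast
  qed
qed

text \<open>At a zero of y the equation forces x^2 to be 1, so the ring lies over (1, 0) or (-1, 0),
  and over each of these there is at most one ring.\<close>

lemma finite_zeros_y: "finite {R \<in> dvrs L fls_const. y \<in> nonunits R}"
proof -
  have "\<exists>b. b\<^sup>2 = 1 \<and> dvr_over b R" if dvr: "R \<in> dvrs L fls_const" and y: "y \<in> nonunits R" for R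
  proof -
    have yR: "y \<in> R" using y nonunits_subset by blast
    have y2: "fls_const c * y\<^sup>2 \<in> nonunits R" "y\<^sup>2 \<in> nonunits R"
      unfolding power2_eq_square by (intro nonunits_mult[OF dvr] dvr_const[OF dvr] y yR)+
    have "inverse (1 - fls_const c * y\<^sup>2) \<in> R"
    proof (rule ccontr)
      assume "inverse (1 - fls_const c * y\<^sup>2) \<notin> R"
      then have "inverse (inverse (1 - fls_const c * y\<^sup>2)) \<in> nonunits R"
        by (intro inverse_nonunit[OF dvr] generated_field_inverse generated_field_diff generated_field_mult
            generated_field_power generated_field_1 generated_field_const generated_field_snd)
      then have "1 - fls_const c * y\<^sup>2 + fls_const c * y\<^sup>2 \<in> nonunits R"
        using y2 nonunits_add[OF dvr] by (metis inverse_inverse_eq)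
      then show False using nonunits_const_iff[OF dvr, of 1] by simp
    qed
    moreover have "1 - y\<^sup>2 \<in> R"
      using dvr_diff[OF dvr dvr_const[OF dvr, of 1] nonunits_subset[OF y2(2)]] by simp
    moreover have "x\<^sup>2 = (1 - y\<^sup>2) * inverse (1 - fls_const c * y\<^sup>2)"
      using equation' den_nonzero by (simp add: field_simps)
    ultimately have x2: "x\<^sup>2 \<in> R" using dvr_mult[OF dvr] by simp
    have xR: "x \<in> R" using dvr_root_of_power[OF dvr _ x2] by blast
    have "(x - fls_const 1) * (x + fls_const 1) = x\<^sup>2 * (fls_const c * y\<^sup>2) - y\<^sup>2"
      using equation by (simp add: power2_eq_square algebra_simps)
    also have "\<dots> \<in> nonunits R"
      using nonunits_diff[OF dvr nonunits_mult[OF dvr x2 y2(1)] y2(2)] .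
    finally have "x - fls_const 1 \<in> nonunits R \<or> x + fls_const 1 \<in> nonunits R"
      by (rule nonunits_prime[OF dvr]) (intro dvr_diff[OF dvr] dvr_add[OF dvr] xR dvr_const[OF dvr])+
    then have "x - fls_const 1 \<in> nonunits R \<or> x - fls_const (- 1) \<in> nonunits R" by simp
    then show ?thesis unfolding dvr_over_def using dvr y by (metis power2_minus power_one)
  qed
  then have "{R \<in> dvrs L fls_const. y \<in> nonunits R} \<subseteq> (\<Union>b\<in>{b. b\<^sup>2 = 1}. {R. dvr_over b R})" by blast
  moreover have "finite {b::'a. b\<^sup>2 = 1}" by (simp add: power2_eq_1_iff Collect_disj_eq)
  moreover have "finite {R. dvr_over b R}" if "b\<^sup>2 = 1" for b
  proof (cases "\<exists>R. dvr_over b R")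
    case True
    then obtain R where "dvr_over b R" by blast
    then have "{R. dvr_over b R} \<subseteq> {R}" using dvr_over_unique[OF that] by blast
    then show ?thesis using finite_subset by blast
  qed simp
  then have "finite (\<Union>b\<in>{b. b\<^sup>2 = 1}. {R. dvr_over b R})"
    using \<open>finite {b. b\<^sup>2 = 1}\<close> by (intro finite_UN_I) auto
  ultimately show ?thesis using finite_subset by blast
qed

lemma finite_poles_y: "finite {R \<in> dvrs L fls_const. y \<notin> R}"
proof -
  obtain s where s: "s\<^sup>2 = c" using nth_root_exists[of 2 c] by auto
  interpret r: generic_point c "1 / (fls_const s * x)" "1 / (fls_const s * y)"
    using reciprocal[OF s] .
  have "{R \<in> dvrs L fls_const. y \<notin> R} \<subseteq> {R \<in> dvrs L fls_const. 1 / (fls_const s * y) \<in> nonunits R}"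
  proof
    fix R assume "R \<in> {R \<in> dvrs L fls_const. y \<notin> R}"
    then have R: "R \<in> dvrs L fls_const" "y \<notin> R" by auto
    then have "inverse y \<in> nonunits R" by (intro inverse_nonunit[OF R(1)]) auto
    moreover have "inverse (fls_const s) = fls_const (inverse s)"
      by (cases "s = 0") (simp_all add: inverse_unique)
    ultimately have "inverse (fls_const s) * inverse y \<in> nonunits R"
      using nonunits_mult[OF R(1) dvr_const[OF R(1)]] by simp
    then show "R \<in> {R \<in> dvrs L fls_const. 1 / (fls_const s * y) \<in> nonunits R}"
      using R(1) by (simp add: divide_inverse)
  qed
  then show ?thesis using r.finite_zeros_y finite_subset generated_field_reciprocal[OF s] by simp
qed

end


section \<open>From isomorphisms of curves to equality of function fields\<close>

lemma poly_pair_transfer: "poly_pair x y f e \<Longrightarrow> \<exists>e'. poly_pair u w f e'"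
  by (induction rule: poly_pair.induct) (blast intro: poly_pair.intros)+

lemma generated_field_swap: "generated_field y x = generated_field x y"
  by (intro equalityI generated_field_mono) auto

context generic_point
begin

text \<open>Otherwise the empty set would be cofinite, and 1 would vanish at each of its points for
  trivial reasons.\<close>

lemma infinite_dvrs: "infinite (dvrs L fls_const)"
proof
  assume "finite (dvrs L fls_const)"
  then have "(1::'a fls) = 0" by (intro nonunits_cofinite_imp_0[of "{}"]) auto
  then show False by simp
qed

text \<open>The points above the affine curve. They form a nonempty open set on which every
  polynomial in x and y is regular.\<close>

definition finite_part :: "'a fls set set"
  where "finite_part = {R \<in> dvrs L fls_const. x \<in> R \<and> y \<in> R}"

lemma finite_complement_finite_part: "finite (dvrs L fls_const - finite_part)"
proof -
  interpret s: generic_point c y x by (rule swap)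
  have "dvrs L fls_const - finite_part \<subseteq> {R \<in> dvrs L fls_const. y \<notin> R} \<union> {R \<in> dvrs L fls_const. x \<notin> R}"
    by (auto simp: finite_part_def)
  moreover have "finite {R \<in> dvrs L fls_const. x \<notin> R}"
    using s.finite_poles_y by (simp only: generated_field_swap)
  ultimately show ?thesis using finite_poles_y finite_subset by blast
qed

lemma openin_finite_part: "openin (cofinite_topology (dvrs L fls_const)) finite_part"
  using finite_complement_finite_part by (auto simp: openin_cofinite_topology finite_part_def)

lemma finite_part_nonempty: "finite_part \<noteq> {}"
  using finite_complement_finite_part infinite_dvrs by auto

lemma residues_0_imp_0:
  assumes "finite (dvrs L fls_const - A)" "g \<in> K"
    "\<And>R. R \<in> A \<Longrightarrow> R \<in> dvrs L fls_const \<Longrightarrow> g \<in> R \<and> residue g R = 0"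
  shows "g = 0"
  using assms residue_eq_0_iff by (intro nonunits_cofinite_imp_0[of A]) auto

end

lemma morphism_pullback:
  assumes "morphism (nonsingular_curve L \<kappa>) (nonsingular_curve L' \<kappa>') \<phi>"
    and "openin (cofinite_topology (dvrs L' \<kappa>')) U" "g \<in> carrier L'" "\<And>R. R \<in> U \<Longrightarrow> g \<in> R"
  shows "\<exists>f\<in>carrier L. \<forall>R\<in>dvrs L \<kappa>. \<phi> R \<in> U \<longrightarrow>
    f \<in> R \<and> residue_value L \<kappa> f R = residue_value L' \<kappa>' g (\<phi> R)"
proof -
  let ?V = "{R \<in> dvrs L \<kappa>. \<phi> R \<in> U}"
  have "restrict (residue_value L' \<kappa>' g) U \<in> regular (nonsingular_curve L' \<kappa>') U"
    using assms(3,4) by (auto simp: nonsingular_curve_def)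
  then have "restrict (restrict (residue_value L' \<kappa>' g) U \<circ> \<phi>) ?V \<in> regular (nonsingular_curve L \<kappa>) ?V"
    using assms(1,2) by (simp add: morphism_def Let_def nonsingular_curve_def)
  then obtain f where f: "f \<in> carrier L" "\<And>R. R \<in> ?V \<Longrightarrow> f \<in> R"
    "restrict (restrict (residue_value L' \<kappa>' g) U \<circ> \<phi>) ?V = restrict (residue_value L \<kappa> f) ?V"
    by (auto simp: nonsingular_curve_def)
  have "residue_value L \<kappa> f R = residue_value L' \<kappa>' g (\<phi> R)" if "R \<in> dvrs L \<kappa>" "\<phi> R \<in> U" for R
    using fun_cong[OF f(3), of R] that by simp
  then show ?thesis using f(1,2) by blast
qed

text \<open>The pullbacks u, w of x', y' along \<phi> have at R the residues that x', y' have at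
  \<phi> R. Functions are determined by residues on cofinite sets, so a polynomial vanishes at (u,
  w) exactly when it vanishes at (x', y'); this makes (u, w) a generic point of the second curve.
  That u and w generate the whole field comes from pulling x and y back along \<psi>.\<close>

lemma isomorphic_imp_generic_point:
  fixes x y x' y' :: "'a::alg_closed_field fls"
  assumes G: "generic_point c x y" and H: "generic_point c' x' y'"
    and iso: "isomorphic (nonsingular_curve (subfield_ring (generated_field x y)) fls_const)
      (nonsingular_curve (subfield_ring (generated_field x' y')) fls_const)"
  shows "\<exists>u w. generic_point c' u w \<and> generated_field u w = generated_field x y"
proof -
  interpret G: generic_point c x y by (rule G)
  interpret H: generic_point c' x' y' by (rule H)
  let ?P = "dvrs G.L fls_const" and ?P' = "dvrs H.L fls_const"
  let ?M = "nonsingular_curve G.L fls_const" and ?N = "nonsingular_curve H.L fls_const"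
  have top: "zariski ?M = cofinite_topology ?P" "zariski ?N = cofinite_topology ?P'"
    by (simp_all add: nonsingular_curve_def)
  obtain \<phi> \<psi> where phi: "morphism ?M ?N \<phi>" and psi: "morphism ?N ?M \<psi>"
    and inv: "\<And>R. R \<in> ?P \<Longrightarrow> \<psi> (\<phi> R) = R" "\<And>R. R \<in> ?P' \<Longrightarrow> \<phi> (\<psi> R) = R"
    using iso unfolding isomorphic_def top by auto
  have into: "\<And>R. R \<in> ?P \<Longrightarrow> \<phi> R \<in> ?P'" "\<And>R. R \<in> ?P' \<Longrightarrow> \<psi> R \<in> ?P"
    using phi psi unfolding morphism_def top continuous_map_def by auto
  let ?U = "G.finite_part" and ?U' = "H.finite_part"
  have part: "?U \<subseteq> ?P" "?U' \<subseteq> ?P'" by (auto simp: G.finite_part_def H.finite_part_def)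
  define V where "V = {R \<in> ?P. \<phi> R \<in> ?U'}"
  have "openin (cofinite_topology ?P) V"
    using openin_continuous_map_preimage[of "zariski ?M" "zariski ?N" \<phi> ?U'] H.openin_finite_part phi
    unfolding morphism_def top V_def by simp
  moreover have surj: "\<exists>R\<in>V. \<phi> R = R'" if "R' \<in> ?U'" for R'
  proof -
    have "R' \<in> ?P'" using that part(2) by blast
    then have "\<psi> R' \<in> ?P" "\<phi> (\<psi> R') = R'" using into(2) inv(2) by blast+
    then show ?thesis using that unfolding V_def by (intro bexI[of _ "\<psi> R'"]) simp_all
  qed
  then have "V \<noteq> {}" using H.finite_part_nonempty by blast
  ultimately have finV: "finite (?P - V)" by (simp add: openin_cofinite_topology)
  have finVU: "finite (?P - V \<inter> ?U)"
    using finV G.finite_complement_finite_part by (simp add: Diff_Int)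
  have pull: "\<exists>f\<in>G.K. \<forall>R\<in>V. f \<in> R \<and> G.residue f R = H.residue g (\<phi> R)"
    if "g \<in> H.K" "\<And>R. R \<in> ?U' \<Longrightarrow> g \<in> R" for g
  proof -
    have "\<exists>f\<in>carrier G.L. \<forall>R\<in>?P. \<phi> R \<in> ?U' \<longrightarrow>
        f \<in> R \<and> residue_value G.L fls_const f R = residue_value H.L fls_const g (\<phi> R)"
      by (rule morphism_pullback[OF phi H.openin_finite_part _ that(2)]) (simp add: that(1))
    then show ?thesis
      unfolding V_def G.residue_def H.residue_def subfield_ring_simps(1) by (simp add: Ball_def imp_conjL)
  qed
  have "\<And>R. R \<in> ?U' \<Longrightarrow> x' \<in> R" "\<And>R. R \<in> ?U' \<Longrightarrow> y' \<in> R" by (simp_all add: H.finite_part_def)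
  from pull[OF _ this(1)] pull[OF _ this(2)] obtain u w where
    u: "u \<in> G.K" "\<And>R. R \<in> V \<Longrightarrow> u \<in> R \<and> G.residue u R = H.residue x' (\<phi> R)" and
    w: "w \<in> G.K" "\<And>R. R \<in> V \<Longrightarrow> w \<in> R \<and> G.residue w R = H.residue y' (\<phi> R)"
    by (metis generated_field_fst generated_field_snd)
  have transfer: "e \<in> R \<and> e' \<in> \<phi> R \<and> G.residue e R = H.residue e' (\<phi> R)"
    if e: "poly_pair x' y' f e'" "poly_pair u w f e" and R: "R \<in> V" for f e e' R
  proof -
    have *: "R \<in> ?P" "\<phi> R \<in> ?P'" "x' \<in> \<phi> R" "y' \<in> \<phi> R"
      using R part unfolding V_def H.finite_part_def by auto
    show ?thesis
      using G.residue_poly_pair[OF *(1) e(2)] H.residue_poly_pair[OF *(2) e(1) *(3,4)] u(2)[OF R] w(2)[OF R]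
      by simp
  qed
  have zero: "e = 0 \<longleftrightarrow> e' = 0" if e: "poly_pair x' y' f e'" "poly_pair u w f e" for f e e'
  proof
    assume "e' = 0"
    have "e \<in> G.K"
      using generated_fieldI[OF e(2)] generated_field_mono[OF u(1) w(1)] by blast
    moreover have "H.residue 0 (\<phi> R) = 0" if "R \<in> V" for R
      using H.residue_const[of "\<phi> R" 0] that part unfolding V_def by auto
    ultimately show "e = 0"
      using transfer[OF e] \<open>e' = 0\<close> by (intro G.residues_0_imp_0[OF finV]) auto
  next
    assume "e = 0"
    have "e' \<in> R' \<and> H.residue e' R' = 0" if R': "R' \<in> ?U'" for R'
    proof -
      obtain R where R: "R \<in> V" "\<phi> R = R'" using surj[OF R'] by blast
      then have "G.residue 0 R = 0" using G.residue_const[of R 0] unfolding V_def by auto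
      then show ?thesis using transfer[OF e R(1)] R(2) \<open>e = 0\<close> by simp
    qed
    then show "e' = 0"
      using generated_fieldI[OF e(1)] by (intro H.residues_0_imp_0[OF H.finite_complement_finite_part]) auto
  qed
  have eqn: "poly_pair a b (\<lambda>p. fst p ^ 2 + snd p ^ 2 - (1 + c' * fst p ^ 2 * snd p ^ 2))
      (a\<^sup>2 + b\<^sup>2 - (fls_const 1 + fls_const c' * a\<^sup>2 * b\<^sup>2))" for a b :: "'a fls"
    by (intro poly_pair_diff poly_pair.add poly_pair.mult poly_pair_power poly_pair.const poly_pair.fst poly_pair.snd)
  have "u\<^sup>2 + w\<^sup>2 - (fls_const 1 + fls_const c' * u\<^sup>2 * w\<^sup>2) = 0"
    using zero[OF eqn eqn] H.equation by simp
  moreover have "w \<notin> range fls_const"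
  proof
    assume "w \<in> range fls_const"
    then obtain a where wa: "w = fls_const a" by auto
    have lin: "poly_pair p b (\<lambda>p. snd p - a) (b - fls_const a)" for p b :: "'a fls"
      by (intro poly_pair_diff poly_pair.const poly_pair.snd)
    have "y' - fls_const a = 0" using zero[OF lin lin] wa by simp
    then show False using H.y_nonconst by auto
  qed
  ultimately have "generic_point c' u w"
    using H.two H.c0 H.c1 by unfold_locales auto
  \<comment> \<open>The pullback q of t along \<psi> is a quotient of polynomials in x', y'. The
    same quotient formed in u, w has the residues of t at almost all points, so it equals t.\<close>
  moreover have mem: "t \<in> generated_field u w" if t: "t \<in> G.K" "\<And>R. R \<in> ?U \<Longrightarrow> t \<in> R" for t
  proof -
    have "\<exists>q\<in>carrier H.L. \<forall>R\<in>?P'. \<psi> R \<in> ?U \<longrightarrow>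
        q \<in> R \<and> residue_value H.L fls_const q R = residue_value G.L fls_const t (\<psi> R)"
      by (rule morphism_pullback[OF psi G.openin_finite_part _ t(2)]) (simp add: t(1))
    then obtain q where q: "q \<in> H.K"
      "\<And>R. R \<in> ?P' \<Longrightarrow> \<psi> R \<in> ?U \<Longrightarrow> q \<in> R \<and> H.residue q R = G.residue t (\<psi> R)"
      unfolding G.residue_def H.residue_def subfield_ring_simps(1) by blast
    obtain e1' e2' f1 f2 where e': "poly_pair x' y' f1 e1'" "poly_pair x' y' f2 e2'" "e2' \<noteq> 0" "q = e1' / e2'"
      using q(1) unfolding generated_field_def by blast
    obtain e1 e2 where e: "poly_pair u w f1 e1" "poly_pair u w f2 e2"
      using poly_pair_transfer e'(1,2) by blast
    have e2: "e2 \<noteq> 0" using zero[OF e'(2) e(2)] e'(3) by simp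
    have "e1 - t * e2 = 0"
    proof (rule G.residues_0_imp_0[OF finVU])
      show "e1 - t * e2 \<in> G.K"
        using generated_fieldI[OF e(1)] generated_fieldI[OF e(2)] generated_field_mono[OF u(1) w(1)] t(1) by blast
      fix R assume R: "R \<in> V \<inter> ?U" "R \<in> ?P"
      then have RV: "R \<in> V" and RU: "R \<in> ?U" by auto
      have phiR: "\<phi> R \<in> ?P'" using into(1) R(2) .
      have tR: "t \<in> R" using t(2) RU .
      have qR: "q \<in> \<phi> R" "H.residue q (\<phi> R) = G.residue t R"
        using q(2)[OF phiR] inv(1)[OF R(2)] RU by auto
      note 1 = transfer[OF e'(1) e(1) RV] and 2 = transfer[OF e'(2) e(2) RV]
      have "e1' = q * e2'" using e' by simp
      then have "H.residue e1' (\<phi> R) = H.residue q (\<phi> R) * H.residue e2' (\<phi> R)"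
        using H.residue_mult[OF phiR qR(1)] 2 by simp
      then have "G.residue e1 R = G.residue (t * e2) R"
        using 1 2 qR(2) G.residue_mult[OF R(2) tR] by simp
      moreover have te: "t * e2 \<in> R" using G.dvr_mult[OF R(2) tR] 2 by blast
      moreover have "G.residue (e1 - t * e2 + t * e2) R = G.residue (e1 - t * e2) R + G.residue (t * e2) R"
        using G.residue_add[OF R(2) G.dvr_diff[OF R(2)] te] 1 te by blast
      ultimately have "G.residue (e1 - t * e2) R = 0" by simp
      moreover have "e1 - t * e2 \<in> R" using G.dvr_diff[OF R(2)] 1 te by blast
      ultimately show "e1 - t * e2 \<in> R \<and> G.residue (e1 - t * e2) R = 0" by blast
    qed
    then have "t = e1 / e2" using e2 by (simp add: field_simps)
    then show ?thesis unfolding generated_field_def using e e2 by blast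
  qed
  have "x \<in> generated_field u w" "y \<in> generated_field u w"
    by (rule mem; auto simp: G.finite_part_def)+
  then have "generated_field u w = generated_field x y"
    using u(1) w(1) by (intro equalityI generated_field_mono) auto
  ultimately show ?thesis by blast
qed


section \<open>Biquadratic relations between generators\<close>

definition flip_poly :: "'a::comm_ring_1 poly poly \<Rightarrow> 'a poly poly"
  where "flip_poly F = (\<Sum>i\<le>degree F. map_poly (\<lambda>a. monom a i) (coeff F i))"

lemma coeff_flip_poly: "coeff (coeff (flip_poly F) j) i = coeff (coeff F i) j"
proof -
  have "coeff (coeff (flip_poly F) j) i = (\<Sum>k\<le>degree F. if k = i then coeff (coeff F k) j else 0)"
    unfolding flip_poly_def coeff_sum by (intro sum.cong refl) (simp add: coeff_map_poly)
  also have "\<dots> = coeff (coeff F i) j"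
    by (auto simp: coeff_eq_0)
  finally show ?thesis .
qed

lemma poly_poly_eqI: "(\<And>i j. coeff (coeff F i) j = coeff (coeff G i) j) \<Longrightarrow> F = G"
  by (simp add: poly_eq_iff)

lemma flip_poly_flip_poly [simp]: "flip_poly (flip_poly F) = F"
  by (rule poly_poly_eqI) (simp add: coeff_flip_poly)

text \<open>Divisibility is thereby symmetric in the two variables, so degrees in the inner variable
  can be compared just like degrees in the outer one.\<close>

lemma flip_poly_mult: "flip_poly (F * G) = flip_poly F * flip_poly G"
proof (rule poly_poly_eqI)
  fix j i
  have "coeff (coeff (flip_poly (F * G)) j) i =
      (\<Sum>k\<le>i. \<Sum>l\<le>j. coeff (coeff F k) l * coeff (coeff G (i - k)) (j - l))"
    by (simp add: coeff_flip_poly coeff_mult coeff_sum)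
  also have "\<dots> = (\<Sum>l\<le>j. \<Sum>k\<le>i. coeff (coeff F k) l * coeff (coeff G (i - k)) (j - l))"
    by (rule sum.swap)
  also have "\<dots> = coeff (coeff (flip_poly F * flip_poly G) j) i"
    by (simp add: coeff_flip_poly coeff_mult coeff_sum)
  finally show "coeff (coeff (flip_poly (F * G)) j) i = coeff (coeff (flip_poly F * flip_poly G) j) i" .
qed

definition pev2 :: "'a::alg_closed_field poly poly \<Rightarrow> 'a fls \<Rightarrow> 'a fls \<Rightarrow> 'a fls"
  where "pev2 F y z = poly (map_poly (\<lambda>p. pev p y) F) z"

lemma pev2_0 [simp]: "pev2 0 y z = 0"
  by (simp add: pev2_def)

lemma pev2_pCons [simp]: "pev2 (pCons p F) y z = pev p y + z * pev2 F y z"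
  by (simp add: pev2_def map_poly_pCons)

lemma pev2_add [simp]: "pev2 (F + G) y z = pev2 F y z + pev2 G y z"
  by (simp add: pev2_def map_poly_hom_add)

lemma pev2_mult [simp]: "pev2 (F * G) y z = pev2 F y z * pev2 G y z"
  by (simp add: pev2_def map_poly_hom_mult)

lemma pev2_smult [simp]: "pev2 (Polynomial.smult p F) y z = pev p y * pev2 F y z"
  using pev2_mult[of "[:p:]" F y z] by (simp del: pev2_mult)

lemma pev_monom: "pev (monom a n) y = fls_const a * y ^ n"
  by (simp add: pev_def map_poly_monom poly_monom)

lemma pev2_sum: "pev2 (\<Sum>i\<in>A. f i) y z = (\<Sum>i\<in>A. pev2 (f i) y z)"
  by (induction A rule: infinite_finite_induct) simp_all

lemma pev2_monom_monom: "pev2 (map_poly (\<lambda>a. monom a i) p) y z = y ^ i * pev p z"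
proof (induction p)
  case (pCons a p)
  have "map_poly (\<lambda>a. monom a i) (pCons a p) = pCons (monom a i) (map_poly (\<lambda>a. monom a i) p)"
    by (simp add: map_poly_pCons)
  then show ?case using pCons.IH by (simp add: pev_monom algebra_simps)
qed simp

lemma pev2_flip_poly: "pev2 (flip_poly F) y z = pev2 F z y"
proof -
  have "pev2 F z y = (\<Sum>i\<le>degree F. pev (coeff F i) z * y ^ i)"
  proof -
    have "pev2 F z y = pev2 (\<Sum>i\<le>degree F. monom (coeff F i) i) z y"
      by (simp add: poly_as_sum_of_monoms)
    also have "\<dots> = (\<Sum>i\<le>degree F. pev (coeff F i) z * y ^ i)"
      unfolding pev2_sum by (simp add: pev2_def map_poly_monom poly_monom)
    finally show ?thesis .
  qed
  then show ?thesis
    unfolding flip_poly_def pev2_sum pev2_monom_monom by (simp add: mult.commute)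
qed

text \<open>Gauss's lemma; over an algebraically closed field it suffices to evaluate the coefficients
  at the roots of the content.\<close>

lemma primitive_dvd_smult:
  fixes F G H :: "'a::alg_closed_field poly poly"
  assumes "Polynomial.smult m G = F * H" "m \<noteq> 0"
    and prim: "\<And>a. map_poly (\<lambda>p. poly p a) F \<noteq> 0"
  shows "F dvd G"
  using assms(1,2)
proof (induction "degree m" arbitrary: m H rule: less_induct)
  case less
  show ?case
  proof (cases "degree m = 0")
    case True
    then obtain e where e: "m = [:e:]" using degree_eq_zeroE by blast
    then have "e \<noteq> 0" using less.prems by simp
    have "G = Polynomial.smult ([:1 / e:] * m) G" using \<open>e \<noteq> 0\<close> e by (simp add: one_pCons[symmetric])
    also have "\<dots> = F * Polynomial.smult [:1 / e:] H"
      using less.prems(1) by (metis mult_smult_right smult_smult)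
    finally show ?thesis by (metis dvd_triv_left)
  next
    case False
    then obtain a where "poly m a = 0" using alg_closed_imp_poly_has_root by blast
    then obtain m' where m: "m = [:-a, 1:] * m'" by (metis dvd_def poly_eq_0_iff_dvd)
    then have m': "m' \<noteq> 0" using less.prems by auto
    \<comment> \<open>Modulo Y - a the multiple of G vanishes and F does not. There are no zero
      divisors over a field, so H vanishes, that is, Y - a divides each of its coefficients and can
      be cancelled.\<close>
    have "map_poly (\<lambda>p. poly p a) (F * H) = map_poly (\<lambda>p. poly p a) F * map_poly (\<lambda>p. poly p a) H"
      by (rule map_poly_hom_mult) simp_all
    moreover have "map_poly (\<lambda>p. poly p a) (Polynomial.smult m G) = 0"
      using \<open>poly m a = 0\<close> by (intro poly_eqI) (simp add: coeff_map_poly)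
    ultimately have "map_poly (\<lambda>p. poly p a) H = 0"
      using less.prems(1) prim[of a] by simp
    then have root: "poly (coeff H i) a = 0" for i
      by (metis coeff_0 coeff_map_poly poly_0)
    define H' where "H' = map_poly (\<lambda>p. p div [:-a, 1:]) H"
    have H: "H = Polynomial.smult [:-a, 1:] H'"
    proof (rule poly_eqI)
      fix i
      have "[:-a, 1:] dvd coeff H i" using root by (simp add: poly_eq_0_iff_dvd)
      then have "coeff H i = [:-a, 1:] * (coeff H i div [:-a, 1:])" by (rule dvd_mult_div_cancel[symmetric])
      then show "coeff H i = coeff (Polynomial.smult [:-a, 1:] H') i"
        by (simp only: coeff_smult H'_def coeff_map_poly div_0)
    qed
    have "Polynomial.smult [:-a, 1:] (Polynomial.smult m' G) = Polynomial.smult [:-a, 1:] (F * H')"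
      using less.prems(1) unfolding m H by (simp only: smult_smult mult_smult_right)
    then have "Polynomial.smult [:-a, 1:] (Polynomial.smult m' G - F * H') = 0"
      by (simp only: smult_diff_right right_minus_eq)
    then have "Polynomial.smult m' G - F * H' = 0"
      by (metis smult_eq_0_iff one_neq_zero pCons_eq_0_iff)
    then have "Polynomial.smult m' G = F * H'" by simp
    moreover have "degree m' < degree m"
      unfolding m using m' by (subst degree_mult_eq) auto
    ultimately show ?thesis using less.hyps m' by blast
  qed
qed

text \<open>For nonconstant y this says that z is not rational in y.\<close>

definition independent_over :: "'a::alg_closed_field fls \<Rightarrow> 'a fls \<Rightarrow> bool"
  where "independent_over y z \<longleftrightarrow> (\<forall>p q. pev p y + pev q y * z = 0 \<longrightarrow> p = 0 \<and> q = 0)"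

text \<open>As a quadratic in z the relation F is irreducible over k(y), so it divides every
  relation G between y and z: pseudo-division leaves a remainder at most linear in z, which
  independence makes 0, and Gauss's lemma removes the multiplier. Taking G quadratic in y bounds the
  degree of F in y by 2.\<close>

lemma primitive_relation_degree:
  fixes y z :: "'a::alg_closed_field fls"
  assumes ind: "independent_over y z"
    and rel: "pev P y * z\<^sup>2 + pev Q y * z + pev S y = 0"
    and prim: "\<And>a. poly P a \<noteq> 0 \<or> poly Q a \<noteq> 0 \<or> poly S a \<noteq> 0"
    and rel': "pev A z * y\<^sup>2 + pev B z * y + pev C z = 0" "C \<noteq> 0"
  shows "degree P \<le> 2" "degree Q \<le> 2" "degree S \<le> 2" "P \<noteq> 0"
proof -
  show P: "P \<noteq> 0"
  proof
    assume "P = 0"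
    then have "pev S y + pev Q y * z = 0" using rel by (simp add: add.commute)
    then have "S = 0" "Q = 0" using ind by (auto simp: independent_over_def)
    then show False using prim[of 0] \<open>P = 0\<close> by simp
  qed
  define F where "F = [:S, Q, P:]"
  define G where "G = flip_poly [:C, B, A:]"
  have F: "F \<noteq> 0" "degree F = 2" using P by (simp_all add: F_def)
  have "pev2 F y z = 0" using rel by (simp add: F_def power2_eq_square algebra_simps)
  have "pev2 G y z = 0"
    unfolding G_def pev2_flip_poly using rel'(1) by (simp add: power2_eq_square algebra_simps)
  obtain H T where HT: "pseudo_divmod G F = (H, T)" by fastforce
  define m where "m = coeff F (degree F) ^ (Suc (degree G) - degree F)"
  have pd: "Polynomial.smult m G = F * H + T" "T = 0 \<or> degree T < degree F"
    using pseudo_divmod[OF F(1) HT] by (simp_all add: m_def)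
  have "m \<noteq> 0" using F(1) by (simp add: m_def)
  have "T = 0"
  proof -
    have "degree T \<le> 1" using pd(2) F(2) by auto
    then have T: "T = [:coeff T 0, coeff T 1:]"
      by (intro poly_eqI) (auto simp: coeff_pCons coeff_eq_0 split: nat.split)
    have "pev2 T y z = 0"
      using arg_cong[OF pd(1), of "\<lambda>p. pev2 p y z"] \<open>pev2 F y z = 0\<close> \<open>pev2 G y z = 0\<close> by simp
    then have "pev (coeff T 0) y + pev (coeff T 1) y * z = 0"
      by (subst (asm) T) (simp add: mult.commute)
    then show ?thesis using ind T by (metis independent_over_def pCons_0_0)
  qed
  have "map_poly (\<lambda>p. poly p a) F \<noteq> 0" for a
    using prim[of a] by (auto simp: F_def map_poly_pCons)
  then have "F dvd G"
    using primitive_dvd_smult[of m G F H] pd(1) \<open>T = 0\<close> \<open>m \<noteq> 0\<close> by simp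
  then have "flip_poly F dvd flip_poly G" by (auto simp: flip_poly_mult elim!: dvdE)
  then have "degree (flip_poly F) \<le> degree [:C, B, A:]"
    using rel'(2) by (intro dvd_imp_degree_le) (auto simp: G_def)
  also have "\<dots> \<le> 2" by simp
  finally have deg: "degree (flip_poly F) \<le> 2" .
  have "coeff (coeff F i) j = 0" if "j > 2" for i j
    using that deg coeff_flip_poly[of F j i] by (simp add: coeff_eq_0)
  from this[where i = 0] this[where i = 1] this[where i = 2]
  show "degree P \<le> 2" "degree Q \<le> 2" "degree S \<le> 2"
    by (auto intro!: degree_le simp: F_def numeral_2_eq_2)
qed

text \<open>Here \<open>generated_field y y\<close> stands for the field k(y) of rational functions
  of a single series.\<close>

lemma generated_field_self:
  assumes "f \<in> generated_field y y" "y \<notin> range fls_const"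
  obtains p r where "r \<noteq> 0" "f * pev r y = pev p y"
proof -
  have pp: "\<exists>p. e = pev p y" if "poly_pair y y g e" for g e
    using that
  proof induction
    case (const a)
    show ?case by (intro exI[of _ "[:a:]"]) simp
  next
    case fst
    show ?case by (intro exI[of _ "[:0, 1:]"]) simp
  next
    case snd
    show ?case by (intro exI[of _ "[:0, 1:]"]) simp
  next
    case (add f e f' e')
    then show ?case by (metis pev_add)
  next
    case (mult f e f' e')
    then show ?case by (metis pev_mult)
  qed
  obtain e e' g g' where "poly_pair y y g e" "poly_pair y y g' e'" "e' \<noteq> 0" "f = e / e'"
    using assms(1) unfolding generated_field_def by blast
  moreover from this(1,2) obtain p r where "e = pev p y" "e' = pev r y" using pp by blast
  ultimately have "f * pev r y = pev p y" "r \<noteq> 0" by auto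
  then show ?thesis using that by blast
qed

lemma not_independent_over:
  assumes "\<not> independent_over y z" "y \<notin> range fls_const"
  shows "z \<in> generated_field y y"
proof -
  obtain p q where pq: "pev p y + pev q y * z = 0" "p \<noteq> 0 \<or> q \<noteq> 0"
    using assms(1) by (auto simp: independent_over_def)
  have nz: "pev r y \<noteq> 0" if "r \<noteq> 0" for r
    using pev_eq_0_imp_const that assms(2) by fastforce
  have "q \<noteq> 0" using pq nz[of p] by auto
  then have "z = - pev p y / pev q y"
    using pq(1) nz[of q] by (simp add: field_simps eq_neg_iff_add_eq_0)
  then show ?thesis by auto
qed

context generic_point
begin

text \<open>The element t = 2 P z + Q has as its square the discriminant E, a polynomial in y, but t
  is not in k(y). Hence t = q x / r, and E (1 - c y^2) agrees with 1 - y^2 up to squares. So E has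
  odd order at 1, -1 and the two square roots of 1 / c, and as its degree is at most 4 it is a
  multiple of (1 - y^2) (1 - c y^2).\<close>

lemma discriminant:
  assumes z: "z \<in> K" and ind: "independent_over y z"
    and rel: "pev P y * z\<^sup>2 + pev Q y * z + pev S y = 0" and P: "P \<noteq> 0"
    and deg: "degree P \<le> 2" "degree Q \<le> 2" "degree S \<le> 2"
  shows "\<exists>k. k \<noteq> 0 \<and> Q\<^sup>2 - Polynomial.smult 4 (P * S) = [:k, 0, - k * (1 + c), 0, k * c:]"
proof -
  define E where "E = Q\<^sup>2 - Polynomial.smult 4 (P * S)"
  define t where "t = 2 * pev P y * z + pev Q y"
  have "t \<in> K" unfolding t_def using z by (intro generated_field_add generated_field_mult generated_field_pev) auto
  then obtain p q r where r: "r \<noteq> 0" "t * pev r y = pev p y + pev q y * x"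
    using generated_field_form by blast
  let ?D = "[:1, 0, -c:]" and ?N = "[:1, 0, -1::'a:]"
  have D: "pev ?D y = 1 - fls_const c * y\<^sup>2" "pev ?N y = 1 - y\<^sup>2"
    by (simp_all add: power2_eq_square algebra_simps)
  have "t\<^sup>2 = pev E y + 4 * pev P y * (pev P y * z\<^sup>2 + pev Q y * z + pev S y)"
    unfolding t_def E_def by (simp add: power2_eq_square algebra_simps)
  then have t2: "t\<^sup>2 = pev E y" using rel by simp
  have "pev (r\<^sup>2 * E) y = (pev p y + pev q y * x)\<^sup>2"
    unfolding pev_mult pev_power t2[symmetric] r(2)[symmetric] by (simp add: power_mult_distrib mult.commute)
  then have "pev (?D * (r\<^sup>2 * E)) y = (1 - fls_const c * y\<^sup>2) * (pev p y + pev q y * x)\<^sup>2"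
    unfolding pev_mult[of ?D] D by simp
  also have "\<dots> = pev (?D * p\<^sup>2 + ?N * q\<^sup>2) y + pev (Polynomial.smult 2 (?D * (p * q))) y * x"
    unfolding pev_add pev_mult pev_smult pev_power D unfolding equation'[symmetric]
    by (simp add: power2_eq_square algebra_simps)
  finally have "pev (?D * p\<^sup>2 + ?N * q\<^sup>2 - ?D * (r\<^sup>2 * E)) y + pev (Polynomial.smult 2 (?D * (p * q))) y * x = 0"
    unfolding pev_diff by simp
  from independent[OF this] have
    eq: "?D * p\<^sup>2 + ?N * q\<^sup>2 - ?D * (r\<^sup>2 * E) = 0" and pq: "Polynomial.smult 2 (?D * (p * q)) = 0" .
  have "?D * (p * q) = 0" using pq two by (metis smult_eq_0_iff)
  moreover have "?D \<noteq> 0" by simp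
  ultimately have "p * q = 0" by (metis mult_eq_0_iff)
  moreover have q: "q \<noteq> 0"
  proof
    assume "q = 0"
    then have "pev (r * Q - p) y + pev (Polynomial.smult 2 (r * P)) y * z = 0"
      using r(2) unfolding t_def by (simp add: algebra_simps)
    then have "Polynomial.smult 2 (r * P) = 0" using ind unfolding independent_over_def by blast
    then show False using two r(1) P by simp
  qed
  ultimately have "p = 0" by simp
  then have eq: "q\<^sup>2 * ?N = r\<^sup>2 * (?D * E)" using eq by (simp only: power2_eq_square) (simp add: mult_ac del: mult_pCons_left mult_pCons_right)
  have N0: "?N \<noteq> 0" by simp
  have "q\<^sup>2 * ?N \<noteq> 0" using q N0 by (metis mult_eq_0_iff power_eq_0_iff)
  then have E: "E \<noteq> 0" unfolding eq by auto
  have "?D * E \<noteq> 0" using E \<open>?D \<noteq> 0\<close> by (metis mult_eq_0_iff)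
  have par: "2 * Polynomial.order a q + Polynomial.order a ?N =
      2 * Polynomial.order a r + (Polynomial.order a ?D + Polynomial.order a E)" for a
    using arg_cong[OF eq, of "Polynomial.order a"] order_square_mult[OF q N0, of a]
      order_square_mult[OF r(1) \<open>?D * E \<noteq> 0\<close>, of a] order_mult[OF \<open>?D * E \<noteq> 0\<close>, of a] by simp
  have root: "poly E a = 0" if "(a\<^sup>2 = 1) \<noteq> (c * a\<^sup>2 = 1)" for a
  proof -
    have "Polynomial.order a E \<noteq> 0"
    proof
      assume "Polynomial.order a E = 0"
      then have "2 * Polynomial.order a q + (if a\<^sup>2 = 1 then 1 else 0) =
          2 * Polynomial.order a r + (if c * a\<^sup>2 = 1 then 1 else 0)"
        using par[of a] order_one_minus[OF two, of a 1] order_one_minus[OF two, of a c] by simp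
      then show False using that by (auto split: if_splits) presburger+
    qed
    then show ?thesis using order_root by blast
  qed
  have "degree E \<le> 4"
    unfolding E_def power2_eq_square using deg degree_mult_le[of Q Q] degree_mult_le[of P S]
    by (intro degree_diff_le order.trans[OF degree_smult_le]) linarith+
  define e where "e = coeff E"
  have E_eq: "E = [:e 0, e 1, e 2, e 3, e 4:]"
  proof (rule poly_eqI)
    fix n
    show "coeff E n = coeff [:e 0, e 1, e 2, e 3, e 4:] n"
    proof (cases "n > 4")
      case True
      then show ?thesis using \<open>degree E \<le> 4\<close>
        by (simp add: coeff_eq_0 coeff_pCons split: nat.split)
    next
      case False
      then have "n \<in> {0, 1, 2, 3, 4}" by auto
      then show ?thesis by (auto simp: e_def numeral_nat)
    qed
  qed
  have E_at: "poly E a = (e 0 + e 2 * a\<^sup>2 + e 4 * (a\<^sup>2)\<^sup>2) + a * (e 1 + e 3 * a\<^sup>2)" for a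
    unfolding E_eq by (simp add: power2_eq_square algebra_simps)
  \<comment> \<open>This is applied to b = 1 and b = 1 / c. Both square roots of b are roots of E,
    so the even part and the odd part of E vanish separately.\<close>
  have even_odd: "e 0 + e 2 * b + e 4 * b\<^sup>2 = 0 \<and> e 1 + e 3 * b = 0" if b: "(b = 1) \<noteq> (c * b = 1)" "b \<noteq> 0" for b
  proof -
    obtain a where a: "a\<^sup>2 = b" using nth_root_exists[of 2 b] by auto
    have 1: "(e 0 + e 2 * b + e 4 * b\<^sup>2) + a * (e 1 + e 3 * b) = 0"
      using root[of a] E_at[of a] a b(1) by simp
    have 2: "(e 0 + e 2 * b + e 4 * b\<^sup>2) - a * (e 1 + e 3 * b) = 0"
      using root[of "- a"] E_at[of "- a"] a b(1) by simp
    have "2 * (e 0 + e 2 * b + e 4 * b\<^sup>2) = 0" using 1 2 by Groebner_Basis.algebra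
    moreover have "2 * a * (e 1 + e 3 * b) = 0" using 1 2 by Groebner_Basis.algebra
    moreover have "a \<noteq> 0" using a b(2) by auto
    ultimately show ?thesis using two by (metis mult_eq_0_iff)
  qed
  have 1: "e 0 + e 2 + e 4 = 0" "e 1 + e 3 = 0"
    using even_odd[of 1] c1 by simp_all
  have 2: "e 0 + e 2 * (1 / c) + e 4 * (1 / c)\<^sup>2 = 0" "e 1 + e 3 * (1 / c) = 0"
    using even_odd[of "1 / c"] c0 c1 by simp_all
  have 3: "c\<^sup>2 * e 0 + c * e 2 + e 4 = 0" "c * e 1 + e 3 = 0"
    using 2 c0 by (simp_all add: field_simps power2_eq_square)
  have "(c - 1) * e 1 = 0" using 1(2) 3(2) by Groebner_Basis.algebra
  then have e1: "e 1 = 0" using c1 by simp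
  then have e3: "e 3 = 0" using 1(2) by simp
  have "(c - 1) * (c * e 0 - e 4) = 0" using 1(1) 3(1) by Groebner_Basis.algebra
  then have e4: "e 4 = e 0 * c" using c1 by (simp add: mult.commute)
  have e2: "e 2 = - e 0 * (1 + c)" using 1(1) e4 by Groebner_Basis.algebra
  have "E = [:e 0, 0, - e 0 * (1 + c), 0, e 0 * c:]"
    by (subst E_eq) (simp only: e1 e2 e3 e4)
  moreover from this E have "e 0 \<noteq> 0" by auto
  ultimately show ?thesis unfolding E_def by blast
qed

end


section \<open>The parameters of isomorphic curves\<close>

text \<open>The two discriminants of a biquadratic form have the same invariants; dividing the
  resulting identities by powers of 3 makes them usable in every characteristic other than 2.\<close>

lemma biquadratic_identities:
  fixes a00 a01 a02 a10 a11 a12 a20 a21 a22 e0 e1 e2 e3 e4 d0 d1 d2 d3 d4 f :: "'a::field"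
  assumes def: "e0 = a01\<^sup>2 - 4 * a02 * a00"
    "e1 = 2 * a01 * a11 - 4 * (a02 * a10 + a12 * a00)"
    "e2 = a11\<^sup>2 + 2 * a01 * a21 - 4 * (a02 * a20 + a12 * a10 + a22 * a00)"
    "e3 = 2 * a11 * a21 - 4 * (a12 * a20 + a22 * a10)"
    "e4 = a21\<^sup>2 - 4 * a22 * a20"
    "d0 = a10\<^sup>2 - 4 * a20 * a00"
    "d1 = 2 * a10 * a11 - 4 * (a20 * a01 + a21 * a00)"
    "d2 = a11\<^sup>2 + 2 * a10 * a12 - 4 * (a20 * a02 + a21 * a01 + a22 * a00)"
    "d3 = 2 * a11 * a12 - 4 * (a21 * a02 + a22 * a01)"
    "d4 = a12\<^sup>2 - 4 * a22 * a02"
    "f = 2 * (a10 * a12 - a01 * a21)"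
  shows "d2 = e2 + 3 * f"
    and "4 * e0 * e4 - e1 * e3 = 4 * d0 * d4 - d1 * d3 + 2 * e2 * f + 3 * f\<^sup>2"
    and "2 * f * (4 * e0 * e4 - (e2 + 2 * f)\<^sup>2) - 2 * f * e1 * e3 + 3 * f * d1 * d3 =
      e2 * e1 * e3 - e2 * d1 * d3 - (e0 * e3\<^sup>2 + e4 * e1\<^sup>2) + (d0 * d3\<^sup>2 + d4 * d1\<^sup>2)"
proof -
  \<comment> \<open>Put I = 12 e0 e4 - 3 e1 e3 + e2^2 and J = 72 e0 e2 e4 + 9 e1 e2 e3 - 27 e0 e3^2
    - 27 e4 e1^2 - 2 e2^3. With d2 replaced by e2 + 3 f, the second identity is the equality of the
    two values of I divided by 3. The third is that of J divided by 27, after the second has been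
    used to eliminate d0 d4.\<close>
  show "d2 = e2 + 3 * f" unfolding def by Groebner_Basis.algebra
  show "4 * e0 * e4 - e1 * e3 = 4 * d0 * d4 - d1 * d3 + 2 * e2 * f + 3 * f\<^sup>2"
    unfolding def by Groebner_Basis.algebra
  show "2 * f * (4 * e0 * e4 - (e2 + 2 * f)\<^sup>2) - 2 * f * e1 * e3 + 3 * f * d1 * d3 =
      e2 * e1 * e3 - e2 * d1 * d3 - (e0 * e3\<^sup>2 + e4 * e1\<^sup>2) + (d0 * d3\<^sup>2 + d4 * d1\<^sup>2)"
    unfolding def by Groebner_Basis.algebra
qed

text \<open>The numbers -4 k' and -4 k' c' have the sum k (A + B) and the product k^2 A B, so they
  are k A and k B in some order, and c' is a quotient of A and B. The lemma serves for \<rho> = r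
  and for \<rho> = i r.\<close>

lemma parameter_from_invariants:
  fixes k k' c c' f \<rho> :: "'a::field"
  assumes two: "(2::'a) \<noteq> 0" and nz: "k' \<noteq> 0" and c: "c = \<rho> ^ 4" "c \<noteq> 1"
    and f: "2 * f = k * (1 + \<rho>\<^sup>2)\<^sup>2"
    and 1: "- k' * (1 + c') = - k * (1 + c) + 3 * f"
    and 2: "4 * k\<^sup>2 * c = 4 * k'\<^sup>2 * c' - 2 * k * (1 + c) * f + 3 * f\<^sup>2"
  shows "c' = ((1 + \<rho>) / (1 - \<rho>)) ^ 4 \<or> c' = ((1 - \<rho>) / (1 + \<rho>)) ^ 4"
proof -
  define A B where "A = (1 + \<rho>) ^ 4" and "B = (1 - \<rho>) ^ 4"
  have "\<rho> \<noteq> 1" using c by auto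
  moreover have "\<rho> \<noteq> - 1" using c by auto
  ultimately have AB: "1 + \<rho> \<noteq> 0" "1 - \<rho> \<noteq> 0" by (auto simp: add_eq_0_iff)
  then have nzAB: "A \<noteq> 0" "B \<noteq> 0" by (simp_all add: A_def B_def)
  have s: "- 4 * (k' * (1 + c')) = k * (A + B)"
    using 1 f unfolding A_def B_def c(1) by Groebner_Basis.algebra
  have "16 * (k'\<^sup>2 * c') = 16 * k\<^sup>2 * c + 4 * k * (1 + c) * (2 * f) - 3 * (2 * f)\<^sup>2"
    using 2 by Groebner_Basis.algebra
  then have p: "16 * (k'\<^sup>2 * c') = k\<^sup>2 * (A * B)"
    unfolding f A_def B_def c(1) by Groebner_Basis.algebra
  have "(- 4 * k' - k * A) * (- 4 * k' - k * B) = 0"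
    using s p by Groebner_Basis.algebra
  then consider "- 4 * k' = k * A" | "- 4 * k' = k * B" by auto
  then show ?thesis
  proof cases
    case 1
    then have "k * (A * (1 + c')) = k * (A + B)" using s by Groebner_Basis.algebra
    moreover have four: "(4::'a) \<noteq> 0" using two by (metis mult_2_right mult_eq_0_iff numeral_Bit0 numeral_times_numeral)
    then have "k \<noteq> 0" using 1 nz by auto
    ultimately have "A * (1 + c') = A + B" by simp
    then have "c' = B / A" using nzAB by (simp add: field_simps)
    then show ?thesis by (simp add: A_def B_def power_divide)
  next
    case 2
    then have "k * (B * (1 + c')) = k * (A + B)" using s by Groebner_Basis.algebra
    moreover have four: "(4::'a) \<noteq> 0" using two by (metis mult_2_right mult_eq_0_iff numeral_Bit0 numeral_times_numeral)
    then have "k \<noteq> 0" using 2 nz by auto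
    ultimately have "B * (1 + c') = A + B" by simp
    then have "c' = A / B" using nzAB by (simp add: field_simps)
    then show ?thesis by (simp add: A_def B_def power_divide)
  qed
qed

definition isomorphic_parameters :: "'a::field \<Rightarrow> 'a \<Rightarrow> 'a \<Rightarrow> 'a set"
  where "isomorphic_parameters c r i = {c, 1 / c, ((1 + r) / (1 - r)) ^ 4, ((1 - r) / (1 + r)) ^ 4,
      ((1 + i * r) / (1 - i * r)) ^ 4, ((1 - i * r) / (1 + i * r)) ^ 4}"

text \<open>As the odd coefficients of both discriminants are 0, the third identity becomes 2 f (4
  k^2 c - (2 f - k (1 + c))^2) = 0. Its solutions are f = 0, 2 f = k (1 + r^2)^2 and 2 f = k (1 -
  r^2)^2.\<close>

lemma biquadratic_parameters:
  fixes a00 a01 a02 a10 a11 a12 a20 a21 a22 c c' r i k k' :: "'a::field"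
  assumes two: "(2::'a) \<noteq> 0" and k: "k \<noteq> 0" "k' \<noteq> 0" and c: "r ^ 4 = c" "i\<^sup>2 = - 1" "c \<noteq> 0" "c \<noteq> 1"
    and e: "k = a01\<^sup>2 - 4 * a02 * a00"
    "0 = 2 * a01 * a11 - 4 * (a02 * a10 + a12 * a00)"
    "- k * (1 + c) = a11\<^sup>2 + 2 * a01 * a21 - 4 * (a02 * a20 + a12 * a10 + a22 * a00)"
    "0 = 2 * a11 * a21 - 4 * (a12 * a20 + a22 * a10)"
    "k * c = a21\<^sup>2 - 4 * a22 * a20"
    "k' = a10\<^sup>2 - 4 * a20 * a00"
    "0 = 2 * a10 * a11 - 4 * (a20 * a01 + a21 * a00)"
    "- k' * (1 + c') = a11\<^sup>2 + 2 * a10 * a12 - 4 * (a20 * a02 + a21 * a01 + a22 * a00)"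
    "0 = 2 * a11 * a12 - 4 * (a21 * a02 + a22 * a01)"
    "k' * c' = a12\<^sup>2 - 4 * a22 * a02"
  shows "c' \<in> isomorphic_parameters c r i"
proof -
  define f where "f = 2 * (a10 * a12 - a01 * a21)"
  note id = biquadratic_identities[OF e f_def]
  have I1: "- k' * (1 + c') = - k * (1 + c) + 3 * f" using id(1) .
  have I2: "4 * k\<^sup>2 * c = 4 * k'\<^sup>2 * c' - 2 * k * (1 + c) * f + 3 * f\<^sup>2"
    using id(2) by (simp add: power2_eq_square algebra_simps)
  have "2 * f * (4 * k * (k * c) - (- k * (1 + c) + 2 * f)\<^sup>2) = 0"
    using id(3) by simp
  then consider "f = 0" | "4 * k * (k * c) = (- k * (1 + c) + 2 * f)\<^sup>2" using two by auto
  then show ?thesis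
  proof cases
    case 1
    have J1: "k' * (1 + c') = k * (1 + c)" using I1 1 by simp
    have "2 * (2 * (k\<^sup>2 * c - k'\<^sup>2 * c')) = 0" using I2 1 by simp
    then have J2: "k\<^sup>2 * c = k'\<^sup>2 * c'" using two by (metis mult_eq_0_iff right_minus_eq)
    \<comment> \<open>The numbers k' and k' c' have the same sum and the same product as k and k
      c.\<close>
    have "(k' - k) * (k' - k * c) = 0" using J1 J2 by Groebner_Basis.algebra
    then consider "k' = k" | "k' = k * c" by auto
    then show ?thesis
    proof cases
      case 1
      then have "c' = c" using J1 k by simp
      then show ?thesis by (simp add: isomorphic_parameters_def)
    next
      case 2
      then have "k * (c * (1 + c')) = k * (1 + c)" using J1 by (simp add: mult.assoc)
      then have "c * (1 + c') = 1 + c" using k by simp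
      then have "c' = 1 / c" using c(3) by (simp add: field_simps)
      then show ?thesis by (simp add: isomorphic_parameters_def)
    qed
  next
    case 2
    have "(2 * k * r\<^sup>2)\<^sup>2 = 4 * k * (k * c)"
      unfolding c(1)[symmetric] by Groebner_Basis.algebra
    also note 2
    finally consider "2 * k * r\<^sup>2 = - k * (1 + c) + 2 * f" | "2 * k * r\<^sup>2 = - (- k * (1 + c) + 2 * f)"
      using power2_eq_iff by blast
    then show ?thesis
    proof cases
      case 1
      have "2 * f = k * (1 + r\<^sup>2)\<^sup>2" using 1 unfolding c(1)[symmetric] by Groebner_Basis.algebra
      from parameter_from_invariants[OF two k(2) c(1)[symmetric] c(4) this I1 I2]
      show ?thesis by (auto simp: isomorphic_parameters_def)
    next
      case 2
      \<comment> \<open>With i r in place of r the value k (1 - r^2)^2 takes the form k (1 + (i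
        r)^2)^2 of the previous case.\<close>
      have ir2: "(i * r)\<^sup>2 = - r\<^sup>2" using c(2) by (simp add: power_mult_distrib)
      have "(i * r) ^ 4 = ((i * r)\<^sup>2)\<^sup>2" by Groebner_Basis.algebra
      also have "\<dots> = r ^ 4" unfolding ir2 by Groebner_Basis.algebra
      finally have ir: "(i * r) ^ 4 = c" using c(1) by simp
      have "2 * f = k * (1 + (i * r)\<^sup>2)\<^sup>2"
        using 2 unfolding ir2 c(1)[symmetric] by Groebner_Basis.algebra
      from parameter_from_invariants[OF two k(2) ir[symmetric] c(4) this I1 I2]
      show ?thesis by (auto simp: isomorphic_parameters_def)
    qed
  qed
qed

lemma poly_degree_2: "degree p \<le> 2 \<Longrightarrow> p = [:coeff p 0, coeff p 1, coeff p 2:]"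
  by (intro poly_eqI) (auto simp: coeff_pCons coeff_eq_0 numeral_2_eq_2 split: nat.split)

lemma discriminant_coeffs:
  fixes a00 a01 a02 a10 a11 a12 a20 a21 a22 :: "'a::field"
  assumes "[:a01, a11, a21:]\<^sup>2 - Polynomial.smult 4 ([:a02, a12, a22:] * [:a00, a10, a20:]) =
      [:k, 0, - k * (1 + c), 0, k * c:]"
  shows "k = a01\<^sup>2 - 4 * a02 * a00"
    "0 = 2 * a01 * a11 - 4 * (a02 * a10 + a12 * a00)"
    "- k * (1 + c) = a11\<^sup>2 + 2 * a01 * a21 - 4 * (a02 * a20 + a12 * a10 + a22 * a00)"
    "0 = 2 * a11 * a21 - 4 * (a12 * a20 + a22 * a10)"
    "k * c = a21\<^sup>2 - 4 * a22 * a20"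
proof -
  have "[:a01, a11, a21:]\<^sup>2 - Polynomial.smult 4 ([:a02, a12, a22:] * [:a00, a10, a20:]) =
    [:a01\<^sup>2 - 4 * a02 * a00, 2 * a01 * a11 - 4 * (a02 * a10 + a12 * a00),
      a11\<^sup>2 + 2 * a01 * a21 - 4 * (a02 * a20 + a12 * a10 + a22 * a00),
      2 * a11 * a21 - 4 * (a12 * a20 + a22 * a10), a21\<^sup>2 - 4 * a22 * a20:]"
    by (simp add: power2_eq_square algebra_simps)
  then show "k = a01\<^sup>2 - 4 * a02 * a00"
    "0 = 2 * a01 * a11 - 4 * (a02 * a10 + a12 * a00)"
    "- k * (1 + c) = a11\<^sup>2 + 2 * a01 * a21 - 4 * (a02 * a20 + a12 * a10 + a22 * a00)"
    "0 = 2 * a11 * a21 - 4 * (a12 * a20 + a22 * a10)"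
    "k * c = a21\<^sup>2 - 4 * a22 * a20"
    unfolding assms pCons_eq_iff by blast+
qed

lemma generated_field_eq_imp_parameters_aux:
  assumes G: "generic_point c x y" and H: "generic_point c' u w"
    and eq: "generated_field u w = generated_field x y" and ind: "independent_over y w"
    and r: "r ^ 4 = c" "i\<^sup>2 = - 1"
  shows "c' \<in> isomorphic_parameters c r i"
proof -
  interpret G: generic_point c x y by (rule G)
  interpret H: generic_point c' u w by (rule H)
  have wK: "w \<in> G.K" and yK: "y \<in> H.K" using eq by auto
  \<comment> \<open>If y were rational in w, then so would be x, because w = (p + q x) / s with q
    \<noteq> 0. Then u would be rational in w, against the independence of 1 and u.\<close>
  have ind': "independent_over w y"
  proof (rule ccontr)
    assume "\<not> independent_over w y"
    then have y: "y \<in> generated_field w w" using not_independent_over H.y_nonconst by blast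
    obtain p q s where s: "s \<noteq> 0" "w * pev s y = pev p y + pev q y * x"
      using G.generated_field_form[OF wK] .
    have "q \<noteq> 0"
    proof
      assume "q = 0"
      then have "pev (- p) y + pev s y * w = 0" using s(2) by (simp add: mult.commute)
      then show False using ind s(1) unfolding independent_over_def by blast
    qed
    then have "pev q y \<noteq> 0" by simp
    then have "x = (w * pev s y - pev p y) / pev q y" using s(2) by (simp add: field_simps)
    also have "\<dots> \<in> generated_field w w" using y by auto
    finally have "generated_field x y \<subseteq> generated_field w w" using y generated_field_mono by blast
    then have "u \<in> generated_field w w" using eq by auto
    then obtain p s where "s \<noteq> 0" "u * pev s w = pev p w"
      using generated_field_self H.y_nonconst by blast
    then have "pev (- p) w + pev s w * u = 0" by (simp add: mult.commute)
    then show False using H.independent(2) \<open>s \<noteq> 0\<close> by blast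
  qed
  obtain A B C where ABC: "C \<noteq> 0" "pev A w * y\<^sup>2 + pev B w * y + pev C w = 0"
    using H.quadratic_relation[OF yK G.y_nonzero] .
  obtain P Q S where "S \<noteq> 0" "pev P y * w\<^sup>2 + pev Q y * w + pev S y = 0"
    using G.quadratic_relation[OF wK H.y_nonzero] .
  then obtain P Q S where rel: "pev P y * w\<^sup>2 + pev Q y * w + pev S y = 0"
    and prim: "\<And>a. poly P a \<noteq> 0 \<or> poly Q a \<noteq> 0 \<or> poly S a \<noteq> 0"
    using primitive_relation[OF G.y_nonconst, of P w Q S] by blast
  note deg = primitive_relation_degree[OF ind rel prim ABC(2,1)]
  obtain k where k: "k \<noteq> 0" "Q\<^sup>2 - Polynomial.smult 4 (P * S) = [:k, 0, - k * (1 + c), 0, k * c:]"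
    using G.discriminant[OF wK ind rel deg(4,1-3)] by blast
  \<comment> \<open>The number aij is the coefficient of y^i w^j, so the same nine numbers describe
    the relation as a quadratic in w and as a quadratic in y.\<close>
  obtain a00 a10 a20 where S: "S = [:a00, a10, a20:]" using poly_degree_2[OF deg(3)] by blast
  obtain a01 a11 a21 where Q: "Q = [:a01, a11, a21:]" using poly_degree_2[OF deg(2)] by blast
  obtain a02 a12 a22 where P: "P = [:a02, a12, a22:]" using poly_degree_2[OF deg(1)] by blast
  let ?A = "[:a20, a21, a22:]" and ?B = "[:a10, a11, a12:]" and ?C = "[:a00, a01, a02:]"
  have rel': "pev ?A w * y\<^sup>2 + pev ?B w * y + pev ?C w = 0"
    using rel unfolding P Q S by (simp add: power2_eq_square algebra_simps)
  have "?A \<noteq> 0"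
  proof
    assume A: "?A = 0"
    then have "pev ?C w + pev ?B w * y = 0" using rel' by (simp add: add.commute)
    then have "?C = 0" "?B = 0" using ind' unfolding independent_over_def by blast+
    then show False using A deg(4) unfolding P by simp
  qed
  moreover have "degree ?A \<le> 2" "degree ?B \<le> 2" "degree ?C \<le> 2" by simp_all
  ultimately obtain k' where k': "k' \<noteq> 0" "?B\<^sup>2 - Polynomial.smult 4 (?A * ?C) = [:k', 0, - k' * (1 + c'), 0, k' * c':]"
    using H.discriminant[OF yK ind' rel'] by blast
  show ?thesis
    by (rule biquadratic_parameters[OF G.two k(1) k'(1) r G.c0 G.c1
      discriminant_coeffs[OF k(2)[unfolded P Q S]] discriminant_coeffs[OF k'(2)]])
qed

text \<open>If both u and w were rational in y, then x would be too. So one of them is not, and by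
  the symmetry of the equation it may be taken as the second coordinate.\<close>

lemma generated_field_eq_imp_parameters:
  assumes G: "generic_point c x y" and H: "generic_point c' u w"
    and eq: "generated_field u w = generated_field x y"
    and r: "r ^ 4 = c" "i\<^sup>2 = - 1"
  shows "c' \<in> isomorphic_parameters c r i"
proof (cases "independent_over y w")
  case True
  then show ?thesis using generated_field_eq_imp_parameters_aux[OF G H eq _ r] by blast
next
  case w: False
  interpret G: generic_point c x y by (rule G)
  interpret H: generic_point c' u w by (rule H)
  have "independent_over y u"
  proof (rule ccontr)
    assume "\<not> independent_over y u"
    then have "u \<in> generated_field y y" "w \<in> generated_field y y"
      using w not_independent_over G.y_nonconst by blast+
    then have "generated_field u w \<subseteq> generated_field y y" by (rule generated_field_mono)
    then have "x \<in> generated_field y y" using eq by auto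
    then obtain p s where "s \<noteq> 0" "x * pev s y = pev p y"
      using generated_field_self G.y_nonconst by blast
    then have "pev (- p) y + pev s y * x = 0" by (simp add: mult.commute)
    then show False using G.independent(2) \<open>s \<noteq> 0\<close> by blast
  qed
  moreover have "generated_field w u = generated_field x y" using eq by (simp only: generated_field_swap)
  ultimately show ?thesis using generated_field_eq_imp_parameters_aux[OF G H.swap _ _ r] by blast
qed

text \<open>The map y \<mapsto> z sends 1, 1 / R^2, -1, -1 / R^2 to 1, -1, 1 / R'^2, -1 / R'^2, so
  it matches the branch points for the parameters R^4 and R'^4. Accordingly 1 - z^2 = 4 R N / A^2
  and 1 - R'^4 z^2 = -4 R M / B^2. Their quotient is -(N / M) (B / A)^2 with N / M = N^2 / (M N),
  and M N = (x (1 - R^4 y^2))^2 is a square. Its square root is u, and the sign accounts for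
  I.\<close>

lemma moebius_equation:
  fixes x y R R' I :: "'b::field"
  assumes nz: "1 - R \<noteq> 0" "1 + R \<noteq> 0" "1 - R * y \<noteq> 0" "x \<noteq> 0" "1 - R ^ 4 * y\<^sup>2 \<noteq> 0"
      "(1 - y) * (1 - R\<^sup>2 * y) \<noteq> 0" "(1 + y) * (1 + R\<^sup>2 * y) \<noteq> 0"
    and R': "R' * (1 - R) = 1 + R" and I: "I\<^sup>2 = - 1" and eq: "x\<^sup>2 * (1 - R ^ 4 * y\<^sup>2) = 1 - y\<^sup>2"
    and z: "z * (R' * (1 - R * y)) = 1 + R * y"
    and u: "u * ((1 + R) * (x * (1 - R ^ 4 * y\<^sup>2))) = I * (1 - R) * ((1 - y) * (1 - R\<^sup>2 * y))"
  shows "u\<^sup>2 * (1 - R' ^ 4 * z\<^sup>2) = 1 - z\<^sup>2"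
proof -
  \<comment> \<open>A clears the denominator of z, and B that of R'^2 z.\<close>
  define A B N M where "A = (1 + R) * (1 - R * y)" and "B = (1 - R) * (1 - R * y)"
    and "N = (1 - y) * (1 - R\<^sup>2 * y)" and "M = (1 + y) * (1 + R\<^sup>2 * y)"
  have zA: "z * A = (1 + R * y) * (1 - R)"
    using z R' unfolding A_def by Groebner_Basis.algebra
  have "(1 - z\<^sup>2) * A\<^sup>2 = A\<^sup>2 - (z * A)\<^sup>2" by Groebner_Basis.algebra
  also have "\<dots> = 4 * R * N" unfolding zA unfolding A_def N_def by Groebner_Basis.algebra
  finally have 1: "(1 - z\<^sup>2) * A\<^sup>2 = 4 * R * N" .
  have zB: "R'\<^sup>2 * z * B = (1 + R * y) * (1 + R)"
    using z R' unfolding B_def by Groebner_Basis.algebra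
  have "(1 - R' ^ 4 * z\<^sup>2) * B\<^sup>2 = B\<^sup>2 - (R'\<^sup>2 * z * B)\<^sup>2" by Groebner_Basis.algebra
  also have "\<dots> = - 4 * R * M" unfolding zB unfolding B_def M_def by Groebner_Basis.algebra
  finally have 2: "(1 - R' ^ 4 * z\<^sup>2) * B\<^sup>2 = - 4 * R * M" .
  have "u\<^sup>2 * (1 + R)\<^sup>2 * ((x\<^sup>2 * (1 - R ^ 4 * y\<^sup>2)) * (1 - R ^ 4 * y\<^sup>2)) = (u * ((1 + R) * (x * (1 - R ^ 4 * y\<^sup>2))))\<^sup>2"
    by Groebner_Basis.algebra
  also have "\<dots> = - (1 - R)\<^sup>2 * N * N"
    unfolding u N_def[symmetric] using I by Groebner_Basis.algebra
  also have "(x\<^sup>2 * (1 - R ^ 4 * y\<^sup>2)) * (1 - R ^ 4 * y\<^sup>2) = M * N"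
    unfolding eq M_def N_def by Groebner_Basis.algebra
  finally have "(u\<^sup>2 * (1 + R)\<^sup>2 * M) * N = (- (1 - R)\<^sup>2 * N) * N" by (simp only: mult.assoc)
  then have 3: "u\<^sup>2 * (1 + R)\<^sup>2 * M = - (1 - R)\<^sup>2 * N"
    using nz(6) unfolding N_def by (simp only: mult_cancel_right) simp
  have "(u\<^sup>2 * (1 - R' ^ 4 * z\<^sup>2)) * (M * (1 + R)\<^sup>2 * B\<^sup>2) =
      (u\<^sup>2 * (1 + R)\<^sup>2 * M) * ((1 - R' ^ 4 * z\<^sup>2) * B\<^sup>2)" by (simp only: mult_ac)
  also have "\<dots> = (4 * R * N) * M * (1 - R)\<^sup>2" unfolding 2 3 by Groebner_Basis.algebra
  also have "\<dots> = (1 - z\<^sup>2) * (M * (1 + R)\<^sup>2 * B\<^sup>2)"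
    unfolding 1[symmetric] A_def B_def by Groebner_Basis.algebra
  finally have "(u\<^sup>2 * (1 - R' ^ 4 * z\<^sup>2)) * (M * (1 + R)\<^sup>2 * B\<^sup>2) = (1 - z\<^sup>2) * (M * (1 + R)\<^sup>2 * B\<^sup>2)" .
  moreover have "M * (1 + R)\<^sup>2 * B\<^sup>2 \<noteq> 0" using nz unfolding M_def B_def by simp
  ultimately show ?thesis by simp
qed

context generic_point
begin

text \<open>Divided by x^2 the equation becomes 1 / x^2 + c y^2 = 1 + y^2 / x^2, which is the
  equation with parameter 1 / c for 1 / x and s y.\<close>

lemma generic_point_inverse_parameter:
  assumes s: "s\<^sup>2 = c"
  shows "generic_point (1 / c) (1 / x) (fls_const s * y)"
    "generated_field (1 / x) (fls_const s * y) = generated_field x y"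
proof -
  have s0: "s \<noteq> 0" using s c0 by auto
  have inv: "fls_const (1 / s) * (fls_const s * y) = y"
    using s0 by (simp only: mult.assoc[symmetric] fls_const_mult[symmetric]) simp
  show "generic_point (1 / c) (1 / x) (fls_const s * y)"
  proof unfold_locales
    have "fls_const (1 / c) * (fls_const s)\<^sup>2 = fls_const (1 / c * s\<^sup>2)"
      by (simp only: fls_const_mult fls_const_power)
    then have cs: "fls_const (1 / c) * (fls_const s)\<^sup>2 = 1" using c0 s by simp
    have "(fls_const s)\<^sup>2 = fls_const c" using s by (simp only: fls_const_power[symmetric])
    then have "x\<^sup>2 * ((1 / x)\<^sup>2 + (fls_const s * y)\<^sup>2) = 1 + fls_const c * x\<^sup>2 * y\<^sup>2"
      using x_nonzero by (simp add: power_mult_distrib power_divide field_simps)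
    also have "\<dots> = x\<^sup>2 + y\<^sup>2" using equation by simp
    also have "\<dots> = x\<^sup>2 * (1 + (fls_const (1 / c) * (fls_const s)\<^sup>2) * (1 / x)\<^sup>2 * y\<^sup>2)"
      unfolding cs using x_nonzero by (simp add: power_divide field_simps)
    finally have "(1 / x)\<^sup>2 + (fls_const s * y)\<^sup>2 = 1 + (fls_const (1 / c) * (fls_const s)\<^sup>2) * (1 / x)\<^sup>2 * y\<^sup>2"
      using x_nonzero by simp
    then show "(1 / x)\<^sup>2 + (fls_const s * y)\<^sup>2 = 1 + fls_const (1 / c) * (1 / x)\<^sup>2 * (fls_const s * y)\<^sup>2"
      by (simp only: power_mult_distrib mult_ac)
    show "fls_const s * y \<notin> range fls_const"
    proof
      assume "fls_const s * y \<in> range fls_const"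
      then obtain a where "fls_const s * y = fls_const a" by auto
      then have "y = fls_const (1 / s * a)" using inv by (simp only: fls_const_mult)
      then show False using y_nonconst by blast
    qed
  qed (use two c0 c1 in auto)
  have "1 / (1 / x) \<in> generated_field (1 / x) (fls_const s * y)"
    by (intro generated_field_divide generated_field_1 generated_field_fst)
  then have "x \<in> generated_field (1 / x) (fls_const s * y)" by simp
  moreover have "fls_const (1 / s) * (fls_const s * y) \<in> generated_field (1 / x) (fls_const s * y)"
    by (intro generated_field_mult generated_field_const generated_field_snd)
  then have "y \<in> generated_field (1 / x) (fls_const s * y)" unfolding inv .
  ultimately show "generated_field (1 / x) (fls_const s * y) = generated_field x y"
    by (intro equalityI generated_field_mono) auto
qed

text \<open>The second coordinate is a Moebius function of y and can be inverted; then x is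
  recovered from the first coordinate. So both pairs generate the same field.\<close>

lemma generic_point_moebius:
  fixes r i c' :: 'a
  assumes r: "r ^ 4 = c" and i: "i\<^sup>2 = - 1"
    and c': "c' = ((1 + r) / (1 - r)) ^ 4" "c' \<noteq> 0" "c' \<noteq> 1"
  shows "\<exists>u w. generic_point c' u w \<and> generated_field u w = generated_field x y"
proof -
  have r1: "1 - r \<noteq> 0" "1 + r \<noteq> 0" "r \<noteq> 0"
    using r c0 c1 by (auto simp: add_eq_0_iff)
  define r' where "r' = (1 + r) / (1 - r)"
  have r': "r' * (1 - r) = 1 + r" "r' \<noteq> 0" using r1 by (simp_all add: r'_def)
  define R R' I where "R = fls_const r" and "R' = fls_const r'" and "I = fls_const i"
  have RK: "R \<in> generated_field p q" "R' \<in> generated_field p q" "I \<in> generated_field p q" for p q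
    by (simp_all add: R_def R'_def I_def)
  have R4: "R ^ 4 = fls_const c" "R' ^ 4 = fls_const c'"
    using r c'(1) by (simp_all add: R_def R'_def r'_def fls_const_power[symmetric])
  have "R' * (1 - R) = fls_const (r' * (1 - r))" by (simp only: R_def R'_def fls_const_mult fls_const_diff fls_const_1)
  then have R'R: "R' * (1 - R) = 1 + R" unfolding r'(1) by (simp only: R_def fls_const_add fls_const_1)
  have I2: "I\<^sup>2 = - 1" using i unfolding I_def by (simp add: fls_const_power[symmetric])
  have "1 - R = fls_const (1 - r)" "1 + R = fls_const (1 + r)"
    by (simp_all only: R_def fls_const_diff fls_const_add fls_const_1)
  then have Rnz: "1 - R \<noteq> 0" "1 + R \<noteq> 0" "R \<noteq> 0" "R' \<noteq> 0" "I \<noteq> 0"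
    using r1 r'(2) i by (auto simp: R_def R'_def I_def simp del: fls_const_1)
  have lin: "1 + fls_const a * y \<noteq> 0" for a
  proof -
    have "pev [:1, a:] y \<noteq> 0" by (subst pev_y_eq_0_iff) simp
    then show ?thesis by (simp add: mult.commute)
  qed
  have lins: "1 - R * y \<noteq> 0" "1 - y \<noteq> 0" "1 + y \<noteq> 0" "1 - R\<^sup>2 * y \<noteq> 0" "1 + R\<^sup>2 * y \<noteq> 0"
    using lin[of "- r"] lin[of "- 1"] lin[of 1] lin[of "- (r\<^sup>2)"] lin[of "r\<^sup>2"]
    by (simp_all add: R_def fls_const_power)
  define z where "z = (1 + R * y) / (R' * (1 - R * y))"
  define u where "u = I * (1 - R) * ((1 - y) * (1 - R\<^sup>2 * y)) / ((1 + R) * (x * (1 - R ^ 4 * y\<^sup>2)))"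
  have z: "z * (R' * (1 - R * y)) = 1 + R * y" using lins Rnz by (simp add: z_def)
  have den: "(1 + R) * (x * (1 - R ^ 4 * y\<^sup>2)) \<noteq> 0"
    using Rnz x_nonzero den_nonzero by (simp add: R4)
  then have u: "u * ((1 + R) * (x * (1 - R ^ 4 * y\<^sup>2))) = I * (1 - R) * ((1 - y) * (1 - R\<^sup>2 * y))"
    unfolding u_def by simp
  have u0: "u \<noteq> 0" unfolding u_def using den Rnz lins by simp
  have eq: "u\<^sup>2 * (1 - R' ^ 4 * z\<^sup>2) = 1 - z\<^sup>2"
    using Rnz lins x_nonzero den_nonzero R4 equation' R'R I2 z u
    by (intro moebius_equation[of R y x R' I]) simp_all
  \<comment> \<open>This shows that the denominator of the inverse Moebius transformation is not
    0.\<close>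
  have "(1 + R' * z) * (1 - R * y) = 2" using z by Groebner_Basis.algebra
  moreover have "(2::'a fls) \<noteq> 0" using two by (metis fls_const_eq_0_iff fls_const_numeral)
  ultimately have Rz: "1 + R' * z \<noteq> 0" by auto
  have y: "y * (R * (1 + R' * z)) = R' * z - 1" using z by Groebner_Basis.algebra
  have "generic_point c' u z"
  proof unfold_locales
    show "u\<^sup>2 + z\<^sup>2 = 1 + fls_const c' * u\<^sup>2 * z\<^sup>2"
      using eq unfolding R4 by Groebner_Basis.algebra
    show "z \<notin> range fls_const"
    proof
      assume "z \<in> range fls_const"
      then obtain a where a: "z = fls_const a" by auto
      have "1 + R' * z = fls_const (1 + r' * a)" "R' * z - 1 = fls_const (r' * a - 1)"
        unfolding a R'_def by (simp_all only: fls_const_add fls_const_diff fls_const_mult fls_const_1)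
      then have "y * fls_const (r * (1 + r' * a)) = fls_const (r' * a - 1)" and nz: "1 + r' * a \<noteq> 0"
        using y Rz by (simp_all add: R_def)
      moreover have "pev [:- e, b:] y = 0" if "y * fls_const b = fls_const e" for b e
        using that by simp
      ultimately have "pev [:- (r' * a - 1), r * (1 + r' * a):] y = 0" by blast
      then have "[:- (r' * a - 1), r * (1 + r' * a):] = 0" by (simp only: pev_y_eq_0_iff)
      then show False using r1(3) nz by simp
    qed
  qed (use two c' in auto)
  moreover have "generated_field u z = generated_field x y"
  proof (intro equalityI generated_field_mono)
    show "z \<in> generated_field x y" "u \<in> generated_field x y"
      unfolding z_def u_def by (intro generated_field_divide generated_field_mult generated_field_add
        generated_field_diff generated_field_power generated_field_1 generated_field_fst generated_field_snd RK)+
    have "y = (R' * z - 1) / (R * (1 + R' * z))" using y Rz Rnz by (simp add: nonzero_eq_divide_eq)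
    also have "\<dots> \<in> generated_field u z"
      by (intro generated_field_divide generated_field_mult generated_field_add
        generated_field_diff generated_field_1 generated_field_snd RK)
    finally show yK: "y \<in> generated_field u z" .
    have "x * (u * ((1 + R) * (1 - R ^ 4 * y\<^sup>2))) = I * (1 - R) * ((1 - y) * (1 - R\<^sup>2 * y))"
      using u by (simp only: mult_ac)
    moreover have "u * ((1 + R) * (1 - R ^ 4 * y\<^sup>2)) \<noteq> 0" using u0 den by simp
    ultimately have "x = I * (1 - R) * ((1 - y) * (1 - R\<^sup>2 * y)) / (u * ((1 + R) * (1 - R ^ 4 * y\<^sup>2)))"
      by (metis nonzero_mult_div_cancel_right)
    also have "\<dots> \<in> generated_field u z"
      by (intro generated_field_divide generated_field_mult generated_field_add
        generated_field_diff generated_field_power generated_field_1 generated_field_fst RK yK)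
    finally show "x \<in> generated_field u z" .
  qed
  ultimately show ?thesis by blast
qed

text \<open>Apart from c and 1 / c the listed values are ((1 + s) / (1 - s))^4 for the fourth roots
  s = r, - r, i r, - i r of c, so one Moebius construction covers them all.\<close>

lemma parameters_imp_generated_field_eq:
  assumes r: "r ^ 4 = c" and i: "i\<^sup>2 = - 1"
    and c': "c' \<in> isomorphic_parameters c r i" "c' \<noteq> 0" "c' \<noteq> 1"
  shows "\<exists>u w. generic_point c' u w \<and> generated_field u w = generated_field x y"
proof -
  have pow: "(- r) ^ 4 = c" "(i * r) ^ 4 = c" "(- (i * r)) ^ 4 = c"
  proof -
    have "i ^ 4 = (i\<^sup>2)\<^sup>2" by (simp flip: power_mult)
    then have "i ^ 4 = 1" using i by simp
    then show "(- r) ^ 4 = c" "(i * r) ^ 4 = c" "(- (i * r)) ^ 4 = c"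
      using r by (simp_all add: power_mult_distrib)
  qed
  consider "c' = c" | "c' = 1 / c" | "c' = ((1 + r) / (1 - r)) ^ 4" | "c' = ((1 + - r) / (1 - - r)) ^ 4"
    | "c' = ((1 + i * r) / (1 - i * r)) ^ 4" | "c' = ((1 + - (i * r)) / (1 - - (i * r))) ^ 4"
    using c'(1) unfolding isomorphic_parameters_def by auto
  then show ?thesis
  proof cases
    case 1
    then show ?thesis using generic_point_axioms by blast
  next
    case 2
    obtain s where "s\<^sup>2 = c" using nth_root_exists[of 2 c] by auto
    then show ?thesis unfolding 2 using generic_point_inverse_parameter by blast
  qed (use generic_point_moebius r pow i c'(2,3) in blast)+
qed

end

theorem theorem4p2:
  fixes d d' :: "'k::field"
    and r i :: "'k alg_closure"
  assumes "CHAR('k) \<noteq> 2"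
    and "d \<noteq> 0" and "d \<noteq> 1"
    and "d' \<noteq> 0" and "d' \<noteq> 1"
    and "r ^ 4 = to_ac d"
    and "i\<^sup>2 = -1"
  shows "isomorphic (edwards_curve (to_ac d)) (edwards_curve (to_ac d')) \<longleftrightarrow>
    to_ac d' \<in> {to_ac d, 1 / to_ac d,
      ((1 + r) / (1 - r)) ^ 4, ((1 - r) / (1 + r)) ^ 4,
      ((1 + i * r) / (1 - i * r)) ^ 4, ((1 - i * r) / (1 + i * r)) ^ 4}"
proof -
  let ?c = "to_ac d" and ?c' = "to_ac d'"
  have c: "?c \<noteq> 0" "?c \<noteq> 1" "?c' \<noteq> 0" "?c' \<noteq> 1"
    using assms(2-5) to_ac_eq_iff[of _ 1] by (simp_all del: to_ac_eq_iff)
  have "(2::'k) \<noteq> 0"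
  proof
    assume "(2::'k) = 0"
    then have "CHAR('k) dvd 2" by (metis of_nat_eq_0_iff_char_dvd of_nat_numeral)
    then have "CHAR('k) = 1" using assms(1) by (metis prime_nat_iff two_is_prime_nat)
    then show False by simp
  qed
  then have two: "(2::'k alg_closure) \<noteq> 0" by (metis to_ac_eq_0_iff to_ac_numeral)
  \<comment> \<open>At a = 0 both 1 - a^2 and 1 - c a^2 are 1, so the expansion exists for every
    parameter.\<close>
  obtain x y where G: "generic_point ?c x y"
    using series_point[OF two c(1,2), of 0] by auto
  obtain x' y' where H: "generic_point ?c' x' y'"
    using series_point[OF two c(3,4), of 0] by auto
  have edw: "isomorphic (nonsingular_curve (subfield_ring (generated_field u w)) fls_const) (edwards_curve e)"
    if "generic_point e u w" for e and u w :: "'k alg_closure fls"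
    using generic_point.edwards_curve_isomorphic[OF that] .
  have "isomorphic (edwards_curve ?c) (edwards_curve ?c') \<longleftrightarrow> ?c' \<in> isomorphic_parameters ?c r i"
  proof
    assume "isomorphic (edwards_curve ?c) (edwards_curve ?c')"
    then have "isomorphic (nonsingular_curve (subfield_ring (generated_field x y)) fls_const)
        (nonsingular_curve (subfield_ring (generated_field x' y')) fls_const)"
      using isomorphic_trans[OF isomorphic_trans[OF edw[OF G]] isomorphic_sym[OF edw[OF H]]] by blast
    from isomorphic_imp_generic_point[OF G H this]
    obtain u w where "generic_point ?c' u w" "generated_field u w = generated_field x y" by blast
    then show "?c' \<in> isomorphic_parameters ?c r i"
      using generated_field_eq_imp_parameters[OF G _ _ assms(6,7)] by blast
  next
    assume "?c' \<in> isomorphic_parameters ?c r i"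
    from generic_point.parameters_imp_generated_field_eq[OF G assms(6,7) this c(3,4)]
    obtain u w where uw: "generic_point ?c' u w" "generated_field u w = generated_field x y" by blast
    show "isomorphic (edwards_curve ?c) (edwards_curve ?c')"
      using isomorphic_trans[OF isomorphic_sym[OF edw[OF G]]] edw[OF uw(1)] unfolding uw(2) by blast
  qed
  then show ?thesis unfolding isomorphic_parameters_def .
qed

end
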